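(* Let $d,k$ be positive integers with $k\geq 3$ and let $\mathbb{F}\in\{\mathbb{R},\mathbb{C}\}$. Then, asymptotically almost surely (as $n\to\infty$), the random $k$-partite $k$-graph $G(n,M_d)\subseteq K_n^k$ is locally rigid in $\mathbb{F}^d$.
   Context: A $k$-graph is a $k$-uniform hypergraph. $K_n^k$ is the complete $k$-partite $k$-graph with vertex classes $V_1,\dots,V_k$, each of size $n$ (edges are all sets meeting each $V_i$ in exactly one vertex); $N=kn$ is its number of vertices. Subgraphs $G\subseteq K_n^k$ are taken on the full vertex set $V=V_1\cup\dots\cup V_k$. Random graphs: order the $n^k$ edges of $K_n^k$ uniformly at random and let $G(n,m)$ be the subgraph of $K_n^k$ on the full vertex set formed by the first $m$ edges. $M_d=\min\{m:\text{the minimum degree of }G(n,m)\text{ is at least }d\}$, where the degree of a vertex is the number of edges containing it; $G(n,M_d)$ is the graph of this process at the random time $M_d$. A property holds asymptotically almost surely if its probability tends to $1$ as $n\to\infty$. Rigidity: a $d$-dimensional point configuration is $\mathbf p=(p_v)_{v\in V}\in(\mathbb{F}^d)^N$, with $p_{v,j}$ the $j$-th coordinate of $p_v$; it is generic if its $dN$ coordinates are algebraically independent over $\mathbb{Q}$. The rigidity map is $f_G^d(\mathbf p)=\big(\sum_{j=1}^d\prod_{v\in e}p_{v,j}\big)_{e\in E(G)}$. Two configurations $\mathbf p,\mathbf q$ are congruent if there are a permutation matrix $\Sigma$ and invertible diagonal matrices $D_1,\dots,D_k$ in $GL(d,\mathbb{F})$ with $\prod_{i=1}^kD_i=I_d$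 such that $q_v=D_i\Sigma p_v$ for all $v\in V_i$ and all $i$. $(G,\mathbf p)$ is locally rigid if there is an open neighborhood $U$ of $\mathbf p$ in $(\mathbb{F}^d)^N$ such that every $\mathbf q\in U$ with $f_G^d(\mathbf q)=f_G^d(\mathbf p)$ is congruent to $\mathbf p$. $G$ is locally rigid in $\mathbb{F}^d$ if $(G,\mathbf p)$ is locally rigid for all generic $\mathbf p\in(\mathbb{F}^d)^N$. *)

theory Defs
  imports
    "HOL-Probability.Probability"
    "HOL-Combinatorics.Multiset_Permutations"
    "HOL-Library.Poly_Mapping"
    Jordan_Normal_Form.Matrix
begin

section \<open>The complete \<open>k\<close>-partite \<open>k\<close>-graph and its subgraphs\<close>

text \<open>The vertex \<open>(i, a)\<close> is the \<open>a\<close>-th vertex of the \<open>i\<close>-th class; classes are numbered from 0.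
  All subgraphs of \<open>K\<^sub>n\<^sup>k\<close> live on the full vertex set, so a subgraph is given by its edge set.\<close>

type_synonym vertex = "nat \<times> nat"

definition vertex_class :: "nat \<Rightarrow> nat \<Rightarrow> vertex set" where
  "vertex_class n i = {i} \<times> {..<n}"

definition vertices :: "nat \<Rightarrow> nat \<Rightarrow> vertex set" where
  "vertices k n = (\<Union>i<k. vertex_class n i)"

definition complete_edges :: "nat \<Rightarrow> nat \<Rightarrow> vertex set set" where
  "complete_edges k n = {e. e \<subseteq> vertices k n \<and> (\<forall>i<k. card (e \<inter> vertex_class n i) = 1)}"

definition degree_in :: "vertex set set \<Rightarrow> vertex \<Rightarrow> nat" where
  "degree_in G v = card {e \<in> G. v \<in> e}"


section \<open>The random graph process\<close>

definition edge_order :: "nat \<Rightarrow> nat \<Rightarrow> vertex set list pmf" where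
  "edge_order k n = pmf_of_set (permutations_of_set (complete_edges k n))"

definition process_graph :: "vertex set list \<Rightarrow> nat \<Rightarrow> vertex set set" where
  "process_graph es m = set (take m es)"

text \<open>If \<open>n ^ (k - 1) < d\<close>, then no graph of the process has minimum degree at least \<open>d\<close> and the
  value below is unspecified. For fixed \<open>k \<ge> 2\<close> and \<open>d\<close> this concerns only finitely many \<open>n\<close>.\<close>

definition hitting_time :: "nat \<Rightarrow> nat \<Rightarrow> nat \<Rightarrow> vertex set list \<Rightarrow> nat" where
  "hitting_time k n d es =
     (LEAST m. \<forall>v\<in>vertices k n. d \<le> degree_in (process_graph es m) v)"


section \<open>Configurations\<close>

text \<open>A configuration is identified with its family of coordinates \<open>p (v, j) = p\<^sub>v\<^sub>,\<^sub>j\<close>, an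
  (extensional) element of \<open>\<bbbF>\<close> to the power \<open>V \<times> {..<d}\<close>, topologised as a finite product.\<close>

type_synonym 'a config = "vertex \<times> nat \<Rightarrow> 'a"

definition config_topology :: "vertex set \<Rightarrow> nat \<Rightarrow> 'a::topological_space config topology" where
  "config_topology V d = product_topology (\<lambda>_. euclidean) (V \<times> {..<d})"

definition point :: "nat \<Rightarrow> 'a config \<Rightarrow> vertex \<Rightarrow> 'a Matrix.vec" where
  "point d p v = Matrix.vec d (\<lambda>j. p (v, j))"

text \<open>Polynomials over \<open>\<rat>\<close> in indeterminates indexed by \<open>'x\<close>: finitely supported maps from
  monomials (finitely supported exponent functions) to coefficients.\<close>

definition eval_monomial :: "('x \<Rightarrow>\<^sub>0 nat) \<Rightarrow> ('x \<Rightarrow> 'a) \<Rightarrow> 'a::comm_monoid_mult" where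
  "eval_monomial m x = (\<Prod>i\<in>Poly_Mapping.keys m. x i ^ Poly_Mapping.lookup m i)"

definition eval_rat_poly :: "(('x \<Rightarrow>\<^sub>0 nat) \<Rightarrow>\<^sub>0 rat) \<Rightarrow> ('x \<Rightarrow> 'a) \<Rightarrow> 'a::field_char_0" where
  "eval_rat_poly P x =
     (\<Sum>m\<in>Poly_Mapping.keys P. of_rat (Poly_Mapping.lookup P m) * eval_monomial m x)"

definition algebraically_independent :: "'x set \<Rightarrow> ('x \<Rightarrow> 'a::field_char_0) \<Rightarrow> bool" where
  "algebraically_independent I x \<longleftrightarrow>
     (\<forall>P. (\<forall>m\<in>Poly_Mapping.keys P. Poly_Mapping.keys m \<subseteq> I) \<and> eval_rat_poly P x = 0 \<longrightarrow> P = 0)"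

definition generic :: "vertex set \<Rightarrow> nat \<Rightarrow> 'a::field_char_0 config \<Rightarrow> bool" where
  "generic V d p \<longleftrightarrow> algebraically_independent (V \<times> {..<d}) p"


section \<open>Rigidity\<close>

definition rigidity_map ::
    "vertex set set \<Rightarrow> nat \<Rightarrow> 'a::comm_semiring_1 config \<Rightarrow> vertex set \<Rightarrow> 'a" where
  "rigidity_map G d p = (\<lambda>e\<in>G. \<Sum>j<d. \<Prod>v\<in>e. p (v, j))"

definition permutation_mat :: "nat \<Rightarrow> 'a::zero_neq_one mat \<Rightarrow> bool" where
  "permutation_mat d S \<longleftrightarrow>
     (\<exists>\<pi>. \<pi> permutes {..<d} \<and> S = Matrix.mat d d (\<lambda>(i, j). if i = \<pi> j then 1 else 0))"

definition congruent_configs ::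
    "nat \<Rightarrow> nat \<Rightarrow> nat \<Rightarrow> 'a::field config \<Rightarrow> 'a config \<Rightarrow> bool" where
  "congruent_configs k n d p q \<longleftrightarrow>
     (\<exists>S D. permutation_mat d S \<and>
        (\<forall>i<k. D i \<in> carrier_mat d d \<and> diagonal_mat (D i) \<and> invertible_mat (D i)) \<and>
        foldr (*) (map D [0..<k]) (1\<^sub>m d) = 1\<^sub>m d \<and>
        (\<forall>i<k. \<forall>v\<in>vertex_class n i. point d q v = D i *\<^sub>v (S *\<^sub>v point d p v)))"

definition locally_rigid_at ::
    "nat \<Rightarrow> nat \<Rightarrow> nat \<Rightarrow> vertex set set \<Rightarrow> 'a::real_normed_field config \<Rightarrow> bool" where
  "locally_rigid_at k n d G p \<longleftrightarrow>
     (\<exists>U. openin (config_topology (vertices k n) d) U \<and> p \<in> U \<and>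
        (\<forall>q\<in>U. rigidity_map G d q = rigidity_map G d p \<longrightarrow> congruent_configs k n d p q))"

definition locally_rigid ::
    "'a::real_normed_field itself \<Rightarrow> nat \<Rightarrow> nat \<Rightarrow> nat \<Rightarrow> vertex set set \<Rightarrow> bool" where
  "locally_rigid _ k n d G \<longleftrightarrow>
     (\<forall>p :: 'a config. p \<in> topspace (config_topology (vertices k n) d) \<and> generic (vertices k n) d p
        \<longrightarrow> locally_rigid_at k n d G p)"

end

theory Submission
  imports Defs "HOL-Real_Asymp.Real_Asymp"
begin

text \<open>
Local rigidity at all generic configurations is reduced to linear algebra at one special
configuration. Give every vertex \<open>v\<close> its own prime \<open>t\<^sub>v\<close> and put \<open>p\<^sub>v\<^sub>,\<^sub>j = t\<^sub>v\<^sup>j\<close>. Call a set \<open>C\<close> of vertices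
locked by an edge set \<open>S\<close> if every infinitesimal motion of \<open>S\<close> at this configuration agrees on \<open>C\<close>
with the derivative of a family of congruences. If \<open>G\<close> locks all vertices, then the Jacobian of
the rigidity map has its largest possible rank at the special configuration, hence at every generic
one, because a rational polynomial that is nonzero somewhere is nonzero at algebraically independent
arguments. Maximal rank makes a generic configuration isolated in its fibre once the rescalings are
used up (\<open>locked_imp_locally_rigid\<close>).

Locked sets grow in two ways. A vertex with \<open>d\<close> edges into a locked set is locked too: the products
of the primes on these edges are distinct by unique factorisation, so the coefficients form an
invertible Vandermonde matrix (\<open>locked_extend\<close>). And \<open>d\<close> vertices in each of \<open>k \<ge> 3\<close> classes are
locked as soon as all \<open>d\<^sup>k\<close> edges between them are implied, that is, vanish on all motions
(\<open>locked_seed\<close>). Implied edges need not be present, and this is what makes sparse graphs tractable.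
As long as more than \<open>\<epsilon> n\<^sup>k\<close> edges are not implied, the next edge of the process reduces the
dimension of the space of motions with probability at least \<open>\<epsilon>\<close>; this can happen at most \<open>d k n\<close>
times. So after \<open>c n\<close> steps all but \<open>\<epsilon> n\<^sup>k\<close> edges are implied (\<open>prob_few_implied\<close>), and a counting
argument then gives a seed from which almost all vertices of each class are locked
(\<open>dense_implied_imp_locked\<close>). Let \<open>C\<close> be this core.

At time \<open>m\<^sub>1\<close>, which is 0.9 times \<open>n ln n\<close>, the few leftover vertices are those that still have fewer
than \<open>d\<close> later edges into \<open>C\<close>. A given pair of vertices is left over with probability well below
\<open>n\<^sup>-\<^sup>1\<close>, whereas only \<open>O(n ln n)\<close> pairs share an edge by time \<open>m\<^sub>2\<close>, which is \<open>8 n ln n\<close>. So with high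
probability no edge present at time \<open>m\<^sub>2\<close> contains two leftover vertices
(\<open>prob_close_leftover_pair\<close>). The hitting time lies between \<open>m\<^sub>1\<close>, when some vertex is still
isolated (\<open>prob_no_isolated\<close>), and \<open>m\<^sub>2\<close>, when all degrees are at least \<open>d\<close> (\<open>prob_small_degree\<close>). At
the hitting time each leftover vertex therefore has \<open>d\<close> edges whose other ends are all locked, and
so the whole vertex set is locked (\<open>locked_if_leftover_spread\<close>).

The estimates for the random order all come from one induction along the order, carried out in the
locale \<open>progress\<close>.
\<close>


section \<open>Linear algebra over finite index sets\<close>

definition linear_form :: "(('i \<Rightarrow> 'a::field) \<Rightarrow> 'a) \<Rightarrow> bool" where
  "linear_form a \<longleftrightarrow> (\<forall>x y c. a (\<lambda>i. x i + c * y i) = a x + c * a y)"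

lemma linear_formD: "linear_form a \<Longrightarrow> a (\<lambda>i. x i + c * y i) = a x + c * a y"
  unfolding linear_form_def by blast

lemma linear_form_coordinate: "linear_form (\<lambda>x. x i)"
  by (simp add: linear_form_def)

text \<open>Induction on the number of forms. If \<open>a f\<close> does not vanish on the common kernel of the other forms,
choose \<open>z\<close> in that kernel with \<open>a f z \<noteq> 0\<close>. Subtracting a multiple of \<open>a f\<close> from \<open>b\<close> so that the
difference vanishes at \<open>z\<close> makes it vanish on the whole kernel of the other forms. Vectors are
functions on an arbitrary index type, so that the dimension can depend on \<open>n\<close>.\<close>

lemma linear_form_combination:
  fixes a :: "'e \<Rightarrow> ('i \<Rightarrow> 'a::field) \<Rightarrow> 'a"
  assumes "finite E" "\<And>e. e \<in> E \<Longrightarrow> linear_form (a e)" "linear_form b"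
    and "\<And>x. (\<And>e. e \<in> E \<Longrightarrow> a e x = 0) \<Longrightarrow> b x = 0"
  shows "\<exists>c. \<forall>x. b x = (\<Sum>e\<in>E. c e * a e x)"
  using assms
proof (induction E arbitrary: b rule: finite_induct)
  case empty
  then show ?case by simp
next
  case (insert f E)
  show ?case
  proof (cases "\<forall>x. (\<forall>e\<in>E. a e x = 0) \<longrightarrow> a f x = 0")
    case True
    have "\<exists>c. \<forall>x. b x = (\<Sum>e\<in>E. c e * a e x)"
    proof (rule insert.IH)
      fix x assume "\<And>e. e \<in> E \<Longrightarrow> a e x = 0"
      then show "b x = 0" using True insert.prems(3)[of x] by blast
    qed (use insert.prems in auto)
    then obtain c where c: "\<forall>x. b x = (\<Sum>e\<in>E. c e * a e x)" by blast
    have "b x = (\<Sum>e\<in>insert f E. (c(f := 0)) e * a e x)" for x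
      using c insert.hyps by (auto intro!: sum.cong)
    then show ?thesis by blast
  next
    case False
    then obtain z where z: "\<And>e. e \<in> E \<Longrightarrow> a e z = 0" "a f z \<noteq> 0" by blast
    define \<gamma> where "\<gamma> = b z / a f z"
    have "\<exists>c. \<forall>x. b x - \<gamma> * a f x = (\<Sum>e\<in>E. c e * a e x)"
    proof (rule insert.IH)
      show "linear_form (\<lambda>x. b x - \<gamma> * a f x)"
        using insert.prems(1)[of f] insert.prems(2)
        by (simp add: linear_form_def algebra_simps)
      fix x assume x: "\<And>e. e \<in> E \<Longrightarrow> a e x = 0"
      let ?y = "\<lambda>i. x i + (- (a f x / a f z)) * z i"
      have "b ?y = 0"
      proof (rule insert.prems(3))
        fix e assume e: "e \<in> insert f E"
        have "a e ?y = a e x + (- (a f x / a f z)) * a e z"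
          using insert.prems(1)[OF e] by (rule linear_formD)
        then show "a e ?y = 0" using e x z by auto
      qed
      moreover have "b ?y = b x + (- (a f x / a f z)) * b z"
        using insert.prems(2) by (rule linear_formD)
      ultimately show "b x - \<gamma> * a f x = 0"
        by (simp add: \<gamma>_def)
    qed (use insert.prems in auto)
    then obtain c where c: "\<forall>x. b x - \<gamma> * a f x = (\<Sum>e\<in>E. c e * a e x)" by blast
    have "b x = (\<Sum>e\<in>insert f E. (c(f := \<gamma>)) e * a e x)" for x
    proof -
      have "(\<Sum>e\<in>insert f E. (c(f := \<gamma>)) e * a e x) = \<gamma> * a f x + (\<Sum>e\<in>E. (c(f := \<gamma>)) e * a e x)"
        using insert.hyps by simp
      also have "(\<Sum>e\<in>E. (c(f := \<gamma>)) e * a e x) = (\<Sum>e\<in>E. c e * a e x)"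
        using insert.hyps by (intro sum.cong) auto
      finally show ?thesis using c[rule_format, of x] by (simp add: algebra_simps)
    qed
    then show ?thesis by blast
  qed
qed

text \<open>Fraction-free Gaussian elimination, run over the ring and read through both homomorphisms: a pivot
that is nonzero under \<open>\<phi>\<close> is nonzero under \<open>\<psi>\<close>. The homomorphisms will be the evaluations of
polynomials at the special and at a generic configuration, and \<open>S\<close> the polynomials in the coordinates
of the configuration.\<close>

lemma injective_specialisation:
  fixes \<phi> :: "'r::comm_ring_1 \<Rightarrow> 'a::field" and \<psi> :: "'r \<Rightarrow> 'b::field"
    and M :: "'e \<Rightarrow> 'i \<Rightarrow> 'r"
  assumes "finite J"
    and closed: "\<And>x y. x \<in> S \<Longrightarrow> y \<in> S \<Longrightarrow> x * y \<in> S" "\<And>x y. x \<in> S \<Longrightarrow> y \<in> S \<Longrightarrow> x - y \<in> S"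
    and hom\<phi>: "\<And>x y. \<phi> (x * y) = \<phi> x * \<phi> y" "\<And>x y. \<phi> (x - y) = \<phi> x - \<phi> y"
    and hom\<psi>: "\<And>x y. \<psi> (x * y) = \<psi> x * \<psi> y" "\<And>x y. \<psi> (x - y) = \<psi> x - \<psi> y"
    and nz: "\<And>x. x \<in> S \<Longrightarrow> \<phi> x \<noteq> 0 \<Longrightarrow> \<psi> x \<noteq> 0"
    and "\<And>e j. e \<in> E \<Longrightarrow> j \<in> J \<Longrightarrow> M e j \<in> S"
    and "\<And>h. (\<And>e. e \<in> E \<Longrightarrow> (\<Sum>j\<in>J. \<phi> (M e j) * h j) = 0) \<Longrightarrow> \<forall>j\<in>J. h j = 0"
    and "\<And>e. e \<in> E \<Longrightarrow> (\<Sum>j\<in>J. \<psi> (M e j) * h j) = 0"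
  shows "\<forall>j\<in>J. h j = 0"
  using assms(1,9-)
proof (induction J arbitrary: M rule: finite_induct)
  case empty
  then show ?case by simp
next
  case (insert i J)
  note fin = \<open>finite J\<close> and iJ = \<open>i \<notin> J\<close>
  have "\<exists>e\<in>E. \<phi> (M e i) \<noteq> 0"
  proof (rule ccontr)
    assume none: "\<not> ?thesis"
    then have "\<forall>j\<in>insert i J. (if j = i then 1 else 0 :: 'a) = 0"
    proof (intro insert.prems(2))
      fix e assume "e \<in> E"
      have "(\<Sum>j\<in>insert i J. \<phi> (M e j) * (if j = i then 1 else 0)) = \<phi> (M e i)"
        using fin iJ by (simp add: if_distrib sum.If_cases cong: if_cong)
      then show "(\<Sum>j\<in>insert i J. \<phi> (M e j) * (if j = i then 1 else 0)) = 0"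
        using none \<open>e \<in> E\<close> by auto
    qed
    then show False by simp
  qed
  then obtain e0 where e0: "e0 \<in> E" "\<phi> (M e0 i) \<noteq> 0" by blast
  define a where "a = M e0 i"
  have aS: "a \<in> S" and a\<phi>: "\<phi> a \<noteq> 0" and a\<psi>: "\<psi> a \<noteq> 0"
    using e0 insert.prems(1) nz by (auto simp: a_def)
  \<comment> \<open>Eliminate the unknown \<open>i\<close> from all rows by means of the pivot row \<open>e0\<close>.\<close>
  define M' where "M' e j = a * M e j - M e i * M e0 j" for e j
  have IH: "\<forall>j\<in>J. h j = 0"
  proof (rule insert.IH[of M'])
    show "M' e j \<in> S" if "e \<in> E" "j \<in> J" for e j
      unfolding M'_def using that aS insert.prems(1) e0(1) by (intro closed) auto
  next
    fix g :: "'i \<Rightarrow> 'a" assume g: "\<And>e. e \<in> E \<Longrightarrow> (\<Sum>j\<in>J. \<phi> (M' e j) * g j) = 0"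
    define g' where "g' = g(i := - (\<Sum>j\<in>J. \<phi> (M e0 j) * g j) / \<phi> a)"
    have "\<forall>j\<in>insert i J. g' j = 0"
    proof (rule insert.prems(2))
      fix e assume e: "e \<in> E"
      have "(\<Sum>j\<in>insert i J. \<phi> (M e j) * g' j) = \<phi> (M e i) * g' i + (\<Sum>j\<in>J. \<phi> (M e j) * g' j)"
        using fin iJ by simp
      also have "(\<Sum>j\<in>J. \<phi> (M e j) * g' j) = (\<Sum>j\<in>J. \<phi> (M e j) * g j)"
        using iJ by (intro sum.cong) (auto simp: g'_def)
      finally have 1: "(\<Sum>j\<in>insert i J. \<phi> (M e j) * g' j) =
          \<phi> (M e i) * g' i + (\<Sum>j\<in>J. \<phi> (M e j) * g j)" .
      have "0 = \<phi> a * (\<Sum>j\<in>J. \<phi> (M e j) * g j) - \<phi> (M e i) * (\<Sum>j\<in>J. \<phi> (M e0 j) * g j)"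
        using g[OF e] by (simp add: M'_def hom\<phi> algebra_simps sum_subtractf sum_distrib_left)
      then show "(\<Sum>j\<in>insert i J. \<phi> (M e j) * g' j) = 0"
        unfolding 1 using a\<phi> by (simp add: g'_def field_simps)
    qed
    then show "\<forall>j\<in>J. g j = 0" using iJ by (auto simp: g'_def split: if_splits)
  next
    fix e assume e: "e \<in> E"
    have s: "(\<Sum>j\<in>J. \<psi> (M f j) * h j) = - \<psi> (M f i) * h i" if "f \<in> E" for f
      using insert.prems(3)[OF that] fin iJ by (simp add: add_eq_0_iff)
    have "(\<Sum>j\<in>J. \<psi> (M' e j) * h j) =
        \<psi> a * (\<Sum>j\<in>J. \<psi> (M e j) * h j) - \<psi> (M e i) * (\<Sum>j\<in>J. \<psi> (M e0 j) * h j)"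
      by (simp add: M'_def hom\<psi> algebra_simps sum_subtractf sum_distrib_left)
    also have "\<dots> = 0"
      using s[OF e] s[OF e0(1)] by (simp add: a_def)
    finally show "(\<Sum>j\<in>J. \<psi> (M' e j) * h j) = 0" .
  qed
  have "\<psi> a * h i = 0"
    using insert.prems(3)[OF e0(1)] fin iJ IH by (simp add: a_def)
  then show ?case using a\<psi> IH by simp
qed

section \<open>Evaluation of rational polynomials\<close>

lemma eval_monomial_superset:
  assumes "finite A" "Poly_Mapping.keys m \<subseteq> A"
  shows "eval_monomial m x = (\<Prod>i\<in>A. x i ^ Poly_Mapping.lookup m i)"
  unfolding eval_monomial_def using assms
  by (intro prod.mono_neutral_left) (auto simp: in_keys_iff)

lemma eval_monomial_add: "eval_monomial (m + m') x = eval_monomial m x * eval_monomial m' x"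
proof -
  let ?A = "Poly_Mapping.keys m \<union> Poly_Mapping.keys m'"
  have "Poly_Mapping.keys (m + m') \<subseteq> ?A" by (rule keys_add)
  then show ?thesis
    by (simp add: eval_monomial_superset[of ?A] lookup_add power_add prod.distrib)
qed

lemma eval_rat_poly_superset:
  assumes "finite A" "Poly_Mapping.keys P \<subseteq> A"
  shows "eval_rat_poly P x = (\<Sum>m\<in>A. of_rat (Poly_Mapping.lookup P m) * eval_monomial m x)"
  unfolding eval_rat_poly_def using assms
  by (intro sum.mono_neutral_left) (auto simp: in_keys_iff)

lemma eval_rat_poly_add: "eval_rat_poly (P + Q) x = eval_rat_poly P x + eval_rat_poly Q x"
proof -
  let ?A = "Poly_Mapping.keys P \<union> Poly_Mapping.keys Q"
  have "Poly_Mapping.keys (P + Q) \<subseteq> ?A" by (rule keys_add)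
  then show ?thesis
    by (simp add: eval_rat_poly_superset[of ?A] lookup_add of_rat_add algebra_simps sum.distrib)
qed

lemma eval_rat_poly_0: "eval_rat_poly 0 x = 0"
  by (simp add: eval_rat_poly_def)

lemma eval_rat_poly_diff: "eval_rat_poly (P - Q) x = eval_rat_poly P x - eval_rat_poly Q x"
  using eval_rat_poly_add[of "P - Q" Q x] by simp

lemma eval_rat_poly_single:
  "eval_rat_poly (Poly_Mapping.single m c) x = of_rat c * eval_monomial m x"
  by (cases "c = 0") (simp_all add: eval_rat_poly_def)

text \<open>Multiplicativity of the evaluation reduces to monomials through this expansion.\<close>

lemma poly_mapping_sum_single:
  "P = (\<Sum>m\<in>Poly_Mapping.keys P. Poly_Mapping.single m (Poly_Mapping.lookup P m))"
proof (rule poly_mapping_eqI)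
  fix m
  show "Poly_Mapping.lookup P m =
      Poly_Mapping.lookup (\<Sum>m\<in>Poly_Mapping.keys P. Poly_Mapping.single m (Poly_Mapping.lookup P m)) m"
    by (simp add: lookup_sum lookup_single when_def sum.If_cases in_keys_iff)
qed

lemma eval_rat_poly_sum: "eval_rat_poly (sum f A) x = (\<Sum>a\<in>A. eval_rat_poly (f a) x)"
  by (induction A rule: infinite_finite_induct) (auto simp: eval_rat_poly_0 eval_rat_poly_add)

lemma eval_rat_poly_mult: "eval_rat_poly (P * Q) x = eval_rat_poly P x * eval_rat_poly Q x"
proof -
  have "P * Q = (\<Sum>m\<in>Poly_Mapping.keys P. \<Sum>m'\<in>Poly_Mapping.keys Q.
      Poly_Mapping.single (m + m') (Poly_Mapping.lookup P m * Poly_Mapping.lookup Q m'))"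
    by (subst poly_mapping_sum_single[of P], subst poly_mapping_sum_single[of Q])
      (simp add: sum_product mult_single)
  then show ?thesis
    by (simp add: eval_rat_poly_sum eval_rat_poly_single eval_rat_poly_def[of P] eval_rat_poly_def[of Q]
        sum_product eval_monomial_add of_rat_mult algebra_simps)
qed

definition polys_over :: "'x set \<Rightarrow> (('x \<Rightarrow>\<^sub>0 nat) \<Rightarrow>\<^sub>0 rat) set" where
  "polys_over I = {P. \<forall>m\<in>Poly_Mapping.keys P. Poly_Mapping.keys m \<subseteq> I}"

definition indeterminate :: "'x \<Rightarrow> (('x \<Rightarrow>\<^sub>0 nat) \<Rightarrow>\<^sub>0 rat)" where
  "indeterminate i = Poly_Mapping.single (Poly_Mapping.single i 1) 1"

lemma polys_over_diff: "P \<in> polys_over I \<Longrightarrow> Q \<in> polys_over I \<Longrightarrow> P - Q \<in> polys_over I"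
  unfolding polys_over_def using keys_diff[of P Q] by blast

lemma polys_over_mult: "P \<in> polys_over I \<Longrightarrow> Q \<in> polys_over I \<Longrightarrow> P * Q \<in> polys_over I"
  unfolding polys_over_def using keys_mult[of P Q] keys_add[where 'a = 'a and 'b = nat] by blast

lemma polys_over_0: "0 \<in> polys_over I" and polys_over_1: "1 \<in> polys_over I"
  by (auto simp: polys_over_def)

lemma polys_over_indeterminate: "i \<in> I \<Longrightarrow> indeterminate i \<in> polys_over I"
  by (simp add: polys_over_def indeterminate_def)

lemma polys_over_prod: "(\<And>a. a \<in> A \<Longrightarrow> f a \<in> polys_over I) \<Longrightarrow> prod f A \<in> polys_over I"
  by (induction A rule: infinite_finite_induct) (auto simp: polys_over_1 polys_over_mult)

lemma eval_rat_poly_1: "eval_rat_poly 1 x = 1"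
  using eval_rat_poly_single[of 0 1 x] by (simp add: eval_monomial_def)

lemma eval_rat_poly_indeterminate: "eval_rat_poly (indeterminate i) x = x i"
  by (simp add: indeterminate_def eval_rat_poly_single eval_monomial_def)

lemma eval_rat_poly_prod: "eval_rat_poly (prod f A) x = (\<Prod>a\<in>A. eval_rat_poly (f a) x)"
  by (induction A rule: infinite_finite_induct) (auto simp: eval_rat_poly_1 eval_rat_poly_mult)

lemma generic_eval_nonzero:
  assumes "algebraically_independent I x" "P \<in> polys_over I" "P \<noteq> 0"
  shows "eval_rat_poly P x \<noteq> 0"
  using assms unfolding algebraically_independent_def polys_over_def by blast

text \<open>Evaluation at a generic point has no nonzero polynomial in its kernel, so that any rational point can
serve as the first specialisation in \<open>injective_specialisation\<close>.\<close>

lemma generic_injective: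
  fixes q :: "'x \<Rightarrow> rat" and p :: "'x \<Rightarrow> 'a::field_char_0"
  assumes "algebraically_independent I p" "finite J"
    and "\<And>e j. e \<in> E \<Longrightarrow> j \<in> J \<Longrightarrow> M e j \<in> polys_over I"
    and "\<And>h. (\<And>e. e \<in> E \<Longrightarrow> (\<Sum>j\<in>J. eval_rat_poly (M e j) q * h j) = 0) \<Longrightarrow> \<forall>j\<in>J. h j = 0"
    and "\<And>e. e \<in> E \<Longrightarrow> (\<Sum>j\<in>J. eval_rat_poly (M e j) p * h j) = 0"
  shows "\<forall>j\<in>J. h j = 0"
proof (rule injective_specialisation[where \<phi> = "\<lambda>P. eval_rat_poly P q" and \<psi> = "\<lambda>P. eval_rat_poly P p"
      and S = "polys_over I" and E = E and M = M])
  show "eval_rat_poly P p \<noteq> 0" if "P \<in> polys_over I" "eval_rat_poly P q \<noteq> 0" for P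
  proof -
    from that(2) have "P \<noteq> 0" by (metis eval_rat_poly_0)
    then show ?thesis using generic_eval_nonzero[OF assms(1) that(1)] by blast
  qed
qed (use assms in \<open>auto simp: polys_over_mult polys_over_diff eval_rat_poly_mult eval_rat_poly_diff\<close>)



section \<open>Edges as functions\<close>

text \<open>An edge of the complete \<open>k\<close>-partite \<open>k\<close>-graph is the graph of a choice of one vertex from each class.
This turns sums over edges into sums over function spaces, to which \<open>prod_sum_PiE\<close> applies.\<close>

definition transversal :: "nat \<Rightarrow> (nat \<Rightarrow> nat) \<Rightarrow> vertex set" where
  "transversal k g = (\<lambda>i. (i, g i)) ` {..<k}"

lemma mem_transversal: "v \<in> transversal k g \<longleftrightarrow> fst v < k \<and> snd v = g (fst v)"
  by (cases v) (auto simp: transversal_def)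

lemma sum_transversal: "(\<Sum>v\<in>transversal k g. f v) = (\<Sum>i<k. f (i, g i))"
  unfolding transversal_def by (subst sum.reindex) (auto simp: inj_on_def)

lemma prod_transversal: "(\<Prod>v\<in>transversal k g. f v) = (\<Prod>i<k. f (i, g i))"
  unfolding transversal_def by (subst prod.reindex) (auto simp: inj_on_def)

lemma finite_transversal: "finite (transversal k g)"
  by (simp add: transversal_def)

lemma mem_vertices: "v \<in> vertices k n \<longleftrightarrow> fst v < k \<and> snd v < n"
  by (cases v) (auto simp: vertices_def vertex_class_def)

lemma finite_vertices: "finite (vertices k n)"
  by (simp add: vertices_def vertex_class_def)

lemma complete_edges_eq: "complete_edges k n = transversal k ` ({..<k} \<rightarrow>\<^sub>E {..<n})"
proof (intro equalityI subsetI)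
  fix e assume "e \<in> complete_edges k n"
  then have sub: "e \<subseteq> vertices k n" and one: "\<And>i. i < k \<Longrightarrow> card (e \<inter> vertex_class n i) = 1"
    by (auto simp: complete_edges_def)
  have "\<exists>a. e \<inter> vertex_class n i = {(i, a)} \<and> a < n" if i: "i < k" for i
  proof -
    obtain v where v: "e \<inter> vertex_class n i = {v}" using one[OF i] by (auto simp: card_1_singleton_iff)
    then have "v \<in> vertex_class n i" by blast
    with v show ?thesis by (auto simp: vertex_class_def)
  qed
  then obtain a where a: "\<And>i. i < k \<Longrightarrow> e \<inter> vertex_class n i = {(i, a i)} \<and> a i < n" by metis
  define g where "g = restrict a {..<k}"
  have "v \<in> e \<longleftrightarrow> v \<in> transversal k g" for v
  proof
    assume v: "v \<in> e"
    with sub have fv: "fst v < k" "snd v < n" by (auto simp: mem_vertices)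
    then have "fst v < k" by simp
    moreover have "v \<in> e \<inter> vertex_class n (fst v)"
      using v fv by (cases v) (auto simp: vertex_class_def)
    ultimately have "v = (fst v, a (fst v))" using a[of "fst v"] by blast
    then have "snd v = a (fst v)" by (metis snd_conv)
    then show "v \<in> transversal k g" using \<open>fst v < k\<close> by (simp add: mem_transversal g_def)
  next
    assume "v \<in> transversal k g"
    then have "fst v < k" "v = (fst v, a (fst v))" by (auto simp: mem_transversal g_def prod_eq_iff)
    then show "v \<in> e" using a[of "fst v"] by (metis IntD1 insertI1)
  qed
  then have "e = transversal k g" by blast
  moreover have "g \<in> {..<k} \<rightarrow>\<^sub>E {..<n}" using a by (auto simp: g_def)
  ultimately show "e \<in> transversal k ` ({..<k} \<rightarrow>\<^sub>E {..<n})" by blast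
next
  fix e assume "e \<in> transversal k ` ({..<k} \<rightarrow>\<^sub>E {..<n})"
  then obtain g where g: "g \<in> {..<k} \<rightarrow>\<^sub>E {..<n}" "e = transversal k g" by blast
  have "e \<inter> vertex_class n i = {(i, g i)}" if "i < k" for i
    using that g by (auto simp: mem_transversal vertex_class_def PiE_iff)
  then show "e \<in> complete_edges k n"
    using g by (auto simp: complete_edges_def mem_vertices mem_transversal PiE_iff)
qed

lemma complete_edgesE:
  assumes "e \<in> complete_edges k n"
  obtains g where "g \<in> {..<k} \<rightarrow>\<^sub>E {..<n}" "e = transversal k g"
  using assms unfolding complete_edges_eq by blast

lemma inj_on_transversal: "inj_on (transversal k) (Pi\<^sub>E {..<k} X)"
proof
  fix g h assume gh: "g \<in> Pi\<^sub>E {..<k} X" "h \<in> Pi\<^sub>E {..<k} X" "transversal k g = transversal k h"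
  show "g = h"
  proof (rule PiE_ext[OF gh(1,2)])
    fix i assume "i \<in> {..<k}"
    then have "(i, g i) \<in> transversal k g" by (simp add: mem_transversal)
    then show "g i = h i" unfolding gh(3) by (simp add: mem_transversal)
  qed
qed

lemma finite_complete_edges: "finite (complete_edges k n)"
  by (simp add: complete_edges_eq finite_PiE)

lemma card_complete_edges: "card (complete_edges k n) = n ^ k"
  by (simp add: complete_edges_eq card_image inj_on_transversal card_PiE)

lemma finite_edge: "e \<in> complete_edges k n \<Longrightarrow> finite e"
  unfolding complete_edges_eq using finite_transversal by blast

lemma transversal_in_complete: "g \<in> {..<k} \<rightarrow> {..<n} \<Longrightarrow> transversal k g \<in> complete_edges k n"
proof -
  assume "g \<in> {..<k} \<rightarrow> {..<n}"
  moreover have "transversal k g = transversal k (restrict g {..<k})" by (simp add: transversal_def)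
  ultimately show ?thesis by (auto simp: complete_edges_eq intro!: image_eqI)
qed

section \<open>Infinitesimal motions\<close>

text \<open>Distinct primes make the products along distinct edges distinct. The powers of these weights are the
coordinates of the special configuration.\<close>

definition prime_weight :: "vertex \<Rightarrow> nat" where
  "prime_weight = (SOME t. inj t \<and> (\<forall>v. prime (t v)))"

lemma prime_weight: "inj prime_weight" "prime (prime_weight v)"
proof -
  obtain f :: "nat \<Rightarrow> nat" where f: "inj f" "range f \<subseteq> {p. prime p}"
    using infinite_countable_subset[OF primes_infinite] by blast
  have g: "inj (to_nat :: vertex \<Rightarrow> nat)" by simp
  have "inj (f \<circ> to_nat) \<and> (\<forall>v. prime ((f \<circ> to_nat) v))"
    using f g by (auto intro: inj_compose)
  then have "inj prime_weight \<and> (\<forall>v. prime (prime_weight v))"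
    unfolding prime_weight_def by (rule someI[where P = "\<lambda>t. inj t \<and> (\<forall>v. prime (t v))"])
  then show "inj prime_weight" "prime (prime_weight v)" by blast+
qed

definition edge_weight :: "vertex set \<Rightarrow> nat" where
  "edge_weight e = (\<Prod>v\<in>e. prime_weight v)"

lemma prime_weight_dvd_edge_weight:
  "finite e \<Longrightarrow> prime_weight v dvd edge_weight e \<longleftrightarrow> v \<in> e"
proof -
  assume "finite e"
  then have "prime_weight v dvd edge_weight e \<longleftrightarrow> (\<exists>u\<in>e. prime_weight v dvd prime_weight u)"
    unfolding edge_weight_def using prime_weight(2)[of v] by (intro prime_dvd_prod_iff) auto
  also have "\<dots> \<longleftrightarrow> v \<in> e"
    using primes_dvd_imp_eq[OF prime_weight(2) prime_weight(2)] prime_weight(1) dvd_refl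
    by (metis injD)
  finally show ?thesis .
qed

lemma edge_weight_inj: "inj_on edge_weight {e. finite e}"
proof
  fix e f assume "e \<in> {e. finite e}" "f \<in> {e. finite e}" "edge_weight e = edge_weight f"
  then show "e = f"
    using prime_weight_dvd_edge_weight[of e] prime_weight_dvd_edge_weight[of f] by auto
qed

text \<open>The unknowns are the coefficients of a polynomial of degree below \<open>d\<close> with \<open>d\<close> roots.\<close>

lemma vandermonde_injective:
  fixes w :: "nat \<Rightarrow> 'a::field"
  assumes "finite A" "d \<le> card A" "\<And>x. x \<in> A \<Longrightarrow> (\<Sum>j<d. x ^ j * w j) = 0" "j < d"
  shows "w j = 0"
proof -
  define p where "p = (\<Sum>j<d. monom (w j) j)"
  have coeff: "coeff p i = (if i < d then w i else 0)" for i
    by (simp add: p_def coeff_sum coeff_monom)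
  have "p = 0"
  proof (rule ccontr)
    assume "p \<noteq> 0"
    have "A \<subseteq> {x. poly p x = 0}"
      using assms(3) by (auto simp: p_def poly_sum poly_monom mult.commute)
    then have "card A \<le> degree p"
      using card_mono[OF poly_roots_finite[OF \<open>p \<noteq> 0\<close>]] card_poly_roots_bound[OF \<open>p \<noteq> 0\<close>]
      by (meson le_trans)
    moreover have "degree p < d"
      using assms(4) coeff by (intro degree_lessI) auto
    ultimately show False using assms(2) by simp
  qed
  then show ?thesis using coeff[of j] assms(4) by simp
qed

text \<open>The derivative of the edge \<open>e\<close>'s coordinate of the rigidity map at \<open>p\<^sub>v\<^sub>,\<^sub>j = t\<^sub>v\<^sup>j\<close> in the direction
\<open>x\<close>, written in the relative velocities \<open>z\<^sub>v\<^sub>,\<^sub>j = x\<^sub>v\<^sub>,\<^sub>j / p\<^sub>v\<^sub>,\<^sub>j\<close>.\<close>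

definition edge_form :: "nat \<Rightarrow> vertex set \<Rightarrow> (vertex \<times> nat \<Rightarrow> rat) \<Rightarrow> rat" where
  "edge_form d e z = (\<Sum>j<d. of_nat (edge_weight e) ^ j * (\<Sum>v\<in>e. z (v, j)))"

definition motion :: "nat \<Rightarrow> vertex set set \<Rightarrow> (vertex \<times> nat \<Rightarrow> rat) \<Rightarrow> bool" where
  "motion d S z \<longleftrightarrow> (\<forall>e\<in>S. edge_form d e z = 0)"

definition implied :: "nat \<Rightarrow> vertex set set \<Rightarrow> vertex set \<Rightarrow> bool" where
  "implied d S e \<longleftrightarrow> (\<forall>z. motion d S z \<longrightarrow> edge_form d e z = 0)"

text \<open>In relative velocities, rescaling class \<open>i\<close> by diagonal matrices with product \<open>1\<close> becomes
\<open>z\<^sub>v\<^sub>,\<^sub>j = c\<^sub>i\<^sub>,\<^sub>j\<close> with \<open>c\<^sub>1\<^sub>,\<^sub>j + \<dots> + c\<^sub>k\<^sub>,\<^sub>j = 0\<close>.\<close>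

definition locked :: "nat \<Rightarrow> nat \<Rightarrow> vertex set set \<Rightarrow> vertex set \<Rightarrow> bool" where
  "locked k d S C \<longleftrightarrow> (\<forall>z. motion d S z \<longrightarrow>
     (\<exists>c. (\<forall>j<d. (\<Sum>i<k. c i j) = 0) \<and> (\<forall>v\<in>C. \<forall>j<d. z (v, j) = c (fst v) j)))"

lemma implied_mem: "e \<in> S \<Longrightarrow> implied d S e"
  by (auto simp: implied_def motion_def)

lemma motion_mono: "S \<subseteq> S' \<Longrightarrow> motion d S' z \<Longrightarrow> motion d S z"
  by (auto simp: motion_def)

lemma implied_mono: "S \<subseteq> S' \<Longrightarrow> implied d S e \<Longrightarrow> implied d S' e"
  unfolding implied_def using motion_mono by blast

lemma lockedD:
  assumes "locked k d S C" "motion d S z"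
  shows "\<exists>c. (\<forall>j<d. (\<Sum>i<k. c i j) = 0) \<and> (\<forall>v\<in>C. \<forall>j<d. z (v, j) = c (fst v) j)"
  using assms unfolding locked_def by blast

lemma lockedI:
  assumes "\<And>z. motion d S z \<Longrightarrow>
    \<exists>c. (\<forall>j<d. (\<Sum>i<k. c i j) = 0) \<and> (\<forall>v\<in>C. \<forall>j<d. z (v, j) = c (fst v) j)"
  shows "locked k d S C"
  using assms unfolding locked_def by blast

lemma locked_mono:
  assumes "S \<subseteq> S'" "locked k d S C"
  shows "locked k d S' C"
proof (rule lockedI)
  fix z assume "motion d S' z"
  then have "motion d S z" using motion_mono[OF assms(1)] by blast
  then show "\<exists>c. (\<forall>j<d. (\<Sum>i<k. c i j) = 0) \<and> (\<forall>v\<in>C. \<forall>j<d. z (v, j) = c (fst v) j)"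
    using assms(2) unfolding locked_def by blast
qed

text \<open>Subtract from a motion the rescaling that it induces on \<open>C\<close>. What is left vanishes on \<open>C\<close>, so the
equation of an edge through \<open>v\<close> into \<open>C\<close> involves the \<open>d\<close> unknowns at \<open>v\<close> only, and \<open>d\<close> such edges give
a Vandermonde system with pairwise distinct nodes.\<close>

lemma locked_extend:
  assumes "locked k d S C"
    and W: "\<And>v. v \<in> W \<Longrightarrow> \<exists>F\<subseteq>complete_edges k n. d \<le> card F \<and>
      (\<forall>e\<in>F. implied d S e \<and> v \<in> e \<and> e - {v} \<subseteq> C)"
  shows "locked k d S (C \<union> W)"
proof (rule lockedI)
  fix z assume z: "motion d S z"
  obtain c where c': "\<forall>j<d. (\<Sum>i<k. c i j) = 0" "\<forall>v\<in>C. \<forall>j<d. z (v, j) = c (fst v) j"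
    using lockedD[OF assms(1) z] by blast
  then have c: "\<And>j. j < d \<Longrightarrow> (\<Sum>i<k. c i j) = 0"
      "\<And>v j. v \<in> C \<Longrightarrow> j < d \<Longrightarrow> z (v, j) = c (fst v) j" by blast+
  have "z (v, j) = c (fst v) j" if v: "v \<in> W" and j: "j < d" for v j
  proof -
    obtain F where F: "F \<subseteq> complete_edges k n" "d \<le> card F"
        "\<And>e. e \<in> F \<Longrightarrow> implied d S e \<and> v \<in> e \<and> e - {v} \<subseteq> C"
      using W[OF v] by blast
    have finF: "finite F" using F(1) finite_complete_edges finite_subset by blast
    let ?A = "(\<lambda>e. of_nat (edge_weight e) :: rat) ` F"
    have "inj_on (\<lambda>e. of_nat (edge_weight e) :: rat) F"
    proof (rule inj_onI)
      fix e f assume "e \<in> F" "f \<in> F" "(of_nat (edge_weight e) :: rat) = of_nat (edge_weight f)"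
      moreover from this(1,2) have "finite e" "finite f" using F(1) finite_edge by blast+
      ultimately show "e = f" using edge_weight_inj by (simp add: inj_on_def)
    qed
    then have card: "card ?A = card F" by (rule card_image)
    have "z (v, j) - c (fst v) j = 0"
    proof (rule vandermonde_injective[of ?A d])
      fix x assume "x \<in> ?A"
      then obtain e where e: "e \<in> F" "x = of_nat (edge_weight e)" by blast
      have "e \<in> complete_edges k n" using e(1) F(1) by blast
      then obtain g where g: "g \<in> {..<k} \<rightarrow>\<^sub>E {..<n}" "e = transversal k g"
        by (rule complete_edgesE)
      have "(\<Sum>u\<in>e. z (u, l)) = z (v, l) - c (fst v) l" if l: "l < d" for l
      proof -
        have "(\<Sum>u\<in>e. z (u, l)) - (\<Sum>u\<in>e. c (fst u) l) = (\<Sum>u\<in>e. z (u, l) - c (fst u) l)"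
          by (simp add: sum_subtractf)
        also have "\<dots> = z (v, l) - c (fst v) l + (\<Sum>u\<in>e - {v}. z (u, l) - c (fst u) l)"
          using F(3)[OF e(1)] g finite_transversal by (intro sum.remove) auto
        also have "(\<Sum>u\<in>e - {v}. z (u, l) - c (fst u) l) = 0"
          using F(3)[OF e(1)] c(2) l by (intro sum.neutral) auto
        also have "(\<Sum>u\<in>e. c (fst u) l) = 0"
          using c(1)[OF l] by (simp add: g sum_transversal)
        finally show ?thesis by simp
      qed
      then have "edge_form d e z = (\<Sum>l<d. x ^ l * (z (v, l) - c (fst v) l))"
        unfolding edge_form_def e(2) by simp
      moreover have "edge_form d e z = 0"
        using F(3)[OF e(1)] z by (auto simp: implied_def)
      ultimately show "(\<Sum>l<d. x ^ l * (z (v, l) - c (fst v) l)) = 0" by simp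
    qed (use finF card F(2) j in auto)
    then show ?thesis by simp
  qed
  then show "\<exists>c. (\<forall>j<d. (\<Sum>i<k. c i j) = 0) \<and> (\<forall>v\<in>C \<union> W. \<forall>j<d. z (v, j) = c (fst v) j)"
    using c by blast
qed

text \<open>\<open>\<phi> a s\<close> is the coefficient of degree \<open>a\<close> in the Lagrange polynomial that is \<open>1\<close> at \<open>\<tau> s\<close> and \<open>0\<close> at the
other nodes. The second family of equations says that interpolation reproduces the monomials.\<close>

lemma vandermonde_dual_basis:
  fixes \<tau> :: "nat \<Rightarrow> 'a::field"
  assumes "inj_on \<tau> {..<d}"
  shows "\<exists>\<phi>. (\<forall>s<d. \<forall>s'<d. (\<Sum>a<d. \<phi> a s * \<tau> s' ^ a) = (if s = s' then 1 else 0)) \<and>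
    (\<forall>a<d. \<forall>l<d. (\<Sum>s<d. \<phi> a s * \<tau> s ^ l) = (if a = l then 1 else 0))"
proof -
  define L where "L s = (\<Prod>u\<in>{..<d} - {s}. Polynomial.smult (inverse (\<tau> s - \<tau> u)) [:- \<tau> u, 1:])" for s
  have poly_L: "poly (L s) (\<tau> s') = (if s = s' then 1 else 0)" if "s < d" "s' < d" for s s'
  proof (cases "s = s'")
    case True
    have "poly (Polynomial.smult (inverse (\<tau> s - \<tau> u)) [:- \<tau> u, 1:]) (\<tau> s) = 1"
      if "u \<in> {..<d} - {s}" for u
    proof -
      have "\<tau> s - \<tau> u \<noteq> 0" using that \<open>s < d\<close> assms by (auto simp: inj_on_def)
      then have "inverse (\<tau> s - \<tau> u) * (\<tau> s - \<tau> u) = 1" by (rule left_inverse)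
      then show ?thesis by (simp add: algebra_simps)
    qed
    then show ?thesis using True unfolding L_def poly_prod by (simp add: prod.neutral)
  next
    case False
    then show ?thesis using that by (auto simp: L_def poly_prod intro!: prod_zero)
  qed
  have degree_L: "degree (L s) < d" if "s < d" for s
  proof -
    have "degree (L s) \<le> (\<Sum>u\<in>{..<d} - {s}. degree (Polynomial.smult (inverse (\<tau> s - \<tau> u)) [:- \<tau> u, 1:]))"
      unfolding L_def by (rule order_trans[OF degree_prod_sum_le]) (simp_all add: o_def)
    also have "\<dots> \<le> (\<Sum>u\<in>{..<d} - {s}. 1)"
      by (intro sum_mono) (simp add: degree_smult_eq)
    also have "\<dots> < d" using that by simp
    finally show ?thesis .
  qed
  have sum_coeff: "(\<Sum>a<d. coeff p a * x ^ a) = poly p x" if "degree p < d" for p and x :: 'a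
    unfolding poly_altdef using that
    by (intro sum.mono_neutral_right) (auto simp: coeff_eq_0)
  show ?thesis
  proof (intro exI[of _ "\<lambda>a s. coeff (L s) a"] conjI allI impI)
    show "(\<Sum>a<d. coeff (L s) a * \<tau> s' ^ a) = (if s = s' then 1 else 0)" if "s < d" "s' < d" for s s'
      using that by (simp add: sum_coeff degree_L poly_L)
  next
    fix a l assume al: "a < d" "l < d"
    have "(\<Sum>s<d. Polynomial.smult (\<tau> s ^ l) (L s)) = monom 1 l"
    proof (rule poly_eqI_degree[of "\<tau> ` {..<d}"])
      show "poly (\<Sum>s<d. Polynomial.smult (\<tau> s ^ l) (L s)) x = poly (monom 1 l) x" if "x \<in> \<tau> ` {..<d}" for x
        using that by (auto simp: poly_sum poly_L poly_monom if_distrib cong: if_cong)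
      have "card (\<tau> ` {..<d}) = d" using assms by (simp add: card_image)
      moreover have "degree (\<Sum>s<d. Polynomial.smult (\<tau> s ^ l) (L s)) < d"
        using al degree_L degree_smult_le le_less_trans
        by (intro degree_sum_less) (auto intro: le_less_trans[OF degree_smult_le])
      moreover have "degree (monom 1 l :: 'a poly) < d"
        using al by (simp add: degree_monom_eq)
      ultimately show "degree (\<Sum>s<d. Polynomial.smult (\<tau> s ^ l) (L s)) < card (\<tau> ` {..<d})"
        "degree (monom 1 l :: 'a poly) < card (\<tau> ` {..<d})" by auto
    qed
    from arg_cong[OF this, of "\<lambda>p. coeff p a"]
    show "(\<Sum>s<d. coeff (L s) a * \<tau> s ^ l) = (if a = l then 1 else 0)"
      by (auto simp: coeff_sum coeff_monom mult.commute)
  qed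
qed


text \<open>Put \<open>p\<^sup>i\<^sub>j\<close> for the vector of the \<open>j\<close>-th coordinates in class \<open>i\<close>, and \<open>x\<^sup>i\<^sub>j\<close> for its velocity. The
\<open>d\<^sup>k\<close> equations say that the sum over \<open>j\<close> and \<open>i\<close> of \<open>p\<^sup>1\<^sub>j \<otimes> \<dots> \<otimes> x\<^sup>i\<^sub>j \<otimes> \<dots> \<otimes> p\<^sup>k\<^sub>j\<close> is zero. For
each \<open>i\<close> the vectors \<open>p\<^sup>i\<^sub>j\<close> form a Vandermonde basis. Contract the equation with the dual basis,
index \<open>b\<close> in class \<open>i0\<close> and index \<open>j0\<close> in all others: because there are at least two other classes,
only the component of \<open>x\<^sup>i\<^sup>0\<^sub>j\<^sub>0\<close> along \<open>p\<^sup>i\<^sup>0\<^sub>b\<close> survives if \<open>b \<noteq> j0\<close>, so it is zero. With all indices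
equal to \<open>j0\<close> one obtains that the remaining components, which are the scaling factors, sum to
zero. For \<open>k = 2\<close> the first step fails.\<close>

lemma locked_seed:
  assumes k: "3 \<le> k" and inj: "\<And>i. i < k \<Longrightarrow> inj_on (\<alpha> i) {..<d}"
    and imp: "\<And>\<sigma>. (\<And>i. i < k \<Longrightarrow> \<sigma> i < d) \<Longrightarrow> implied d S (transversal k (\<lambda>i. \<alpha> i (\<sigma> i)))"
  shows "locked k d S {(i, \<alpha> i s) | i s. i < k \<and> s < d}"
proof (rule lockedI)
  fix z assume z: "motion d S z"
  define \<tau> :: "nat \<Rightarrow> nat \<Rightarrow> rat" where "\<tau> i s = of_nat (prime_weight (i, \<alpha> i s))" for i s
  have \<tau>nz: "\<tau> i s \<noteq> 0" for i s
    using prime_weight(2)[of "(i, \<alpha> i s)"] by (auto simp: \<tau>_def)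
  define dual where "dual i \<phi> \<longleftrightarrow>
      (\<forall>s<d. \<forall>s'<d. (\<Sum>a<d. \<phi> a s * \<tau> i s' ^ a) = (if s = s' then 1 else 0)) \<and>
      (\<forall>a<d. \<forall>l<d. (\<Sum>s<d. \<phi> a s * \<tau> i s ^ l) = (if a = l then 1 else 0))" for i \<phi>
  have "\<exists>\<phi>. dual i \<phi>" if i: "i < k" for i
  proof -
    have "inj_on (\<tau> i) {..<d}"
    proof (rule inj_onI)
      fix s s' assume *: "s \<in> {..<d}" "s' \<in> {..<d}" "\<tau> i s = \<tau> i s'"
      then have "(i, \<alpha> i s) = (i, \<alpha> i s')"
        using prime_weight(1) by (simp add: \<tau>_def inj_eq)
      then show "s = s'" using inj[OF i] * by (auto simp: inj_on_def)
    qed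
    then show ?thesis unfolding dual_def by (rule vandermonde_dual_basis)
  qed
  then have "\<exists>\<phi>. i < k \<longrightarrow> dual i \<phi>" for i by blast
  then obtain \<phi> where "\<And>i. i < k \<Longrightarrow> dual i (\<phi> i)" by metis
  then have \<phi>1: "\<And>i s s'. i < k \<Longrightarrow> s < d \<Longrightarrow> s' < d \<Longrightarrow>
        (\<Sum>a<d. \<phi> i a s * \<tau> i s' ^ a) = (if s = s' then 1 else 0)"
      and \<phi>2: "\<And>i a l. i < k \<Longrightarrow> a < d \<Longrightarrow> l < d \<Longrightarrow>
        (\<Sum>s<d. \<phi> i a s * \<tau> i s ^ l) = (if a = l then 1 else 0)"
    unfolding dual_def by blast+
  define y where "y i s j = z ((i, \<alpha> i s), j)" for i s j
  \<comment> \<open>\<open>Y i a j\<close> is the component of the velocity \<open>x\<^sup>i\<^sub>j\<close> along the basis vector \<open>p\<^sup>i\<^sub>a\<close>.\<close>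
  define Y where "Y i a j = (\<Sum>s<d. \<phi> i a s * \<tau> i s ^ j * y i s j)" for i a j
  have contracted: "(\<Sum>j<d. \<Sum>i0<k. Y i0 (a i0) j * (\<Prod>i\<in>{..<k} - {i0}. if a i = j then 1 else 0)) = 0"
    if a: "\<And>i. i < k \<Longrightarrow> a i < d" for a
  proof -
    let ?P = "{..<k} \<rightarrow>\<^sub>E {..<d}"
    let ?m = "\<lambda>j i0 \<sigma>. \<Prod>i<k. \<phi> i (a i) (\<sigma> i) * \<tau> i (\<sigma> i) ^ j *
      (if i = i0 then y i (\<sigma> i) j else 1)"
    have zero: "(\<Sum>j<d. (\<Prod>i<k. \<tau> i (\<sigma> i)) ^ j * (\<Sum>i<k. y i (\<sigma> i) j)) = 0" if "\<sigma> \<in> ?P" for \<sigma>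
    proof -
      have "edge_form d (transversal k (\<lambda>i. \<alpha> i (\<sigma> i))) z = 0"
        using imp[of \<sigma>] that z by (auto simp: implied_def PiE_iff)
      then show ?thesis
        by (simp add: edge_form_def edge_weight_def prod_transversal sum_transversal \<tau>_def y_def)
    qed
    have "(\<Sum>\<sigma>\<in>?P. ?m j i0 \<sigma>)
       = Y i0 (a i0) j * (\<Prod>i\<in>{..<k} - {i0}. if a i = j then 1 else 0)"
      if j: "j < d" and i0: "i0 < k" for j i0
    proof -
      have "(\<Sum>\<sigma>\<in>?P. ?m j i0 \<sigma>)
        = (\<Prod>i<k. \<Sum>s<d. \<phi> i (a i) s * \<tau> i s ^ j * (if i = i0 then y i s j else 1))"
        by (subst prod_sum_PiE) auto
      also have "\<dots> = (\<Sum>s<d. \<phi> i0 (a i0) s * \<tau> i0 s ^ j * (if i0 = i0 then y i0 s j else 1)) *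
          (\<Prod>i\<in>{..<k} - {i0}. \<Sum>s<d. \<phi> i (a i) s * \<tau> i s ^ j * (if i = i0 then y i s j else 1))"
        using i0 by (intro prod.remove) auto
      also have "(\<Sum>s<d. \<phi> i0 (a i0) s * \<tau> i0 s ^ j * (if i0 = i0 then y i0 s j else 1)) = Y i0 (a i0) j"
        by (simp add: Y_def)
      also have "(\<Prod>i\<in>{..<k} - {i0}. \<Sum>s<d. \<phi> i (a i) s * \<tau> i s ^ j * (if i = i0 then y i s j else 1))
        = (\<Prod>i\<in>{..<k} - {i0}. if a i = j then 1 else 0)"
        using \<phi>2 a j by (intro prod.cong) auto
      finally show ?thesis .
    qed
    then have "(\<Sum>j<d. \<Sum>i0<k. Y i0 (a i0) j * (\<Prod>i\<in>{..<k} - {i0}. if a i = j then 1 else 0)) =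
       (\<Sum>j<d. \<Sum>i0<k. \<Sum>\<sigma>\<in>?P. ?m j i0 \<sigma>)"
      by (intro sum.cong) auto
    also have "\<dots> = (\<Sum>j<d. \<Sum>\<sigma>\<in>?P. \<Sum>i0<k. ?m j i0 \<sigma>)"
      by (intro sum.cong refl sum.swap)
    also have "\<dots> = (\<Sum>\<sigma>\<in>?P. \<Sum>j<d. \<Sum>i0<k. ?m j i0 \<sigma>)"
      by (rule sum.swap)
    also have "\<dots> = (\<Sum>\<sigma>\<in>?P. (\<Prod>i<k. \<phi> i (a i) (\<sigma> i)) *
        (\<Sum>j<d. (\<Prod>i<k. \<tau> i (\<sigma> i)) ^ j * (\<Sum>i<k. y i (\<sigma> i) j)))"
      by (intro sum.cong refl)
        (simp add: prod.distrib prod_power_distrib sum_distrib_left mult.assoc)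
    also have "\<dots> = 0" using zero by simp
    finally show ?thesis .
  qed
  have off_diagonal: "Y i0 b j0 = 0" if "i0 < k" "b < d" "j0 < d" "b \<noteq> j0" for i0 b j0
  proof -
    define a where "a i = (if i = i0 then b else j0)" for i
    have "(\<Sum>j<d. \<Sum>i1<k. Y i1 (a i1) j * (\<Prod>i\<in>{..<k} - {i1}. if a i = j then 1 else 0)) =
      (\<Sum>j<d. \<Sum>i1<k. if j = j0 \<and> i1 = i0 then Y i0 b j0 else 0)"
    proof (intro sum.cong refl)
      fix j i1 assume j: "j \<in> {..<d}" and i1: "i1 \<in> {..<k}"
      show "Y i1 (a i1) j * (\<Prod>i\<in>{..<k} - {i1}. if a i = j then 1 else 0) =
          (if j = j0 \<and> i1 = i0 then Y i0 b j0 else 0)"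
      proof (cases "j = j0 \<and> i1 = i0")
        case True
        then have "(\<Prod>i\<in>{..<k} - {i1}. if a i = j then 1 else 0 :: rat) = 1"
          by (intro prod.neutral) (auto simp: a_def)
        then show ?thesis using True by (simp add: a_def)
      next
        case False
        have "\<exists>i\<in>{..<k} - {i1}. a i \<noteq> j"
        proof (cases "i1 = i0")
          case True
          obtain i where "i < k" "i \<noteq> i0" using k by (metis less_le_trans zero_less_numeral
            one_less_numeral_iff semiring_norm(77) zero_neq_one)
          then show ?thesis using True False by (auto simp: a_def)
        next
          case i1i0: False
          show ?thesis
          proof (cases "b = j")
            case False
            then show ?thesis using i1i0 that by (auto simp: a_def)
          next
            case True
            have "card ({..<k} - {i0, i1}) > 0"
              using k i1i0 i1 \<open>i0 < k\<close> by (subst card_Diff_subset) auto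
            then obtain i where "i \<in> {..<k} - {i0, i1}" by (metis card_gt_0_iff equals0I)
            then show ?thesis using True that by (auto simp: a_def)
          qed
        qed
        then have "(\<Prod>i\<in>{..<k} - {i1}. if a i = j then 1 else 0 :: rat) = 0"
          by (intro prod_zero) auto
        then show ?thesis using False by (metis mult_zero_right)
      qed
    qed
    also have "\<dots> = Y i0 b j0"
    proof -
      have "(\<Sum>i1<k. if j = j0 \<and> i1 = i0 then Y i0 b j0 else 0) = (if j = j0 then Y i0 b j0 else 0)" for j
        using that by simp
      then show ?thesis using that by simp
    qed
    finally show ?thesis using contracted[of a] that by (auto simp: a_def)
  qed
  have diagonal: "(\<Sum>i<k. Y i j0 j0) = 0" if "j0 < d" for j0
  proof -
    have "(\<Sum>j<d. \<Sum>i1<k. Y i1 j0 j * (\<Prod>i\<in>{..<k} - {i1}. if j0 = j then 1 else 0)) =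
      (\<Sum>j<d. if j = j0 then \<Sum>i1<k. Y i1 j0 j0 else 0)"
    proof (intro sum.cong refl)
      fix j
      have "(\<Prod>i\<in>{..<k} - {i1}. if j0 = j then 1 else 0 :: rat) = (if j = j0 then 1 else 0)"
        if "i1 < k" for i1
      proof -
        have "card ({..<k} - {i1}) > 0" using k that by simp
        then obtain i where "i \<in> {..<k} - {i1}" by (metis card_gt_0_iff equals0I)
        then show ?thesis
        proof (cases "j = j0")
          case False
          then have "(\<Prod>i\<in>{..<k} - {i1}. if j0 = j then 1 else 0 :: rat) = 0"
            using \<open>i \<in> _\<close> by (intro prod_zero) auto
          then show ?thesis using False by simp
        qed simp
      qed
      then show "(\<Sum>i1<k. Y i1 j0 j * (\<Prod>i\<in>{..<k} - {i1}. if j0 = j then 1 else 0)) =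
          (if j = j0 then \<Sum>i1<k. Y i1 j0 j0 else 0)"
        by simp
    qed
    then show ?thesis using contracted[of "\<lambda>_. j0"] that by (simp add: sum.delta)
  qed
  have "y i s j = Y i j j" if "i < k" "s < d" "j < d" for i s j
  proof -
    have "(\<Sum>a<d. Y i a j * \<tau> i s ^ a) = (\<Sum>s'<d. \<tau> i s' ^ j * y i s' j * (\<Sum>a<d. \<phi> i a s' * \<tau> i s ^ a))"
      unfolding Y_def sum_distrib_left sum_distrib_right
      by (subst sum.swap) (intro sum.cong refl, simp add: mult_ac)
    also have "\<dots> = (\<Sum>s'<d. if s' = s then \<tau> i s ^ j * y i s j else 0)"
      using that \<phi>1 by (intro sum.cong) auto
    also have "\<dots> = \<tau> i s ^ j * y i s j" using that by simp
    finally have "(\<Sum>a<d. Y i a j * \<tau> i s ^ a) = \<tau> i s ^ j * y i s j" .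
    moreover have "(\<Sum>a<d. Y i a j * \<tau> i s ^ a) = (\<Sum>a<d. if a = j then Y i j j * \<tau> i s ^ j else 0)"
      using off_diagonal that by (intro sum.cong) auto
    ultimately show ?thesis using that \<tau>nz by simp
  qed
  then show "\<exists>c. (\<forall>j<d. (\<Sum>i<k. c i j) = 0) \<and>
      (\<forall>v\<in>{(i, \<alpha> i s) |i s. i < k \<and> s < d}. \<forall>j<d. z (v, j) = c (fst v) j)"
    using diagonal by (intro exI[of _ "\<lambda>i j. Y i j j"]) (auto simp: y_def)
qed



section \<open>From motions to local rigidity\<close>

definition jacobian_form :: "nat \<Rightarrow> 'a::comm_ring_1 config \<Rightarrow> vertex set \<Rightarrow> 'a config \<Rightarrow> 'a" where
  "jacobian_form d p e h = (\<Sum>j<d. \<Sum>v\<in>e. (\<Prod>u\<in>e - {v}. p (u, j)) * h (v, j))"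

text \<open>Every family of rescalings near the identity is determined by its effect on the first vertex of each
class but the last. Fixing these coordinates removes exactly the trivial motions.\<close>

definition gauge_coordinates :: "nat \<Rightarrow> nat \<Rightarrow> (vertex \<times> nat) set" where
  "gauge_coordinates k d = {((i, 0), j) | i j. i < k - 1 \<and> j < d}"

text \<open>The Jacobian of the rigidity map as a matrix of polynomials, with one further row for each gauge
coordinate.\<close>

definition rigidity_matrix ::
    "vertex set + vertex \<times> nat \<Rightarrow> vertex \<times> nat \<Rightarrow> ((vertex \<times> nat \<Rightarrow>\<^sub>0 nat) \<Rightarrow>\<^sub>0 rat)" where
  "rigidity_matrix r c = (case r of
     Inl e \<Rightarrow> if fst c \<in> e then \<Prod>u\<in>e - {fst c}. indeterminate (u, snd c) else 0
   | Inr g \<Rightarrow> if g = c then 1 else 0)"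

lemma complete_edges_subset: "e \<in> complete_edges k n \<Longrightarrow> e \<subseteq> vertices k n"
  by (simp add: complete_edges_def)

lemma gauge_coordinates_subset: "0 < n \<Longrightarrow> gauge_coordinates k d \<subseteq> vertices k n \<times> {..<d}"
  by (auto simp: gauge_coordinates_def mem_vertices)

lemma finite_gauge_coordinates: "finite (gauge_coordinates k d)"
  using finite_subset[OF gauge_coordinates_subset[of 1 k d]] finite_vertices by simp

lemma rigidity_matrix_edge_row:
  assumes "e \<subseteq> vertices k n"
  shows "(\<Sum>c\<in>vertices k n \<times> {..<d}. eval_rat_poly (rigidity_matrix (Inl e) c) x * h c) =
    jacobian_form d x e h"
proof -
  have "(\<Sum>c\<in>vertices k n \<times> {..<d}. eval_rat_poly (rigidity_matrix (Inl e) c) x * h c) =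
      (\<Sum>v\<in>vertices k n. \<Sum>j<d. eval_rat_poly (rigidity_matrix (Inl e) (v, j)) x * h (v, j))"
    by (simp add: sum.cartesian_product)
  also have "\<dots> = (\<Sum>v\<in>e. \<Sum>j<d. eval_rat_poly (rigidity_matrix (Inl e) (v, j)) x * h (v, j))"
    using assms finite_vertices
    by (intro sum.mono_neutral_right) (auto simp: rigidity_matrix_def eval_rat_poly_0)
  also have "\<dots> = (\<Sum>v\<in>e. \<Sum>j<d. (\<Prod>u\<in>e - {v}. x (u, j)) * h (v, j))"
    by (intro sum.cong refl)
      (simp add: rigidity_matrix_def eval_rat_poly_prod eval_rat_poly_indeterminate)
  finally show ?thesis
    unfolding jacobian_form_def by (subst sum.swap) simp
qed

lemma rigidity_matrix_gauge_row:
  assumes "g \<in> vertices k n \<times> {..<d}"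
  shows "(\<Sum>c\<in>vertices k n \<times> {..<d}. eval_rat_poly (rigidity_matrix (Inr g) c) x * h c) = h g"
proof -
  have "(\<Sum>c\<in>vertices k n \<times> {..<d}. eval_rat_poly (rigidity_matrix (Inr g) c) x * h c) =
    (\<Sum>c\<in>vertices k n \<times> {..<d}. if c = g then h c else 0)"
    by (intro sum.cong refl) (auto simp: rigidity_matrix_def eval_rat_poly_0 eval_rat_poly_1)
  then show ?thesis using assms finite_vertices by (simp add: sum.delta)
qed

text \<open>The rescaling that describes a motion of a graph that locks all vertices can be read off at the gauge
vertices, where the motion is zero; the factor of the last class follows from the sum condition.\<close>

lemma locked_special_jacobian_injective:
  fixes h :: "rat config"
  assumes lock: "locked k d G (vertices k n)" and G: "G \<subseteq> complete_edges k n"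
    and k: "0 < k" and n: "0 < n"
    and jac: "\<And>e. e \<in> G \<Longrightarrow> jacobian_form d (\<lambda>(v, j). of_nat (prime_weight v) ^ j) e h = 0"
    and gauge: "\<And>g. g \<in> gauge_coordinates k d \<Longrightarrow> h g = 0"
    and c: "c \<in> vertices k n \<times> {..<d}"
  shows "h c = 0"
proof -
  define q :: "rat config" where "q = (\<lambda>(v, j). of_nat (prime_weight v) ^ j)"
  have q_nz: "q x \<noteq> 0" for x
    using prime_gt_0_nat[OF prime_weight(2)[of "fst x"]] by (auto simp: q_def split: prod.splits)
  define z where "z x = h x / q x" for x
  have "motion d G z"
    unfolding motion_def
  proof
    fix e assume e: "e \<in> G"
    then have fin: "finite e" using G finite_edge by blast
    have "(\<Prod>u\<in>e - {v}. q (u, j)) * h (v, j) = of_nat (edge_weight e) ^ j * z (v, j)"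
      if "v \<in> e" for v j
    proof -
      have "of_nat (edge_weight e) ^ j = (\<Prod>u\<in>e. q (u, j))"
        by (simp add: edge_weight_def q_def prod_power_distrib)
      also have "\<dots> = q (v, j) * (\<Prod>u\<in>e - {v}. q (u, j))"
        using fin that by (rule prod.remove)
      finally show ?thesis using q_nz[of "(v, j)"] by (simp add: z_def)
    qed
    then have "edge_form d e z = jacobian_form d q e h"
      by (simp add: edge_form_def jacobian_form_def sum_distrib_left)
    then show "edge_form d e z = 0" using jac[OF e] by (simp add: q_def)
  qed
  then obtain b where b: "\<forall>j<d. (\<Sum>i<k. b i j) = 0" "\<forall>v\<in>vertices k n. \<forall>j<d. z (v, j) = b (fst v) j"
    using lockedD[OF lock] by blast
  have b0: "b i j = 0" if "i < k - 1" "j < d" for i j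
  proof -
    have "((i, 0), j) \<in> gauge_coordinates k d" using that by (auto simp: gauge_coordinates_def)
    moreover have "(i, 0) \<in> vertices k n" using that n by (simp add: mem_vertices)
    ultimately show ?thesis using b(2) gauge that by (force simp: z_def)
  qed
  have b1: "b i j = 0" if "i < k" "j < d" for i j
  proof -
    have "(\<Sum>i<k. b i j) = b (k - 1) j + (\<Sum>i\<in>{..<k} - {k - 1}. b i j)"
      using k by (intro sum.remove) auto
    also have "(\<Sum>i\<in>{..<k} - {k - 1}. b i j) = 0"
    proof (intro sum.neutral ballI)
      fix x assume "x \<in> {..<k} - {k - 1}"
      then have "x < k - 1" by auto
      then show "b x j = 0" using b0 that by blast
    qed
    finally have "b (k - 1) j = 0" using b(1) that by simp
    then show ?thesis using b0[of i j] that by (cases "i = k - 1") auto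
  qed
  obtain v j where vj: "c = (v, j)" "v \<in> vertices k n" "j < d" using c by auto
  then have "z c = 0" using b(2) b1 by (auto simp: mem_vertices)
  then show ?thesis using q_nz[of c] by (simp add: z_def)
qed

lemma locked_generic_jacobian_injective:
  fixes p :: "'a::field_char_0 config"
  assumes lock: "locked k d G (vertices k n)" and G: "G \<subseteq> complete_edges k n"
    and k: "0 < k" and n: "0 < n" and gen: "generic (vertices k n) d p"
    and jac: "\<And>e. e \<in> G \<Longrightarrow> jacobian_form d p e h = 0"
    and gauge: "\<And>g. g \<in> gauge_coordinates k d \<Longrightarrow> h g = 0"
    and c: "c \<in> vertices k n \<times> {..<d}"
  shows "h c = 0"
proof -
  let ?I = "vertices k n \<times> {..<d}"
  let ?E = "Inl ` G \<union> Inr ` gauge_coordinates k d"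
  have sub: "e \<subseteq> vertices k n" if "e \<in> G" for e
    using that G complete_edges_subset by blast
  have gsub: "g \<in> ?I" if "g \<in> gauge_coordinates k d" for g
    using that gauge_coordinates_subset[OF n] by blast
  have "\<forall>c\<in>?I. h c = 0"
  proof (rule generic_injective[where M = rigidity_matrix and E = ?E and I = ?I and p = p
        and q = "\<lambda>(v, j). of_nat (prime_weight v) ^ j"])
    show "algebraically_independent ?I p" using gen by (simp add: generic_def)
    show "finite ?I" using finite_vertices by simp
    show "rigidity_matrix r c \<in> polys_over ?I" if "r \<in> ?E" "c \<in> ?I" for r c
    proof (cases r)
      case (Inl e)
      then have "u \<in> vertices k n" if "u \<in> e" for u using \<open>r \<in> ?E\<close> sub that by blast
      then show ?thesis using Inl \<open>c \<in> ?I\<close>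
        unfolding rigidity_matrix_def
        by (auto simp: polys_over_0 simp del: split_paired_All
            intro!: polys_over_prod polys_over_indeterminate)
    qed (simp add: rigidity_matrix_def polys_over_0 polys_over_1)
  next
    fix y :: "rat config"
    assume y: "\<And>r. r \<in> ?E \<Longrightarrow>
      (\<Sum>c\<in>?I. eval_rat_poly (rigidity_matrix r c) (\<lambda>(v, j). of_nat (prime_weight v) ^ j) * y c) = 0"
    show "\<forall>c\<in>?I. y c = 0"
    proof
      fix c assume "c \<in> ?I"
      show "y c = 0"
      proof (rule locked_special_jacobian_injective[OF lock G k n _ _ \<open>c \<in> ?I\<close>])
        show "jacobian_form d (\<lambda>(v, j). of_nat (prime_weight v) ^ j) e y = 0" if "e \<in> G" for e
          using y[of "Inl e"] that unfolding rigidity_matrix_edge_row[OF sub[OF that]] by blast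
        show "y g = 0" if "g \<in> gauge_coordinates k d" for g
          using y[of "Inr g"] that unfolding rigidity_matrix_gauge_row[OF gsub[OF that]] by blast
      qed
    qed
  next
    fix r assume "r \<in> ?E"
    then show "(\<Sum>c\<in>?I. eval_rat_poly (rigidity_matrix r c) p * h c) = 0"
    proof
      assume "r \<in> Inl ` G"
      then obtain e where e: "r = Inl e" "e \<in> G" by blast
      show ?thesis unfolding e(1) rigidity_matrix_edge_row[OF sub[OF e(2)]] by (rule jac[OF e(2)])
    next
      assume "r \<in> Inr ` gauge_coordinates k d"
      then obtain g where g: "r = Inr g" "g \<in> gauge_coordinates k d" by blast
      show ?thesis unfolding g(1) rigidity_matrix_gauge_row[OF gsub[OF g(2)]] by (rule gauge[OF g(2)])
    qed
  qed
  then show ?thesis using c by blast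
qed

text \<open>The quadratic error of the linearisation, by induction on the number of factors. The constant does
not depend on \<open>h\<close>, so that it serves a whole neighbourhood.\<close>

lemma prod_remainder_bound:
  fixes p :: "'v \<Rightarrow> 'a::real_normed_field"
  assumes "finite e"
  shows "\<exists>B\<ge>0. \<forall>(h :: 'v \<Rightarrow> 'a) \<mu>. (\<forall>v\<in>e. norm (h v) \<le> \<mu>) \<and> 0 \<le> \<mu> \<and> \<mu> \<le> 1 \<longrightarrow>
    norm ((\<Prod>v\<in>e. p v + h v) - (\<Prod>v\<in>e. p v) - (\<Sum>v\<in>e. (\<Prod>u\<in>e - {v}. p u) * h v)) \<le> B * \<mu>\<^sup>2"
  using assms
proof (induction e rule: finite_induct)
  case empty
  show ?case by (intro exI[of _ 0]) auto
next
  case (insert w e)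
  then obtain B where B: "B \<ge> 0" "\<And>(h :: 'v \<Rightarrow> 'a) \<mu>. (\<forall>v\<in>e. norm (h v) \<le> \<mu>) \<Longrightarrow> 0 \<le> \<mu> \<Longrightarrow> \<mu> \<le> 1 \<Longrightarrow>
    norm ((\<Prod>v\<in>e. p v + h v) - (\<Prod>v\<in>e. p v) - (\<Sum>v\<in>e. (\<Prod>u\<in>e - {v}. p u) * h v)) \<le> B * \<mu>\<^sup>2"
    by blast
  define S where "S = (\<Sum>v\<in>e. norm (\<Prod>u\<in>e - {v}. p u))"
  have "S \<ge> 0" unfolding S_def by (intro sum_nonneg) auto
  show ?case
  proof (intro exI[of _ "(norm (p w) + 1) * B + S"] conjI allI impI)
    show "0 \<le> (norm (p w) + 1) * B + S" using B(1) \<open>S \<ge> 0\<close> by simp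
  next
    fix h :: "'v \<Rightarrow> 'a" and \<mu> assume *: "(\<forall>v\<in>insert w e. norm (h v) \<le> \<mu>) \<and> 0 \<le> \<mu> \<and> \<mu> \<le> (1::real)"
    define L where "L = (\<Sum>v\<in>e. (\<Prod>u\<in>e - {v}. p u) * h v)"
    define R where "R = (\<Prod>v\<in>e. p v + h v) - (\<Prod>v\<in>e. p v) - L"
    have R: "norm R \<le> B * \<mu>\<^sup>2" unfolding R_def L_def using * by (intro B(2)) auto
    have "norm L \<le> (\<Sum>v\<in>e. norm (\<Prod>u\<in>e - {v}. p u) * \<mu>)"
      unfolding L_def using *
      by (intro sum_norm_le) (auto simp: norm_mult intro: mult_left_mono)
    then have L: "norm L \<le> S * \<mu>" by (simp add: S_def sum_distrib_right)
    have "(\<Sum>v\<in>e. (\<Prod>u\<in>insert w e - {v}. p u) * h v) = (\<Sum>v\<in>e. p w * ((\<Prod>u\<in>e - {v}. p u) * h v))"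
    proof (intro sum.cong refl)
      fix v assume "v \<in> e"
      then have "insert w e - {v} = insert w (e - {v})" using insert.hyps by auto
      then show "(\<Prod>u\<in>insert w e - {v}. p u) * h v = p w * ((\<Prod>u\<in>e - {v}. p u) * h v)"
        using insert.hyps by (simp add: mult.assoc)
    qed
    moreover have "insert w e - {w} = e" using insert.hyps by auto
    ultimately have lin: "(\<Sum>v\<in>insert w e. (\<Prod>u\<in>insert w e - {v}. p u) * h v) =
        (\<Prod>v\<in>e. p v) * h w + p w * L"
      using insert.hyps by (simp add: L_def sum_distrib_left)
    have "(\<Prod>v\<in>insert w e. p v + h v) - (\<Prod>v\<in>insert w e. p v) -
        (\<Sum>v\<in>insert w e. (\<Prod>u\<in>insert w e - {v}. p u) * h v) = (p w + h w) * R + h w * L"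
      unfolding lin using insert.hyps by (simp add: R_def algebra_simps)
    also have "norm \<dots> \<le> (norm (p w) + 1) * (B * \<mu>\<^sup>2) + \<mu> * (S * \<mu>)"
    proof (rule order_trans[OF norm_triangle_ineq], rule add_mono)
      have "norm (p w + h w) \<le> norm (p w) + 1"
        using * by (intro order_trans[OF norm_triangle_ineq]) auto
      then show "norm ((p w + h w) * R) \<le> (norm (p w) + 1) * (B * \<mu>\<^sup>2)"
        unfolding norm_mult using R by (intro mult_mono) auto
      show "norm (h w * L) \<le> \<mu> * (S * \<mu>)"
        unfolding norm_mult using L * by (intro mult_mono) auto
    qed
    also have "\<dots> = ((norm (p w) + 1) * B + S) * \<mu>\<^sup>2"
      by (simp add: power2_eq_square algebra_simps)
    finally show "norm ((\<Prod>v\<in>insert w e. p v + h v) - (\<Prod>v\<in>insert w e. p v) -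
        (\<Sum>v\<in>insert w e. (\<Prod>u\<in>insert w e - {v}. p u) * h v)) \<le> ((norm (p w) + 1) * B + S) * \<mu>\<^sup>2" .
  qed
qed

lemma jacobian_remainder_bound:
  fixes p :: "'a::real_normed_field config"
  assumes "finite e"
  shows "\<exists>B\<ge>0. \<forall>q \<mu>. (\<forall>v\<in>e. \<forall>j<d. norm (q (v, j) - p (v, j)) \<le> \<mu>) \<and> 0 \<le> \<mu> \<and> \<mu> \<le> 1 \<longrightarrow>
    norm ((\<Sum>j<d. \<Prod>v\<in>e. q (v, j)) - (\<Sum>j<d. \<Prod>v\<in>e. p (v, j)) -
      jacobian_form d p e (\<lambda>c. q c - p c)) \<le> B * \<mu>\<^sup>2"
proof -
  define Q where "Q j B \<longleftrightarrow> B \<ge> 0 \<and> (\<forall>h \<mu>. (\<forall>v\<in>e. norm (h v) \<le> \<mu>) \<and> 0 \<le> \<mu> \<and> \<mu> \<le> 1 \<longrightarrow>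
    norm ((\<Prod>v\<in>e. p (v, j) + h v) - (\<Prod>v\<in>e. p (v, j)) -
      (\<Sum>v\<in>e. (\<Prod>u\<in>e - {v}. p (u, j)) * h v)) \<le> B * \<mu>\<^sup>2)" for j B
  have "\<exists>B. Q j B" for j
    unfolding Q_def using prod_remainder_bound[OF assms] .
  then obtain B where "\<And>j. Q j (B j)" by metis
  then have B: "\<And>j. B j \<ge> 0"
    "\<And>j h \<mu>. (\<forall>v\<in>e. norm (h v) \<le> \<mu>) \<Longrightarrow> 0 \<le> \<mu> \<Longrightarrow> \<mu> \<le> 1 \<Longrightarrow>
    norm ((\<Prod>v\<in>e. p (v, j) + h v) - (\<Prod>v\<in>e. p (v, j)) -
      (\<Sum>v\<in>e. (\<Prod>u\<in>e - {v}. p (u, j)) * h v)) \<le> B j * \<mu>\<^sup>2"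
    unfolding Q_def by blast+
  show ?thesis
  proof (intro exI[of _ "\<Sum>j<d. B j"] conjI allI impI)
    show "(\<Sum>j<d. B j) \<ge> 0" using B(1) by (intro sum_nonneg) auto
    fix q \<mu> assume *: "(\<forall>v\<in>e. \<forall>j<d. norm (q (v, j) - p (v, j)) \<le> \<mu>) \<and> 0 \<le> \<mu> \<and> \<mu> \<le> (1::real)"
    have "(\<Sum>j<d. \<Prod>v\<in>e. q (v, j)) - (\<Sum>j<d. \<Prod>v\<in>e. p (v, j)) - jacobian_form d p e (\<lambda>c. q c - p c) =
      (\<Sum>j<d. (\<Prod>v\<in>e. p (v, j) + (q (v, j) - p (v, j))) - (\<Prod>v\<in>e. p (v, j)) -
      (\<Sum>v\<in>e. (\<Prod>u\<in>e - {v}. p (u, j)) * (q (v, j) - p (v, j))))"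
      by (simp add: jacobian_form_def sum_subtractf)
    also have "norm \<dots> \<le> (\<Sum>j<d. B j * \<mu>\<^sup>2)"
      using * by (intro sum_norm_le B(2)) auto
    finally show "norm ((\<Sum>j<d. \<Prod>v\<in>e. q (v, j)) - (\<Sum>j<d. \<Prod>v\<in>e. p (v, j)) -
      jacobian_form d p e (\<lambda>c. q c - p c)) \<le> (\<Sum>j<d. B j) * \<mu>\<^sup>2"
      by (simp add: sum_distrib_right)
  qed
qed

text \<open>By \<open>linear_form_combination\<close>, injectivity of the Jacobian with the gauge rows gives a left inverse. A
point of the fibre at distance \<open>\<mu>\<close> in the maximum norm that agrees on the gauge coordinates is
mapped to zero up to an error of order \<open>\<mu>\<^sup>2\<close>, so \<open>\<mu> \<le> K \<mu>\<^sup>2\<close>, which forces \<open>\<mu> = 0\<close> when \<open>\<mu>\<close> is small.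
This takes the place of the inverse function theorem and works over the reals and the complex
numbers alike.\<close>

lemma isolated_in_fibre:
  fixes p :: "'a::real_normed_field config"
  assumes finI: "finite I" and finG: "finite G" and finE: "\<And>e. e \<in> G \<Longrightarrow> finite e"
    and sub: "\<And>e. e \<in> G \<Longrightarrow> e \<times> {..<d} \<subseteq> I"
    and finite\<Gamma>: "finite \<Gamma>"
    and inj: "\<And>h c. (\<And>e. e \<in> G \<Longrightarrow> jacobian_form d p e h = 0) \<Longrightarrow> (\<And>g. g \<in> \<Gamma> \<Longrightarrow> h g = 0) \<Longrightarrow>
      c \<in> I \<Longrightarrow> h c = 0"
  shows "\<exists>\<delta>>0. \<forall>q. (\<forall>g\<in>\<Gamma>. q g = p g) \<and> (\<forall>c\<in>I. norm (q c - p c) < \<delta>) \<and>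
    (\<forall>e\<in>G. (\<Sum>j<d. \<Prod>v\<in>e. q (v, j)) = (\<Sum>j<d. \<Prod>v\<in>e. p (v, j))) \<longrightarrow> (\<forall>c\<in>I. q c = p c)"
proof -
  define E :: "(vertex set + vertex \<times> nat) set" where "E = Inl ` G \<union> Inr ` \<Gamma>"
  define a where "a r h = (case r of Inl e \<Rightarrow> jacobian_form d p e h | Inr g \<Rightarrow> h g)"
    for r :: "vertex set + vertex \<times> nat" and h :: "'a config"
  have "linear_form (a r)" for r
  proof (cases r)
    case (Inl e)
    show ?thesis
      unfolding a_def linear_form_def jacobian_form_def Inl
      by (simp add: algebra_simps sum.distrib sum_distrib_left)
  next
    case (Inr g)
    show ?thesis unfolding a_def linear_form_def Inr by simp
  qed
  moreover have "finite E" using finG finite\<Gamma> by (simp add: E_def)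
  ultimately have comb: "\<exists>f. \<forall>h. b h = (\<Sum>r\<in>E. f r * a r h)"
    if "linear_form b" "\<And>h. (\<And>r. r \<in> E \<Longrightarrow> a r h = 0) \<Longrightarrow> b h = 0" for b
    using that by (intro linear_form_combination) auto
  have "\<exists>f. c \<in> I \<longrightarrow> (\<forall>h. h c = (\<Sum>r\<in>E. f r * a r h))" for c
  proof (cases "c \<in> I")
    case True
    have "\<exists>f. \<forall>h. h c = (\<Sum>r\<in>E. f r * a r h)"
    proof (rule comb[OF linear_form_coordinate])
      fix h assume h: "\<And>r. r \<in> E \<Longrightarrow> a r h = 0"
      have "jacobian_form d p e h = 0" if "e \<in> G" for e
        using h[of "Inl e"] that by (simp add: E_def a_def)
      moreover have "h g = 0" if "g \<in> \<Gamma>" for g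
        using h[of "Inr g"] that by (simp add: E_def a_def)
      ultimately show "h c = 0" using inj True by blast
    qed
    then show ?thesis by blast
  qed simp
  then obtain f where f: "\<And>c h. c \<in> I \<Longrightarrow> h c = (\<Sum>r\<in>E. f c r * a r h)" by metis
  define Q where "Q e B \<longleftrightarrow> B \<ge> 0 \<and> (\<forall>q \<mu>. (\<forall>v\<in>e. \<forall>j<d. norm (q (v, j) - p (v, j)) \<le> \<mu>) \<and>
    0 \<le> \<mu> \<and> \<mu> \<le> 1 \<longrightarrow> norm ((\<Sum>j<d. \<Prod>v\<in>e. q (v, j)) - (\<Sum>j<d. \<Prod>v\<in>e. p (v, j)) -
      jacobian_form d p e (\<lambda>c. q c - p c)) \<le> B * \<mu>\<^sup>2)" for e B
  have "\<exists>B. e \<in> G \<longrightarrow> Q e B" for e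
    unfolding Q_def using jacobian_remainder_bound[OF finE] by blast
  then obtain B where "\<And>e. e \<in> G \<Longrightarrow> Q e (B e)" by metis
  then have B0: "\<And>e. e \<in> G \<Longrightarrow> B e \<ge> 0"
    and B: "\<And>e q \<mu>. e \<in> G \<Longrightarrow> (\<forall>v\<in>e. \<forall>j<d. norm (q (v, j) - p (v, j)) \<le> \<mu>) \<Longrightarrow> 0 \<le> \<mu> \<Longrightarrow> \<mu> \<le> 1 \<Longrightarrow>
    norm ((\<Sum>j<d. \<Prod>v\<in>e. q (v, j)) - (\<Sum>j<d. \<Prod>v\<in>e. p (v, j)) -
      jacobian_form d p e (\<lambda>c. q c - p c)) \<le> B e * \<mu>\<^sup>2"
    unfolding Q_def by blast+
  define K where "K = (\<Sum>c\<in>I. \<Sum>e\<in>G. norm (f c (Inl e)) * B e)"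
  have Kc: "(\<Sum>e\<in>G. norm (f c (Inl e)) * B e) \<le> K" if "c \<in> I" for c
    unfolding K_def using that finI B0
    by (intro member_le_sum[of c I "\<lambda>c. \<Sum>e\<in>G. norm (f c (Inl e)) * B e"]) (auto intro!: sum_nonneg)
  have K0: "K \<ge> 0" unfolding K_def using B0 by (intro sum_nonneg) auto
  define \<delta> where "\<delta> = 1 / (K + 1)"
  have \<delta>: "\<delta> > 0" "\<delta> \<le> 1" using K0 by (auto simp: \<delta>_def field_simps)
  show ?thesis
  proof (intro exI[of _ \<delta>] conjI allI impI ballI)
    fix q c assume *: "(\<forall>g\<in>\<Gamma>. q g = p g) \<and> (\<forall>c\<in>I. norm (q c - p c) < \<delta>) \<and>
      (\<forall>e\<in>G. (\<Sum>j<d. \<Prod>v\<in>e. q (v, j)) = (\<Sum>j<d. \<Prod>v\<in>e. p (v, j)))" and c: "c \<in> I"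
    define h where "h = (\<lambda>c. q c - p c)"
    define \<mu> where "\<mu> = Max ((\<lambda>c. norm (h c)) ` I)"
    have le: "norm (h c) \<le> \<mu>" if "c \<in> I" for c
      unfolding \<mu>_def using that finI by simp
    have "\<mu> \<in> (\<lambda>c. norm (h c)) ` I"
      unfolding \<mu>_def using c finI by (intro Max_in) auto
    then obtain c0 where c0: "c0 \<in> I" "\<mu> = norm (h c0)" by blast
    have \<mu>: "0 \<le> \<mu>" "\<mu> < \<delta>" using c0 * by (auto simp: h_def)
    have rem: "norm (jacobian_form d p e h) \<le> B e * \<mu>\<^sup>2" if e: "e \<in> G" for e
    proof -
      have "\<forall>v\<in>e. \<forall>j<d. norm (q (v, j) - p (v, j)) \<le> \<mu>"
        using sub[OF e] le by (auto simp: h_def)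
      then have "norm ((\<Sum>j<d. \<Prod>v\<in>e. q (v, j)) - (\<Sum>j<d. \<Prod>v\<in>e. p (v, j)) -
          jacobian_form d p e (\<lambda>c. q c - p c)) \<le> B e * \<mu>\<^sup>2"
        using \<mu> \<delta> by (intro B[OF e]) auto
      then show ?thesis using * e by (simp add: h_def)
    qed
    have "h c0 = (\<Sum>r\<in>Inl ` G. f c0 r * a r h) + (\<Sum>r\<in>Inr ` \<Gamma>. f c0 r * a r h)"
      unfolding f[OF c0(1), of h] E_def using finG finite\<Gamma> by (intro sum.union_disjoint) auto
    also have "(\<Sum>r\<in>Inr ` \<Gamma>. f c0 r * a r h) = 0"
      using * by (intro sum.neutral) (auto simp: a_def h_def)
    also have "(\<Sum>r\<in>Inl ` G. f c0 r * a r h) = (\<Sum>e\<in>G. f c0 (Inl e) * jacobian_form d p e h)"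
      by (subst sum.reindex) (auto simp: a_def)
    finally have "\<mu> = norm (\<Sum>e\<in>G. f c0 (Inl e) * jacobian_form d p e h)"
      using c0 by simp
    also have "\<dots> \<le> (\<Sum>e\<in>G. norm (f c0 (Inl e)) * (B e * \<mu>\<^sup>2))"
      using rem by (intro sum_norm_le) (auto simp: norm_mult intro: mult_left_mono)
    also have "\<dots> = (\<Sum>e\<in>G. norm (f c0 (Inl e)) * B e) * \<mu>\<^sup>2"
      by (simp add: sum_distrib_right mult.assoc)
    also have "\<dots> \<le> K * \<mu>\<^sup>2" using Kc[OF c0(1)] by (intro mult_right_mono) auto
    finally have "\<mu> \<le> (K * \<mu>) * \<mu>" by (simp add: power2_eq_square mult.assoc)
    moreover have "K * \<mu> < 1"
    proof -
      have "(K + 1) * \<mu> < 1" using \<mu>(2) K0 by (simp add: \<delta>_def field_simps)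
      then show ?thesis using \<mu>(1) by (simp add: algebra_simps)
    qed
    ultimately have "\<mu> = 0"
      using \<mu>(1) mult_strict_right_mono[of "K * \<mu>" 1 \<mu>] by (cases "\<mu> = 0") auto
    then show "q c = p c" using le[OF c] by (simp add: h_def)
  qed (rule \<delta>)
qed

lemma tendsto_config_coordinate:
  fixes p :: "'a::topological_space config"
  assumes "p \<in> topspace (config_topology V d)" "c \<in> V \<times> {..<d}"
  shows "((\<lambda>q. q c) \<longlongrightarrow> p c) (nhdsin (config_topology V d) p)"
proof (rule topological_tendstoI)
  fix W :: "'a set" assume W: "open W" "p c \<in> W"
  have "continuous_map (config_topology V d) euclidean (\<lambda>q. q c)"
    unfolding config_topology_def using assms(2) by (rule continuous_map_product_projection)
  then have "openin (config_topology V d) {q \<in> topspace (config_topology V d). q c \<in> W}"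
    by (rule openin_continuous_map_preimage) (simp add: W(1))
  then show "\<forall>\<^sub>F q in nhdsin (config_topology V d) p. q c \<in> W"
    using assms(1) W(2) by (auto simp: eventually_nhdsin)
qed

lemma foldr_mult_mat_diag:
  "foldr (*) (map (\<lambda>i. mat_diag d (f i)) xs) (1\<^sub>m d) =
    mat_diag d (\<lambda>j. prod_list (map (\<lambda>i. f i j) xs :: 'a::field list))"
  by (induction xs) auto

lemma congruent_by_scaling:
  fixes p q :: "'a::field config"
  assumes s0: "\<And>i j. i < k \<Longrightarrow> j < d \<Longrightarrow> s i j \<noteq> 0"
    and s1: "\<And>j. j < d \<Longrightarrow> (\<Prod>i<k. s i j) = 1"
    and q: "\<And>i v j. i < k \<Longrightarrow> v \<in> vertex_class n i \<Longrightarrow> j < d \<Longrightarrow> q (v, j) = s i j * p (v, j)"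
  shows "congruent_configs k n d p q"
  unfolding congruent_configs_def
proof (intro exI conjI allI impI ballI)
  show "permutation_mat d (1\<^sub>m d :: 'a mat)"
    unfolding permutation_mat_def
    by (intro exI[of _ id] conjI permutes_id) (auto simp: one_mat_def)
  let ?D = "\<lambda>i. mat_diag d (s i)"
  fix i assume i: "i < k"
  show "?D i \<in> carrier_mat d d" by simp
  show "diagonal_mat (?D i)" by (auto simp: diagonal_mat_def mat_diag_def)
  have "mat_diag d (s i) * mat_diag d (\<lambda>j. inverse (s i j)) = 1\<^sub>m d"
    "mat_diag d (\<lambda>j. inverse (s i j)) * mat_diag d (s i) = 1\<^sub>m d"
    using s0[OF i] by (auto simp: mat_diag_diag) (auto simp: mat_diag_def one_mat_def intro!: eq_matI)
  then show "invertible_mat (?D i)"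
    unfolding invertible_mat_def inverts_mat_def
    by (intro conjI exI[of _ "mat_diag d (\<lambda>j. inverse (s i j))"]) (auto simp: mat_diag_def)
  fix v assume v: "v \<in> vertex_class n i"
  show "point d q v = ?D i *\<^sub>v (1\<^sub>m d *\<^sub>v point d p v)"
  proof (rule eq_vecI)
    fix j assume "j < dim_vec (?D i *\<^sub>v (1\<^sub>m d *\<^sub>v point d p v))"
    then have j: "j < d" by (simp add: mat_diag_def)
    have "1\<^sub>m d *\<^sub>v point d p v = point d p v"
      by (intro one_mult_mat_vec) (simp add: point_def)
    then have "(?D i *\<^sub>v (1\<^sub>m d *\<^sub>v point d p v)) $ j = (\<Sum>l\<in>{0..<d}. (if j = l then s i l else 0) * p (v, l))"
      using j by (simp add: mat_diag_def scalar_prod_def point_def)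
    also have "\<dots> = (\<Sum>l\<in>{0..<d}. if l = j then s i l * p (v, l) else 0)"
      by (intro sum.cong) auto
    also have "\<dots> = point d q v $ j" using j q[OF i v j] by (simp add: point_def)
    finally show "point d q v $ j = (?D i *\<^sub>v (1\<^sub>m d *\<^sub>v point d p v)) $ j" by simp
  qed (simp add: point_def mat_diag_def)
next
  have "mat_diag d (\<lambda>j. prod_list (map (\<lambda>i. s i j) [0..<k])) = 1\<^sub>m d"
    using s1 by (auto simp: mat_diag_def one_mat_def prod.list_conv_set_nth atLeast0LessThan intro!: eq_matI)
  then show "foldr (*) (map (\<lambda>i. mat_diag d (s i)) [0..<k]) (1\<^sub>m d) = 1\<^sub>m d"
    by (simp add: foldr_mult_mat_diag)
qed


text \<open>A configuration \<open>q\<close> near \<open>p\<close> is first rescaled so that its gauge coordinates become those of \<open>p\<close>. The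
factors tend to \<open>1\<close> as \<open>q\<close> tends to \<open>p\<close>, and they keep the values on all edges, so
\<open>isolated_in_fibre\<close> applies to the rescaled configuration. The witness of congruence uses the
identity permutation.\<close>

theorem locked_imp_locally_rigid:
  assumes lock: "locked k d G (vertices k n)" and G: "G \<subseteq> complete_edges k n"
    and k: "0 < k" and n: "0 < n"
  shows "locally_rigid TYPE('a::real_normed_field) k n d G"
  unfolding locally_rigid_def
proof (intro allI impI)
  fix p :: "'a config"
  let ?T = "config_topology (vertices k n) d :: 'a config topology"
  let ?I = "vertices k n \<times> {..<d}"
  assume "p \<in> topspace ?T \<and> generic (vertices k n) d p"
  then have pT: "p \<in> topspace ?T" and gen: "generic (vertices k n) d p" by auto
  have finI: "finite ?I" using finite_vertices by simp
  have p_nz: "p c \<noteq> 0" if "c \<in> ?I" for c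
  proof -
    have "indeterminate c \<noteq> (0 :: (vertex \<times> nat \<Rightarrow>\<^sub>0 nat) \<Rightarrow>\<^sub>0 rat)"
      by (metis eval_rat_poly_0 eval_rat_poly_indeterminate[of c "\<lambda>_. 1 :: rat"] one_neq_zero)
    then show ?thesis
      using generic_eval_nonzero[OF gen[unfolded generic_def] polys_over_indeterminate[OF that]]
      by (simp add: eval_rat_poly_indeterminate)
  qed
  have "\<exists>\<delta>>0. \<forall>q. (\<forall>g\<in>gauge_coordinates k d. q g = p g) \<and> (\<forall>c\<in>?I. norm (q c - p c) < \<delta>) \<and>
    (\<forall>e\<in>G. (\<Sum>j<d. \<Prod>v\<in>e. q (v, j)) = (\<Sum>j<d. \<Prod>v\<in>e. p (v, j))) \<longrightarrow> (\<forall>c\<in>?I. q c = p c)"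
  proof (rule isolated_in_fibre[OF finI])
    show "finite G" using G finite_complete_edges finite_subset by blast
    show "finite e" if "e \<in> G" for e using that G finite_edge by blast
    show "e \<times> {..<d} \<subseteq> ?I" if "e \<in> G" for e using that G complete_edges_subset by blast
  qed (use finite_gauge_coordinates locked_generic_jacobian_injective[OF lock G k n gen] in auto)
  then obtain \<delta> where \<delta>: "\<delta> > 0" "\<And>q. (\<forall>g\<in>gauge_coordinates k d. q g = p g) \<Longrightarrow>
      (\<forall>c\<in>?I. norm (q c - p c) < \<delta>) \<Longrightarrow>
      (\<forall>e\<in>G. (\<Sum>j<d. \<Prod>v\<in>e. q (v, j)) = (\<Sum>j<d. \<Prod>v\<in>e. p (v, j))) \<Longrightarrow> \<forall>c\<in>?I. q c = p c"
    by blast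
  \<comment> \<open>The factor of the last class makes the product over all classes equal to \<open>1\<close>.\<close>
  define s where "s q i j = (if i < k - 1 then p ((i, 0), j) / q ((i, 0), j)
      else \<Prod>i<k - 1. q ((i, 0), j) / p ((i, 0), j))" for q :: "'a config" and i j
  define rescale where "rescale q c = q c * s q (fst (fst c)) (snd c)" for q c
  have base: "((i, 0), j) \<in> ?I" if "i < k - 1" "j < d" for i j
    using that n by (simp add: mem_vertices)
  have tends_s: "((\<lambda>q. s q i j) \<longlongrightarrow> 1) (nhdsin ?T p)" if "j < d" for i j
  proof (cases "i < k - 1")
    case True
    have "((\<lambda>q. p ((i, 0), j) / q ((i, 0), j)) \<longlongrightarrow> p ((i, 0), j) / p ((i, 0), j)) (nhdsin ?T p)"
      using base[OF True that] p_nz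
      by (intro tendsto_divide tendsto_const tendsto_config_coordinate[OF pT]) auto
    then show ?thesis using True p_nz[OF base[OF True that]] by (simp add: s_def)
  next
    case False
    have "((\<lambda>q. \<Prod>i<k - 1. q ((i, 0), j) / p ((i, 0), j)) \<longlongrightarrow>
        (\<Prod>i<k - 1. p ((i, 0), j) / p ((i, 0), j))) (nhdsin ?T p)"
      using base that p_nz
      by (intro tendsto_prod tendsto_divide tendsto_const tendsto_config_coordinate[OF pT]) auto
    moreover have "(\<Prod>i<k - 1. p ((i, 0), j) / p ((i, 0), j)) = 1"
      using p_nz base that by (intro prod.neutral) auto
    ultimately show ?thesis using False by (simp add: s_def)
  qed
  have ev1: "\<forall>\<^sub>F q in nhdsin ?T p. \<forall>c\<in>?I. q c \<noteq> 0"
  proof (intro eventually_ball_finite[OF finI] ballI)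
    fix c assume c: "c \<in> ?I"
    show "\<forall>\<^sub>F q in nhdsin ?T p. q c \<noteq> 0"
      by (rule tendsto_imp_eventually_ne[OF tendsto_config_coordinate[OF pT c] p_nz[OF c]])
  qed
  have ev2: "\<forall>\<^sub>F q in nhdsin ?T p. \<forall>c\<in>?I. norm (rescale q c - p c) < \<delta>"
  proof (intro eventually_ball_finite[OF finI] ballI)
    fix c assume c: "c \<in> ?I"
    have "((\<lambda>q. rescale q c) \<longlongrightarrow> p c * 1) (nhdsin ?T p)"
      unfolding rescale_def using c
      by (intro tendsto_mult tends_s tendsto_config_coordinate[OF pT]) auto
    then show "\<forall>\<^sub>F q in nhdsin ?T p. norm (rescale q c - p c) < \<delta>"
      using tendstoD[OF _ \<delta>(1), of "\<lambda>q. rescale q c" "p c"] by (simp add: dist_norm)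
  qed
  from eventually_conj[OF ev1 ev2] obtain U where U: "openin ?T U" "p \<in> U"
      "\<And>q. q \<in> U \<Longrightarrow> (\<forall>c\<in>?I. q c \<noteq> 0) \<and> (\<forall>c\<in>?I. norm (rescale q c - p c) < \<delta>)"
    using pT by (auto simp: eventually_nhdsin)
  have "congruent_configs k n d p q" if q: "q \<in> U" and eq: "rigidity_map G d q = rigidity_map G d p" for q
  proof -
    have q_nz: "q c \<noteq> 0" if "c \<in> ?I" for c using U(3)[OF q] that by blast
    have s_nz: "s q i j \<noteq> 0" if "j < d" for i j
      using that q_nz p_nz base by (auto simp: s_def)
    have s_prod: "(\<Prod>i<k. s q i j) = 1" if j: "j < d" for j
    proof -
      obtain l where l: "k = Suc l" using k gr0_implies_Suc by blast
      have "(\<Prod>i<l. s q i j) * (\<Prod>i<l. q ((i, 0), j) / p ((i, 0), j)) =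
          (\<Prod>i<l. (p ((i, 0), j) / q ((i, 0), j)) * (q ((i, 0), j) / p ((i, 0), j)))"
        unfolding prod.distrib by (simp add: s_def l)
      also have "\<dots> = 1"
        using q_nz p_nz base j by (intro prod.neutral) (auto simp: l)
      finally show ?thesis by (simp add: l s_def)
    qed
    have "\<forall>c\<in>?I. rescale q c = p c"
    proof (rule \<delta>(2))
      show "\<forall>g\<in>gauge_coordinates k d. rescale q g = p g"
        using q_nz base by (auto simp: gauge_coordinates_def rescale_def s_def)
      show "\<forall>c\<in>?I. norm (rescale q c - p c) < \<delta>" using U(3)[OF q] by blast
      show "\<forall>e\<in>G. (\<Sum>j<d. \<Prod>v\<in>e. rescale q (v, j)) = (\<Sum>j<d. \<Prod>v\<in>e. p (v, j))"
      proof
        fix e assume e: "e \<in> G"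
        then obtain g where g: "e = transversal k g" using G complete_edgesE by (metis subsetD)
        have "(\<Prod>v\<in>e. rescale q (v, j)) = (\<Prod>v\<in>e. q (v, j))" if "j < d" for j
          unfolding rescale_def prod.distrib g using s_prod[OF that] by (simp add: prod_transversal)
        then have "(\<Sum>j<d. \<Prod>v\<in>e. rescale q (v, j)) = (\<Sum>j<d. \<Prod>v\<in>e. q (v, j))" by simp
        also have "\<dots> = (\<Sum>j<d. \<Prod>v\<in>e. p (v, j))"
          using fun_cong[OF eq, of e] e by (simp add: rigidity_map_def)
        finally show "(\<Sum>j<d. \<Prod>v\<in>e. rescale q (v, j)) = (\<Sum>j<d. \<Prod>v\<in>e. p (v, j))" .
      qed
    qed
    then have q_eq: "q c = inverse (s q (fst (fst c)) (snd c)) * p c" if "c \<in> ?I" for c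
      using that s_nz[of "snd c" "fst (fst c)"] by (auto simp: rescale_def field_simps)
    show ?thesis
    proof (rule congruent_by_scaling[where s = "\<lambda>i j. inverse (s q i j)"])
      show "inverse (s q i j) \<noteq> 0" if "i < k" "j < d" for i j using s_nz that by simp
      show "(\<Prod>i<k. inverse (s q i j)) = 1" if "j < d" for j
        using s_prod[OF that] by (simp add: prod_inversef[unfolded o_def])
      show "q (v, j) = inverse (s q i j) * p (v, j)"
        if "i < k" "v \<in> vertex_class n i" "j < d" for i v j
        using q_eq[of "(v, j)"] that by (auto simp: vertex_class_def mem_vertices)
    qed
  qed
  then show "locally_rigid_at k n d G p"
    unfolding locally_rigid_at_def using U(1,2) by blast
qed



lemma locked_subset:
  assumes "locked k d S C" "C' \<subseteq> C"
  shows "locked k d S C'"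
proof (rule lockedI)
  fix z assume "motion d S z"
  from lockedD[OF assms(1) this] show
    "\<exists>c. (\<forall>j<d. (\<Sum>i<k. c i j) = 0) \<and> (\<forall>v\<in>C'. \<forall>j<d. z (v, j) = c (fst v) j)"
    using assms(2) by blast
qed

section \<open>Dense implied edges force a large locked set\<close>

text \<open>Averaging over seeds. Cut each class into \<open>m = n div d\<close> blocks of \<open>d\<close> consecutive vertices and choose a
block \<open>b i\<close> in each class \<open>i\<close>. A non-implied edge spoils at most one choice of blocks as a seed. It also
belongs to at most one attachment, with the diagonal choice of positions \<open>s < d\<close>, of a vertex of
class \<open>i\<close> to the blocks of the other classes, and hence to at most \<open>m\<close> choices of blocks. So if few
edges are not implied, some choice of blocks is a seed to which all but \<open>\<eta> n\<close> vertices of each class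
are attached.\<close>

lemma dense_implied_imp_locked:
  fixes \<eta> :: real
  assumes k: "3 \<le> k" and d: "0 < d" and \<eta>: "0 < \<eta>" and n: "2 * d \<le> n"
    and dense: "real (card {e \<in> complete_edges k n. \<not> implied d S e}) * (1 + k / \<eta>) * (2 * (2 * d) ^ k)
      \<le> real n ^ k"
  shows "\<exists>C\<subseteq>vertices k n. locked k d S C \<and> (\<forall>i<k. real (card (C \<inter> vertex_class n i)) \<ge> (1 - \<eta>) * n)"
proof -
  define m where "m = n div d"
  have md: "m * d \<le> n" by (simp add: m_def)
  have n_lt: "n < m * d + d" unfolding m_def using d
    by (metis dividend_less_div_times mult.commute add.commute)
  have m: "real n \<le> real m * (2 * d)"
  proof -
    have "n \<le> 2 * (m * d)" using n_lt n by linarith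
    then have "real n \<le> real (2 * (m * d))" by (rule of_nat_mono)
    then show ?thesis by (simp add: mult_ac)
  qed
  have m0: "0 < m" using n d by (auto simp: m_def div_greater_zero_iff)
  have mn: "m \<le> n" by (simp add: m_def)
  have lt: "x * d + s < n" if "x < m" "s < d" for x s
  proof -
    have "x * d + s < (x + 1) * d" using that by simp
    also have "\<dots> \<le> m * d" using that by (intro mult_right_mono) auto
    finally show ?thesis using md by simp
  qed
  define P where "P = {..<k} \<rightarrow>\<^sub>E {..<m}"
  define Bd where "Bd = {g \<in> {..<k} \<rightarrow>\<^sub>E {..<n}. \<not> implied d S (transversal k g)}"
  have finBd: "finite Bd" unfolding Bd_def by (rule finite_subset[of _ "{..<k} \<rightarrow>\<^sub>E {..<n}"]) (auto intro: finite_PiE)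
  have finP: "finite P" unfolding P_def by (intro finite_PiE) auto
  have cardBd: "card {e \<in> complete_edges k n. \<not> implied d S e} = card Bd"
  proof -
    have "{e \<in> complete_edges k n. \<not> implied d S e} = transversal k ` Bd"
      unfolding complete_edges_eq Bd_def by blast
    moreover have "inj_on (transversal k) Bd"
      unfolding Bd_def by (rule inj_on_subset[OF inj_on_transversal[of k "\<lambda>_. {..<n}"]]) blast
    ultimately show ?thesis by (simp add: card_image)
  qed
  define spread where "spread b \<sigma> = (\<lambda>i\<in>{..<k}. b i * d + \<sigma> i)" for b \<sigma> :: "nat \<Rightarrow> nat"
  define attach where "attach b i a s = (\<lambda>l\<in>{..<k}. if l = i then a else b l * d + s)" for b :: "nat \<Rightarrow> nat" and i a s
  \<comment> \<open>\<open>Bad\<close>: some edge inside the chosen blocks is not implied. \<open>U i b\<close>: the vertices of class \<open>i\<close> that are not attached.\<close>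
  define Bad where "Bad = {b \<in> P. \<exists>\<sigma>. (\<forall>i<k. \<sigma> i < d) \<and> spread b \<sigma> \<in> Bd}"
  define U where "U i b = {a. a < n \<and> (\<exists>s<d. attach b i a s \<in> Bd)}" for i b
  define Bad' where "Bad' i = {b \<in> P. real (card (U i b)) > \<eta> * n}" for i
  have "Bad \<subseteq> (\<lambda>g. \<lambda>i\<in>{..<k}. g i div d) ` Bd"
  proof
    fix b assume "b \<in> Bad"
    then obtain \<sigma> where \<sigma>: "b \<in> P" "\<forall>i<k. \<sigma> i < d" "spread b \<sigma> \<in> Bd" by (auto simp: Bad_def)
    have "b = (\<lambda>i\<in>{..<k}. spread b \<sigma> i div d)"
    proof
      fix i show "b i = (\<lambda>i\<in>{..<k}. spread b \<sigma> i div d) i"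
        using \<sigma>(1,2) d by (auto simp: spread_def P_def PiE_def extensional_def)
    qed
    then show "b \<in> (\<lambda>g. \<lambda>i\<in>{..<k}. g i div d) ` Bd" using \<sigma>(3) by blast
  qed
  then have cardBad: "card Bad \<le> card Bd" using surj_card_le finBd by blast
  have finU: "finite (U i b)" for i b by (simp add: U_def)
  have cardBad': "real (card (Bad' i)) * (\<eta> * n) \<le> real (card Bd) * m" if i: "i < k" for i
  proof -
    have sub: "(SIGMA b:P. U i b) \<subseteq>
        (\<lambda>(g, t). ((\<lambda>l\<in>{..<k}. if l = i then t else g l div d), g i)) ` (Bd \<times> {..<m})"
    proof
      fix x assume "x \<in> (SIGMA b:P. U i b)"
      then obtain b a s where x: "x = (b, a)" "b \<in> P" "a < n" "s < d" "attach b i a s \<in> Bd"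
        by (auto simp: U_def)
      have "b = (\<lambda>l\<in>{..<k}. if l = i then b i else attach b i a s l div d)"
      proof
        fix l show "b l = (\<lambda>l\<in>{..<k}. if l = i then b i else attach b i a s l div d) l"
          using x d by (auto simp: attach_def P_def PiE_def extensional_def)
      qed
      moreover have "a = attach b i a s i" using i by (simp add: attach_def)
      moreover have "b i < m" using x(2) i by (auto simp: P_def)
      ultimately show "x \<in> (\<lambda>(g, t). ((\<lambda>l\<in>{..<k}. if l = i then t else g l div d), g i)) ` (Bd \<times> {..<m})"
        using x by (intro image_eqI[of _ _ "(attach b i a s, b i)"]) auto
    qed
    have "real (card (Bad' i)) * (\<eta> * n) = (\<Sum>b\<in>Bad' i. \<eta> * n)" by simp
    also have "\<dots> \<le> (\<Sum>b\<in>Bad' i. real (card (U i b)))"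
      by (intro sum_mono) (auto simp: Bad'_def)
    also have "\<dots> \<le> (\<Sum>b\<in>P. real (card (U i b)))"
      using finP by (intro sum_mono2) (auto simp: Bad'_def)
    also have "\<dots> = real (card (SIGMA b:P. U i b))"
      using finP finU by simp
    also have "\<dots> \<le> real (card (Bd \<times> {..<m}))"
      using surj_card_le[OF _ sub] finBd by (intro of_nat_mono) simp
    finally show ?thesis by (simp add: card_cartesian_product)
  qed
  have "\<exists>b\<in>P. b \<notin> Bad \<and> (\<forall>i<k. b \<notin> Bad' i)"
  proof (rule ccontr)
    assume "\<not> ?thesis"
    then have "P \<subseteq> Bad \<union> (\<Union>i<k. Bad' i)" by blast
    moreover have "finite (Bad \<union> (\<Union>i<k. Bad' i))"
      using finP by (auto simp: Bad_def Bad'_def)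
    ultimately have "card P \<le> card (Bad \<union> (\<Union>i<k. Bad' i))" by (intro card_mono)
    also have "\<dots> \<le> card Bad + (\<Sum>i<k. card (Bad' i))"
      by (intro order_trans[OF card_Un_le] add_mono order_refl card_UN_le) auto
    finally have "real (card P) \<le> real (card Bad + (\<Sum>i<k. card (Bad' i)))" by (rule of_nat_mono)
    also have "\<dots> = real (card Bad) + (\<Sum>i<k. real (card (Bad' i)))" by simp
    also have "\<dots> \<le> real (card Bd) + (\<Sum>i<k. real (card Bd) / \<eta>)"
    proof (intro add_mono sum_mono)
      fix i assume "i \<in> {..<k}"
      then have "real (card (Bad' i)) * (\<eta> * n) \<le> real (card Bd) * m" using cardBad' by simp
      also have "\<dots> \<le> real (card Bd) * n" using mn by (intro mult_left_mono) auto
      finally have "(real (card (Bad' i)) * \<eta>) * n \<le> real (card Bd) * n" by (simp add: mult.assoc)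
      moreover have "real n > 0" using n d by simp
      ultimately have "real (card (Bad' i)) * \<eta> \<le> real (card Bd)" by (rule mult_right_le_imp_le)
      then show "real (card (Bad' i)) \<le> real (card Bd) / \<eta>" using \<eta> by (simp add: field_simps)
    qed (use cardBad in simp)
    also have "\<dots> = real (card Bd) * (1 + k / \<eta>)" by (simp add: field_simps)
    finally have "real m ^ k \<le> real (card Bd) * (1 + k / \<eta>)"
      by (simp add: P_def card_PiE)
    then have "real m ^ k * (2 * (2 * d) ^ k) \<le> real (card Bd) * (1 + k / \<eta>) * (2 * (2 * d) ^ k)"
      by (intro mult_right_mono) auto
    also have "\<dots> \<le> real n ^ k" using dense by (simp add: cardBd)
    also have "\<dots> \<le> (real m * (2 * d)) ^ k" using m by (intro power_mono) auto
    finally have "2 * (real m * (2 * d)) ^ k \<le> (real m * (2 * d)) ^ k"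
      by (simp add: power_mult_distrib mult_ac)
    moreover have "(real m * (2 * d)) ^ k > 0" using m0 d by simp
    ultimately show False by linarith
  qed
  then obtain b where b: "b \<in> P" "b \<notin> Bad" "\<And>i. i < k \<Longrightarrow> b \<notin> Bad' i" by blast
  have bm: "b i < m" if "i < k" for i using b(1) that by (auto simp: P_def)
  define \<alpha> where "\<alpha> i s = b i * d + s" for i s
  define A where "A = {(i, \<alpha> i s) | i s. i < k \<and> s < d}"
  define C where "C = {(i, a). i < k \<and> a < n \<and> a \<notin> U i b}"
  have spread_ok: "spread b \<sigma> \<notin> Bd" if "\<And>i. i < k \<Longrightarrow> \<sigma> i < d" for \<sigma>
    using b(1,2) that by (auto simp: Bad_def)
  have trans_eq: "transversal k (restrict g {..<k}) = transversal k g" for g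
    by (simp add: transversal_def)
  have "locked k d S A"
    unfolding A_def
  proof (rule locked_seed[OF k])
    show "inj_on (\<alpha> i) {..<d}" if "i < k" for i by (auto simp: inj_on_def \<alpha>_def)
    fix \<sigma> assume \<sigma>: "\<And>i. i < k \<Longrightarrow> \<sigma> i < d"
    have "spread b \<sigma> \<in> {..<k} \<rightarrow>\<^sub>E {..<n}" using \<sigma> bm lt by (auto simp: spread_def)
    then have "implied d S (transversal k (spread b \<sigma>))"
      using spread_ok[OF \<sigma>] by (auto simp: Bd_def)
    then show "implied d S (transversal k (\<lambda>i. \<alpha> i (\<sigma> i)))"
      by (simp add: spread_def trans_eq \<alpha>_def)
  qed
  then have "locked k d S (A \<union> C)"
  proof (rule locked_extend[where n = n])
    fix v assume "v \<in> C"
    then obtain i a where v: "v = (i, a)" "i < k" "a < n" "a \<notin> U i b" by (auto simp: C_def)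
    define F where "F = (\<lambda>s. transversal k (attach b i a s)) ` {..<d}"
    have mem: "attach b i a s \<in> {..<k} \<rightarrow>\<^sub>E {..<n}" if "s < d" for s
      using v bm lt that by (auto simp: attach_def)
    show "\<exists>F\<subseteq>complete_edges k n. d \<le> card F \<and> (\<forall>e\<in>F. implied d S e \<and> v \<in> e \<and> e - {v} \<subseteq> A)"
    proof (intro exI[of _ F] conjI ballI)
      show "F \<subseteq> complete_edges k n" using mem by (auto simp: F_def complete_edges_eq)
      obtain l where l: "l < k" "l \<noteq> i"
      proof -
        have "card ({..<k} - {i}) > 0" using k v by simp
        then show ?thesis using that by (metis DiffD1 DiffD2 card_gt_0_iff equals0I insertI1 lessThan_iff)
      qed
      have "inj_on (\<lambda>s. transversal k (attach b i a s)) {..<d}"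
      proof (rule inj_onI)
        fix s s' assume *: "s \<in> {..<d}" "s' \<in> {..<d}"
          "transversal k (attach b i a s) = transversal k (attach b i a s')"
        then have "attach b i a s = attach b i a s'"
          using inj_on_transversal[of k "\<lambda>_. {..<n}"] mem unfolding inj_on_def by blast
        from fun_cong[OF this, of l] show "s = s'" using l by (simp add: attach_def)
      qed
      then show "d \<le> card F" by (simp add: F_def card_image)
    next
      fix e assume "e \<in> F"
      then obtain s where s: "s < d" "e = transversal k (attach b i a s)" by (auto simp: F_def)
      have "attach b i a s \<notin> Bd" using v(3,4) s(1) by (auto simp: U_def)
      then show "implied d S e" using mem[OF s(1)] s(2) by (auto simp: Bd_def)
      show "v \<in> e" using v by (simp add: s mem_transversal attach_def)
      show "e - {v} \<subseteq> A"
      proof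
        fix u assume u: "u \<in> e - {v}"
        obtain l c where lc: "u = (l, c)" by (cases u)
        then have "l < k" "c = attach b i a s l" "l \<noteq> i"
          using u v by (auto simp: s mem_transversal attach_def)
        then show "u \<in> A" using s by (auto simp: A_def lc attach_def \<alpha>_def)
      qed
    qed
  qed
  then have "locked k d S C" by (rule locked_subset) blast
  moreover have "C \<subseteq> vertices k n" by (auto simp: C_def mem_vertices)
  moreover have "real (card (C \<inter> vertex_class n i)) \<ge> (1 - \<eta>) * n" if i: "i < k" for i
  proof -
    have "C \<inter> vertex_class n i = Pair i ` ({..<n} - U i b)"
      using i by (auto simp: C_def vertex_class_def)
    then have "card (C \<inter> vertex_class n i) = card ({..<n} - U i b)"
      by (simp add: card_image inj_on_def)
    also have "\<dots> = n - card (U i b)"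
      by (subst card_Diff_subset) (auto simp: finU U_def)
    finally have "real (card (C \<inter> vertex_class n i)) \<ge> real n - real (card (U i b))" by linarith
    moreover have "real (card (U i b)) \<le> \<eta> * n" using b(3)[OF i] b(1) by (auto simp: Bad'_def)
    ultimately show ?thesis by (simp add: algebra_simps)
  qed
  ultimately show ?thesis by blast
qed



section \<open>Uniformly random orders\<close>

abbreviation prob :: "'a pmf \<Rightarrow> 'a set \<Rightarrow> real" where
  "prob p \<equiv> measure (measure_pmf p)"

abbreviation random_order :: "'a set \<Rightarrow> 'a list pmf" where
  "random_order A \<equiv> pmf_of_set (permutations_of_set A)"

lemma set_random_order: "finite A \<Longrightarrow> set_pmf (random_order A) = permutations_of_set A"
  by (simp add: permutations_of_set_empty_iff)

lemma random_order_step: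
  assumes "finite A" "A \<noteq> {}"
  shows "prob (random_order A) Q =
    (\<Sum>x\<in>A. prob (random_order (A - {x})) {xs. x # xs \<in> Q}) / card A"
proof -
  have ne: "permutations_of_set B \<noteq> {}" if "finite B" for B :: "'a set"
    using that by (simp add: permutations_of_set_empty_iff)
  have "permutations_of_set A \<inter> Q =
      (\<Union>x\<in>A. (#) x ` (permutations_of_set (A - {x}) \<inter> {xs. x # xs \<in> Q}))"
    using assms by (auto simp: permutations_of_set_nonempty)
  then have "card (permutations_of_set A \<inter> Q) =
      (\<Sum>x\<in>A. card ((#) x ` (permutations_of_set (A - {x}) \<inter> {xs. x # xs \<in> Q})))"
    using assms(1) by (simp only:) (rule card_UN_disjoint, auto)
  also have "\<dots> = (\<Sum>x\<in>A. card (permutations_of_set (A - {x}) \<inter> {xs. x # xs \<in> Q}))"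
    by (intro sum.cong refl card_image) simp
  finally have card: "card (permutations_of_set A \<inter> Q) = \<dots>" .
  have "prob (random_order A) Q =
      (\<Sum>x\<in>A. real (card (permutations_of_set (A - {x}) \<inter> {xs. x # xs \<in> Q}))) / fact (card A)"
    using assms ne by (simp add: measure_pmf_of_set card)
  also have "fact (card A) = real (card A) * fact (card A - 1)"
    using assms by (simp add: fact_reduce card_gt_0_iff)
  also have "(\<Sum>x\<in>A. real (card (permutations_of_set (A - {x}) \<inter> {xs. x # xs \<in> Q}))) /
      (real (card A) * fact (card A - 1)) =
      (\<Sum>x\<in>A. prob (random_order (A - {x})) {xs. x # xs \<in> Q}) / card A"
    using assms ne by (simp add: measure_pmf_of_set sum_divide_distrib mult.commute)
  finally show ?thesis .
qed

text \<open>Conditioning on the first \<open>m\<close> elements, after which the rest is a uniformly random order of the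
remaining elements.\<close>

lemma random_order_prefix_bound:
  assumes "finite K" "m \<le> card K"
    and "\<And>ys. distinct ys \<Longrightarrow> set ys \<subseteq> K \<Longrightarrow> length ys = m \<Longrightarrow>
      prob (random_order (K - set ys)) {xs. ys @ xs \<in> Q} \<le> \<delta>"
  shows "prob (random_order K) Q \<le> \<delta>"
  using assms
proof (induction m arbitrary: K Q)
  case 0
  then show ?case using "0.prems"(3)[of "[]"] by simp
next
  case (Suc m)
  have ne: "K \<noteq> {}" using Suc.prems by auto
  have "prob (random_order (K - {x})) {xs. x # xs \<in> Q} \<le> \<delta>" if x: "x \<in> K" for x
  proof (rule Suc.IH)
    show "finite (K - {x})" "m \<le> card (K - {x})" using Suc.prems x by auto
    fix ys assume ys: "distinct ys" "set ys \<subseteq> K - {x}" "length ys = m"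
    have "K - set (x # ys) = K - {x} - set ys" by auto
    then show "prob (random_order (K - {x} - set ys)) {xs. ys @ xs \<in> {xs. x # xs \<in> Q}} \<le> \<delta>"
      using Suc.prems(3)[of "x # ys"] ys x by auto
  qed
  then have "(\<Sum>x\<in>K. prob (random_order (K - {x})) {xs. x # xs \<in> Q}) \<le> (\<Sum>x\<in>K. \<delta>)"
    by (intro sum_mono)
  then show ?case
    using Suc.prems(1) ne by (simp add: random_order_step divide_le_eq card_gt_0_iff mult.commute)
qed

lemma random_order_avoid:
  assumes "finite A" "m \<le> card A"
  shows "prob (random_order A) {xs. set (take m xs) \<inter> B = {}} =
    (\<Prod>i<m. (real (card (A - B)) - real i) / (real (card A) - real i))"
  using assms
proof (induction m arbitrary: A)
  case 0
  then show ?case by simp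
next
  case (Suc m)
  have ne: "A \<noteq> {}" using Suc.prems by auto
  have N: "card A > 0" using Suc.prems by simp
  have "prob (random_order (A - {x})) {xs. x # xs \<in> {xs. set (take (Suc m) xs) \<inter> B = {}}} =
      (if x \<in> A - B then \<Prod>i<m. (real (card (A - B)) - real (Suc i)) / (real (card A) - real (Suc i)) else 0)"
    if x: "x \<in> A" for x
  proof (cases "x \<in> B")
    case True
    then show ?thesis by simp
  next
    case False
    have 1: "card (A - {x} - B) = card (A - B) - 1" "card (A - B) > 0" "card (A - {x}) = card A - 1"
    proof -
      have "A - {x} - B = (A - B) - {x}" by auto
      then show "card (A - {x} - B) = card (A - B) - 1" using x False Suc.prems by simp
      show "card (A - B) > 0" using x False Suc.prems by (auto simp: card_gt_0_iff)
      show "card (A - {x}) = card A - 1" using x by simp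
    qed
    have "prob (random_order (A - {x})) {xs. set (take m xs) \<inter> B = {}} =
        (\<Prod>i<m. (real (card (A - {x} - B)) - real i) / (real (card (A - {x})) - real i))"
      using Suc.prems x by (intro Suc.IH) auto
    also have "\<dots> = (\<Prod>i<m. (real (card (A - B)) - real (Suc i)) / (real (card A) - real (Suc i)))"
      unfolding 1(1,3) using 1(2) N by (intro prod.cong refl) (simp add: of_nat_diff algebra_simps)
    finally show ?thesis using x False by simp
  qed
  then have "(\<Sum>x\<in>A. prob (random_order (A - {x}))
        {xs. x # xs \<in> {xs. set (take (Suc m) xs) \<inter> B = {}}}) =
      (\<Sum>x\<in>A. if x \<in> A - B then \<Prod>i<m. (real (card (A - B)) - real (Suc i)) / (real (card A) - real (Suc i)) else 0)"
    by (intro sum.cong refl)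
  also have "\<dots> = card (A - B) * (\<Prod>i<m. (real (card (A - B)) - real (Suc i)) / (real (card A) - real (Suc i)))"
    using Suc.prems(1) by (subst sum.inter_filter[symmetric]) (auto simp: set_diff_eq)
  finally show ?case
    unfolding prod.lessThan_Suc_shift using Suc.prems(1) ne by (simp add: random_order_step)
qed

lemma random_order_hit:
  assumes "finite A" "finite B" "0 < D" "D + real m \<le> card A"
  shows "prob (random_order A) {xs. set (take m xs) \<inter> B \<noteq> {}} \<le> m * (card B / D)"
  using assms(1,4)
proof (induction m arbitrary: A)
  case 0
  then show ?case by simp
next
  case (Suc m)
  have N: "card A > 0" using Suc.prems assms(3) by (metis add_pos_nonneg less_le_trans of_nat_0_le_iff of_nat_0_less_iff)
  have ND: "D \<le> card A" using Suc.prems by simp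
  have "prob (random_order (A - {x})) {xs. x # xs \<in> {xs. set (take (Suc m) xs) \<inter> B \<noteq> {}}}
      \<le> (if x \<in> B then 1 else 0) + m * (card B / D)" if x: "x \<in> A" for x
  proof (cases "x \<in> B")
    case True
    have "prob (random_order (A - {x})) {xs. x # xs \<in> {xs. set (take (Suc m) xs) \<inter> B \<noteq> {}}} \<le> 1"
      by simp
    also have "\<dots> \<le> (if x \<in> B then 1 else 0) + m * (card B / D)" using True assms(3) by simp
    finally show ?thesis .
  next
    case False
    have "prob (random_order (A - {x})) {xs. set (take m xs) \<inter> B \<noteq> {}} \<le> m * (card B / D)"
      using Suc.prems x N by (intro Suc.IH) (auto simp: of_nat_diff)
    then show ?thesis using False by simp
  qed
  then have "(\<Sum>x\<in>A. prob (random_order (A - {x}))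
      {xs. x # xs \<in> {xs. set (take (Suc m) xs) \<inter> B \<noteq> {}}})
      \<le> (\<Sum>x\<in>A. (if x \<in> B then 1 else 0) + m * (card B / D))"
    by (intro sum_mono)
  also have "\<dots> = card (A \<inter> B) + card A * (m * (card B / D))"
    using Suc.prems(1) by (simp add: sum.distrib sum.If_cases Int_def)
  also have "\<dots> \<le> card B + card A * (m * (card B / D))"
    using assms(2) by (simp add: card_mono)
  also have "\<dots> \<le> card A * (card B / D) + card A * (m * (card B / D))"
    using ND assms(3) by (simp add: field_simps mult_right_mono)
  also have "\<dots> = card A * (Suc m * (card B / D))" by (simp add: algebra_simps add_divide_distrib)
  finally show ?case
    using Suc.prems(1) N by (subst random_order_step) (auto simp: divide_le_eq mult.commute)
qed

text \<open>Second moment method for the number of sets \<open>B v\<close> that the first \<open>m\<close> elements avoid. The events are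
negatively correlated, since \<open>1 - 2 x \<le> (1 - x)\<^sup>2\<close> in each factor of \<open>random_order_avoid\<close>. Hence the
variance is at most the mean, and Chebyshev's inequality bounds the probability of the value zero
by the inverse of the mean.\<close>

lemma random_order_all_hit:
  fixes B :: "'v \<Rightarrow> 'a set" and q :: real
  assumes "finite A" "finite V" "V \<noteq> {}"
    and B: "\<And>v. v \<in> V \<Longrightarrow> B v \<subseteq> A" "\<And>v. v \<in> V \<Longrightarrow> card (B v) = b"
    and disj: "\<And>u v. u \<in> V \<Longrightarrow> v \<in> V \<Longrightarrow> u \<noteq> v \<Longrightarrow> B u \<inter> B v = {}"
    and m: "m + 2 * b \<le> card A" "0 < b"
    and q: "0 < q" "q \<le> (\<Prod>i<m. 1 - real b / (real (card A) - real i))"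
  shows "prob (random_order A) {xs. \<forall>v\<in>V. set (take m xs) \<inter> B v \<noteq> {}} \<le> 1 / (card V * q)"
proof -
  let ?M = "random_order A"
  let ?N = "real (card A)"
  define h where "h = (\<Prod>i<m. 1 - real b / (?N - real i))"
  define f where "f v xs = (if set (take m xs) \<inter> B v = {} then 1 else 0 :: real)" for v xs
  define \<mu> where "\<mu> = card V * h"
  have h: "h > 0" using q by (simp add: h_def)
  have V: "card V > 0" using assms by (simp add: card_gt_0_iff)
  have \<mu>: "\<mu> > 0" using h V by (simp add: \<mu>_def)
  have int: "integrable (measure_pmf ?M) (g :: 'a list \<Rightarrow> real)" for g
    using assms(1) by (intro integrable_measure_pmf_finite) (simp add: set_random_order)
  have Ef: "measure_pmf.expectation ?M (f v) = h" if v: "v \<in> V" for v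
  proof -
    have "measure_pmf.expectation ?M (f v) =
        prob ?M {xs. set (take m xs) \<inter> B v = {}}"
    proof -
      have "f v = indicator {xs. set (take m xs) \<inter> B v = {}}"
        by (auto simp: f_def indicator_def fun_eq_iff)
      then show ?thesis by simp
    qed
    also have "\<dots> = (\<Prod>i<m. (real (card (A - B v)) - real i) / (?N - real i))"
      using assms(1) m by (intro random_order_avoid) auto
    also have "\<dots> = h"
      unfolding h_def
    proof (intro prod.cong refl)
      fix i assume "i \<in> {..<m}"
      then have "?N - real i > 0" using m by auto
      moreover have "real (card (A - B v)) = ?N - real b"
        using B[OF v] m assms(1) by (subst card_Diff_subset) (auto intro: finite_subset simp: of_nat_diff)
      ultimately show "(real (card (A - B v)) - real i) / (?N - real i) = 1 - real b / (?N - real i)"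
        by (simp add: field_simps)
    qed
    finally show ?thesis .
  qed
  have Eff: "measure_pmf.expectation ?M (\<lambda>xs. f u xs * f v xs) \<le> h\<^sup>2"
    if uv: "u \<in> V" "v \<in> V" "u \<noteq> v" for u v
  proof -
    have "measure_pmf.expectation ?M (\<lambda>xs. f u xs * f v xs) =
        prob ?M {xs. set (take m xs) \<inter> (B u \<union> B v) = {}}"
    proof -
      have "(\<lambda>xs. f u xs * f v xs) = indicator {xs. set (take m xs) \<inter> (B u \<union> B v) = {}}"
        by (auto simp: f_def indicator_def fun_eq_iff)
      then show ?thesis by simp
    qed
    also have "\<dots> = (\<Prod>i<m. (real (card (A - (B u \<union> B v))) - real i) / (?N - real i))"
      using assms(1) m by (intro random_order_avoid) auto
    also have "\<dots> \<le> (\<Prod>i<m. (1 - real b / (?N - real i))\<^sup>2)"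
    proof (intro prod_mono conjI)
      fix i assume "i \<in> {..<m}"
      then have pos: "?N - real i > 2 * real b" using m by auto
      have "card (B u \<union> B v) = 2 * b"
        using B uv disj[OF uv] assms(1) by (subst card_Un_disjoint) (auto intro: finite_subset)
      then have card: "real (card (A - (B u \<union> B v))) = ?N - 2 * real b"
        using B uv m assms(1) by (subst card_Diff_subset) (auto intro: finite_subset simp: of_nat_diff)
      show "0 \<le> (real (card (A - (B u \<union> B v))) - real i) / (?N - real i)"
        using pos unfolding card by (intro divide_nonneg_pos) auto
      have "(real (card (A - (B u \<union> B v))) - real i) / (?N - real i) = 1 - 2 * (real b / (?N - real i))"
        using pos unfolding card by (simp add: field_simps)
      also have "\<dots> \<le> (1 - real b / (?N - real i))\<^sup>2"
        using zero_le_power2[of "real b / (?N - real i)"] by (simp add: power2_diff)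
      finally show "(real (card (A - (B u \<union> B v))) - real i) / (?N - real i) \<le> (1 - real b / (?N - real i))\<^sup>2" .
    qed
    also have "\<dots> = h\<^sup>2" by (simp add: h_def prod_power_distrib)
    finally show ?thesis .
  qed
  have Esq: "measure_pmf.expectation ?M (\<lambda>xs. ((\<Sum>v\<in>V. f v xs) - \<mu>)\<^sup>2) \<le> \<mu>"
  proof -
    have "(\<lambda>xs. ((\<Sum>v\<in>V. f v xs) - \<mu>)\<^sup>2) =
        (\<lambda>xs. (\<Sum>u\<in>V. \<Sum>v\<in>V. f u xs * f v xs) - 2 * \<mu> * (\<Sum>v\<in>V. f v xs) + \<mu>\<^sup>2)"
      by (simp add: fun_eq_iff power2_eq_square sum_product algebra_simps)
    then have "measure_pmf.expectation ?M (\<lambda>xs. ((\<Sum>v\<in>V. f v xs) - \<mu>)\<^sup>2) =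
        (\<Sum>u\<in>V. \<Sum>v\<in>V. measure_pmf.expectation ?M (\<lambda>xs. f u xs * f v xs)) -
          2 * \<mu> * (\<Sum>v\<in>V. measure_pmf.expectation ?M (f v)) + \<mu>\<^sup>2"
      by (simp add: Bochner_Integration.integral_add Bochner_Integration.integral_diff
          Bochner_Integration.integral_sum int measure_pmf.prob_space)
    also have "(\<Sum>v\<in>V. measure_pmf.expectation ?M (f v)) = \<mu>"
      using Ef by (simp add: \<mu>_def)
    also have "(\<Sum>u\<in>V. \<Sum>v\<in>V. measure_pmf.expectation ?M (\<lambda>xs. f u xs * f v xs)) \<le>
        (\<Sum>u\<in>V. \<Sum>v\<in>V. h\<^sup>2 + (if u = v then h else 0))"
    proof (intro sum_mono)
      fix u v assume uv: "u \<in> V" "v \<in> V"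
      show "measure_pmf.expectation ?M (\<lambda>xs. f u xs * f v xs) \<le> h\<^sup>2 + (if u = v then h else 0)"
      proof (cases "u = v")
        case True
        have "(\<lambda>xs. f v xs * f v xs) = f v" by (auto simp: f_def)
        then show ?thesis using True Ef[OF uv(2)] by simp
      qed (use Eff uv in auto)
    qed
    also have "\<dots> = \<mu>\<^sup>2 + \<mu>"
      using assms(2) by (simp add: sum.distrib \<mu>_def power2_eq_square algebra_simps)
    finally show ?thesis by (simp add: power2_eq_square)
  qed
  have "prob ?M {xs. \<forall>v\<in>V. set (take m xs) \<inter> B v \<noteq> {}} \<le>
      prob ?M {xs. \<bar>(\<Sum>v\<in>V. f v xs) - \<mu>\<bar> \<ge> \<mu>}"
  proof (intro measure_pmf.finite_measure_mono subsetI CollectI)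
    fix xs assume "xs \<in> {xs. \<forall>v\<in>V. set (take m xs) \<inter> B v \<noteq> {}}"
    then have "(\<Sum>v\<in>V. f v xs) = 0" by (intro sum.neutral) (auto simp: f_def)
    then show "\<mu> \<le> \<bar>(\<Sum>v\<in>V. f v xs) - \<mu>\<bar>" by simp
  qed simp
  also have "\<dots> \<le> measure_pmf.expectation ?M (\<lambda>xs. ((\<Sum>v\<in>V. f v xs) - \<mu>)\<^sup>2) / \<mu>\<^sup>2"
    using measure_pmf.second_moment_method[of "\<lambda>xs. (\<Sum>v\<in>V. f v xs) - \<mu>" ?M \<mu>] int \<mu> by simp
  also have "\<dots> \<le> \<mu> / \<mu>\<^sup>2" using Esq \<mu> by (intro divide_right_mono) auto
  also have "\<dots> = 1 / \<mu>" using \<mu> by (simp add: power2_eq_square)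
  also have "\<dots> \<le> 1 / (card V * q)"
    unfolding \<mu>_def using q V by (intro divide_left_mono mult_left_mono) (auto simp: h_def)
  finally show ?thesis .
qed

section \<open>Progress along a random order\<close>

text \<open>
The elements of \<open>K\<close> are added one after the other to a set \<open>S\<close>. While \<open>S\<close> is bad, the next element
lowers the potential \<open>r\<close> with conditional probability at least \<open>\<nu>\<close>. Since \<open>r\<close> takes natural number
values, \<open>S\<close> is unlikely to remain bad for long. The parameter \<open>\<xi>\<close> is free: a step that makes progress
gains a factor \<open>\<xi>\<close>, so each bad step multiplies the expected weight \<open>(1 / \<xi>)\<^sup>r\<close> by at most
\<open>\<rho> = 1 - (1 - \<xi>) \<nu>\<close>.
\<close>

locale progress =
  fixes K :: "'a set" and bad :: "'a set \<Rightarrow> bool" and r :: "'a set \<Rightarrow> nat" and \<xi> \<nu> \<rho> :: real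
  assumes finite_K: "finite K" and \<xi>: "0 < \<xi>" "\<xi> \<le> 1"
    and \<rho>_def: "\<rho> = 1 - (1 - \<xi>) * \<nu>" and \<rho>: "0 < \<rho>" "\<rho> \<le> 1"
    and progress: "\<And>S. S \<subseteq> K \<Longrightarrow> bad S \<Longrightarrow> \<nu> * card (K - S) \<le> card {x \<in> K - S. r (insert x S) < r S}"
    and nonincreasing: "\<And>S x. S \<subseteq> K \<Longrightarrow> x \<in> K - S \<Longrightarrow> r (insert x S) \<le> r S"
    and bad_antimono: "\<And>S x. S \<subseteq> K \<Longrightarrow> x \<in> K - S \<Longrightarrow> bad (insert x S) \<Longrightarrow> bad S"
begin

lemma weight_nonincreasing:
  assumes "S \<subseteq> K" "x \<in> K - S"
  shows "(1 / \<xi>) ^ r (insert x S) \<le> (1 / \<xi>) ^ r S"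
  using nonincreasing[OF assms] \<xi> by (intro power_increasing) auto

lemma average_weight:
  assumes S: "S \<subseteq> K" and "bad S"
  shows "(\<Sum>x\<in>K - S. (1 / \<xi>) ^ r (insert x S)) \<le> card (K - S) * (\<rho> * (1 / \<xi>) ^ r S)"
proof -
  define W where "W = (1 / \<xi>) ^ r S"
  have W: "W > 0" using \<xi> by (simp add: W_def)
  let ?P = "{x \<in> K - S. r (insert x S) < r S}"
  have fin: "finite (K - S)" using finite_K by simp
  have "(\<Sum>x\<in>K - S. (1 / \<xi>) ^ r (insert x S)) \<le> (\<Sum>x\<in>K - S. W - (if x \<in> ?P then (1 - \<xi>) * W else 0))"
  proof (intro sum_mono)
    fix x assume x: "x \<in> K - S"
    show "(1 / \<xi>) ^ r (insert x S) \<le> W - (if x \<in> ?P then (1 - \<xi>) * W else 0)"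
    proof (cases "r (insert x S) < r S")
      case True
      then have "(1 / \<xi>) ^ r (insert x S) \<le> (1 / \<xi>) ^ (r S - 1)"
        using \<xi> by (intro power_increasing) auto
      also have "\<dots> = \<xi> * W"
        unfolding W_def using True \<xi> by (cases "r S") auto
      finally show ?thesis using True x by (simp add: algebra_simps)
    next
      case False
      then show ?thesis using weight_nonincreasing[OF S x] by (simp add: W_def)
    qed
  qed
  also have "\<dots> = card (K - S) * W - card ?P * ((1 - \<xi>) * W)"
    using fin by (simp add: sum_subtractf sum.If_cases Int_def)
  also have "\<dots> \<le> card (K - S) * W - (\<nu> * card (K - S)) * ((1 - \<xi>) * W)"
    using progress[OF assms] \<xi> W by (intro diff_left_mono mult_right_mono) auto
  also have "\<dots> = card (K - S) * (\<rho> * W)" by (simp add: \<rho>_def algebra_simps)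
  finally show ?thesis by (simp add: W_def)
qed

text \<open>The case distinction keeps the induction going: once the set is good it stays good, and the
probability is zero.\<close>

lemma tail_aux:
  assumes "S \<subseteq> K" "m \<le> card (K - S)"
  shows "prob (random_order (K - S)) {xs. bad (S \<union> set (take m xs))} \<le>
    (if bad S then (1 / \<xi>) ^ r S * \<rho> ^ m else 0)"
  using assms
proof (induction m arbitrary: S)
  case 0
  have "1 \<le> (1 / \<xi>) ^ r S" using \<xi> by (intro one_le_power) auto
  moreover have "prob (random_order (K - S)) {xs. bad S} \<le> 1" by simp
  ultimately show ?case by (auto intro: order_trans)
next
  case (Suc m)
  have fin: "finite (K - S)" using finite_K by simp
  have N: "card (K - S) > 0" using Suc.prems(2) by simp
  then have ne: "K - S \<noteq> {}" by (metis card.empty less_irrefl)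
  have x_bound: "prob (random_order (K - S - {x})) {xs. x # xs \<in> {xs. bad (S \<union> set (take (Suc m) xs))}}
      \<le> (if bad S then (1 / \<xi>) ^ r (insert x S) * \<rho> ^ m else 0)" if x: "x \<in> K - S" for x
  proof -
    have eq: "K - S - {x} = K - insert x S" by auto
    have "card (K - insert x S) = card (K - S) - 1" using x fin by (simp flip: eq)
    then have "prob (random_order (K - insert x S)) {xs. bad (insert x S \<union> set (take m xs))}
        \<le> (if bad (insert x S) then (1 / \<xi>) ^ r (insert x S) * \<rho> ^ m else 0)"
      using Suc.prems x by (intro Suc.IH) auto
    also have "\<dots> \<le> (if bad S then (1 / \<xi>) ^ r (insert x S) * \<rho> ^ m else 0)"
      using bad_antimono[OF Suc.prems(1) x] \<xi> \<rho> by auto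
    finally show ?thesis by (simp add: eq)
  qed
  show ?case
  proof (cases "bad S")
    case False
    then have "(\<Sum>x\<in>K - S. prob (random_order (K - S - {x}))
        {xs. x # xs \<in> {xs. bad (S \<union> set (take (Suc m) xs))}}) \<le> (\<Sum>x\<in>K - S. 0)"
      using x_bound by (intro sum_mono) auto
    then show ?thesis using False fin ne by (subst random_order_step) (auto simp: divide_le_0_iff)
  next
    case True
    have "(\<Sum>x\<in>K - S. prob (random_order (K - S - {x}))
        {xs. x # xs \<in> {xs. bad (S \<union> set (take (Suc m) xs))}}) \<le>
        (\<Sum>x\<in>K - S. (1 / \<xi>) ^ r (insert x S) * \<rho> ^ m)"
      using x_bound True by (intro sum_mono) auto
    also have "\<dots> \<le> (card (K - S) * (\<rho> * (1 / \<xi>) ^ r S)) * \<rho> ^ m"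
      unfolding sum_distrib_right[symmetric]
      using average_weight[OF Suc.prems(1) True] \<rho> by (intro mult_right_mono) auto
    finally show ?thesis
      using True fin N ne by (subst random_order_step) (auto simp: divide_le_eq mult_ac)
  qed
qed

lemma tail:
  assumes "S \<subseteq> K" "m \<le> card (K - S)"
  shows "prob (random_order (K - S)) {xs. bad (S \<union> set (take m xs))} \<le> (1 / \<xi>) ^ r S * \<rho> ^ m"
  using tail_aux[OF assms] \<xi> \<rho> by (auto intro: order_trans split: if_splits)

text \<open>The event that \<open>B\<close> is hit uses up only one step, so its probability, which is at most \<open>m c\<close>, appears
as a factor; the price is the division by \<open>\<rho>\<close> for the step that is lost.\<close>

lemma tail_hit:
  fixes c D :: real
  assumes "finite B" "0 < D" "0 \<le> c" "real (card B) \<le> c * D"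
    and "S \<subseteq> K" "s \<le> card (K - S)" "D + real m \<le> card (K - S)"
  shows "prob (random_order (K - S))
      {xs. set (take m xs) \<inter> B \<noteq> {} \<and> bad (S \<union> set (take s xs))} \<le>
    m * c * ((1 / \<xi>) ^ r S * \<rho> ^ s / \<rho>)"
  using assms(5-)
proof (induction m arbitrary: S s)
  case 0
  then show ?case by simp
next
  case (Suc m)
  let ?H = "{xs. set (take (Suc m) xs) \<inter> B \<noteq> {} \<and> bad (S \<union> set (take s xs))}"
  have fin: "finite (K - S)" using finite_K by simp
  define \<beta> where "\<beta> = (1 / \<xi>) ^ r S * \<rho> ^ s / \<rho>"
  have N: "card (K - S) > 0" using Suc.prems assms(2)
    by (metis add_pos_nonneg less_le_trans of_nat_0_le_iff of_nat_0_less_iff)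
  then have ne: "K - S \<noteq> {}" by (metis card.empty less_irrefl)
  have ND: "D \<le> card (K - S)" using Suc.prems by simp
  show ?case
  proof (cases s)
    case 0
    have "prob (random_order (K - S))
        ?H \<le>
      prob (random_order (K - S)) {xs. set (take (Suc m) xs) \<inter> B \<noteq> {}}"
      by (intro measure_pmf.finite_measure_mono) auto
    also have "\<dots> \<le> Suc m * (card B / D)"
      by (rule random_order_hit[OF fin assms(1,2) Suc.prems(3)])
    also have "\<dots> \<le> Suc m * c * 1"
    proof -
      have "card B / D \<le> c" using assms(2,4) by (simp add: pos_divide_le_eq)
      then show ?thesis unfolding mult_1_right by (rule mult_left_mono) simp
    qed
    also have "\<dots> \<le> Suc m * c * \<beta>"
    proof (intro mult_left_mono)
      have "1 \<le> (1 / \<xi>) ^ r S" using \<xi> by (intro one_le_power) auto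
      also have "\<dots> = (1 / \<xi>) ^ r S * \<rho> / \<rho>" using \<rho> by simp
      also have "\<dots> \<le> \<beta>"
        unfolding \<beta>_def 0 using \<rho> \<xi> by (intro divide_right_mono mult_left_mono) auto
      finally show "1 \<le> \<beta>" .
      show "0 \<le> real (Suc m) * c" using assms(3) by simp
    qed
    finally show ?thesis unfolding \<beta>_def .
  next
    case (Suc s')
    have \<beta>: "\<beta> = (1 / \<xi>) ^ r S * \<rho> ^ s'" using \<rho> Suc by (simp add: \<beta>_def)
    have \<beta>0: "\<beta> \<ge> 0" using \<xi> \<rho> by (simp add: \<beta>)
    show ?thesis
    proof (cases "bad S")
      case False
      have "prob (random_order (K - S))
          ?H \<le>
        prob (random_order (K - S)) {xs. bad (S \<union> set (take s xs))}"
        by (intro measure_pmf.finite_measure_mono) auto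
      also have "\<dots> \<le> 0" using tail_aux[OF Suc.prems(1,2)] False by simp
      also have "0 \<le> Suc m * c * \<beta>" using assms(3) \<beta>0 by simp
      finally show ?thesis unfolding \<beta>_def .
    next
      case True
      have x_bound: "prob (random_order (K - S - {x}))
          {xs. x # xs \<in> ?H}
        \<le> (if x \<in> B then \<beta> else 0) + m * c * ((1 / \<xi>) ^ r (insert x S) * \<rho> ^ s' / \<rho>)"
        if x: "x \<in> K - S" for x
      proof -
        have eq: "K - S - {x} = K - insert x S" by auto
        have card: "card (K - insert x S) = card (K - S) - 1" using x fin by (simp flip: eq)
        have sub: "insert x S \<subseteq> K" using Suc.prems x by auto
        have s': "s' \<le> card (K - insert x S)" using card Suc.prems(2) \<open>s = Suc s'\<close> by simp
        have nn: "m * c * ((1 / \<xi>) ^ r (insert x S) * \<rho> ^ s' / \<rho>) \<ge> 0"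
          using assms(3) \<xi> \<rho> by simp
        show ?thesis
        proof (cases "x \<in> B")
          case xB: True
          have "prob (random_order (K - insert x S))
              {xs. x # xs \<in> ?H} \<le>
            prob (random_order (K - insert x S)) {xs. bad (insert x S \<union> set (take s' xs))}"
            using \<open>s = Suc s'\<close> by (intro measure_pmf.finite_measure_mono) auto
          also have "\<dots> \<le> (1 / \<xi>) ^ r (insert x S) * \<rho> ^ s'" by (rule tail[OF sub s'])
          also have "\<dots> \<le> \<beta>"
            unfolding \<beta> using weight_nonincreasing[OF Suc.prems(1) x] \<rho> by (intro mult_right_mono) auto
          finally show ?thesis using xB nn by (simp add: eq)
        next
          case xB: False
          have "prob (random_order (K - insert x S))
              {xs. set (take m xs) \<inter> B \<noteq> {} \<and> bad (insert x S \<union> set (take s' xs))} \<le>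
            m * c * ((1 / \<xi>) ^ r (insert x S) * \<rho> ^ s' / \<rho>)"
            using Suc.prems(3) N card by (intro Suc.IH[OF sub s']) (simp add: of_nat_diff)
          then show ?thesis using xB \<open>s = Suc s'\<close> by (simp add: eq)
        qed
      qed
      have "(\<Sum>x\<in>K - S. prob (random_order (K - S - {x}))
          {xs. x # xs \<in> ?H}) \<le>
        (\<Sum>x\<in>K - S. (if x \<in> B then \<beta> else 0) + m * c * ((1 / \<xi>) ^ r (insert x S) * \<rho> ^ s' / \<rho>))"
        using x_bound by (intro sum_mono)
      also have "\<dots> = card ((K - S) \<inter> B) * \<beta> +
          m * c * (\<rho> ^ s' / \<rho>) * (\<Sum>x\<in>K - S. (1 / \<xi>) ^ r (insert x S))"
      proof -
        have "(\<Sum>x\<in>K - S. if x \<in> B then \<beta> else 0) = card ((K - S) \<inter> B) * \<beta>"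
          using fin by (simp add: sum.If_cases Int_def)
        moreover have "(\<Sum>x\<in>K - S. m * c * ((1 / \<xi>) ^ r (insert x S) * \<rho> ^ s' / \<rho>)) =
            m * c * (\<rho> ^ s' / \<rho>) * (\<Sum>x\<in>K - S. (1 / \<xi>) ^ r (insert x S))"
          unfolding sum_distrib_left by (intro sum.cong refl) simp
        ultimately show ?thesis by (simp only: sum.distrib)
      qed
      also have "\<dots> \<le> card B * \<beta> +
          m * c * (\<rho> ^ s' / \<rho>) * (card (K - S) * (\<rho> * (1 / \<xi>) ^ r S))"
        using average_weight[OF Suc.prems(1) True] assms(3) \<rho> \<beta>0 assms(1)
        by (intro add_mono mult_right_mono mult_left_mono) (auto intro: card_mono)
      also have "m * c * (\<rho> ^ s' / \<rho>) * (card (K - S) * (\<rho> * (1 / \<xi>) ^ r S)) =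
          card (K - S) * (m * c * \<beta>)"
        using \<rho> by (simp add: \<beta>)
      also have "card B * \<beta> \<le> card (K - S) * c * \<beta>"
      proof (intro mult_right_mono \<beta>0)
        have "c * D \<le> c * card (K - S)" using ND assms(3) by (intro mult_left_mono)
        then show "real (card B) \<le> card (K - S) * c" using assms(4) by (simp add: mult.commute)
      qed
      also have "card (K - S) * c * \<beta> + card (K - S) * (m * c * \<beta>) =
          card (K - S) * (Suc m * c * \<beta>)"
        by (simp add: algebra_simps)
      finally have "(\<Sum>x\<in>K - S. prob (random_order (K - S - {x}))
          {xs. x # xs \<in> ?H}) \<le>
          card (K - S) * (Suc m * c * \<beta>)" by simp
      then show ?thesis
        unfolding \<beta>_def[symmetric] using fin N ne
        by (subst random_order_step) (auto simp: divide_le_eq mult.commute)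
    qed
  qed
qed

end



section \<open>The number of coordinates that determine a motion\<close>

definition determines :: "nat \<Rightarrow> nat \<Rightarrow> nat \<Rightarrow> vertex set set \<Rightarrow> (vertex \<times> nat) set \<Rightarrow> bool" where
  "determines k n d S I \<longleftrightarrow>
     (\<forall>z. motion d S z \<longrightarrow> (\<forall>c\<in>I. z c = 0) \<longrightarrow> (\<forall>c\<in>vertices k n \<times> {..<d}. z c = 0))"

text \<open>The least number of coordinates that determine a motion is the dimension of the space of motions,
defined without subspaces and bases. It is the potential for the growth of the set of implied edges.\<close>

definition freedom :: "nat \<Rightarrow> nat \<Rightarrow> nat \<Rightarrow> vertex set set \<Rightarrow> nat" where
  "freedom k n d S = (LEAST r. \<exists>I\<subseteq>vertices k n \<times> {..<d}. card I = r \<and> determines k n d S I)"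

lemma freedom_attained:
  "\<exists>I\<subseteq>vertices k n \<times> {..<d}. card I = freedom k n d S \<and> determines k n d S I"
  unfolding freedom_def
  by (rule LeastI_ex[where P = "\<lambda>r. \<exists>I\<subseteq>vertices k n \<times> {..<d}. card I = r \<and> determines k n d S I"])
    (auto simp: determines_def)

lemma freedom_le:
  "I \<subseteq> vertices k n \<times> {..<d} \<Longrightarrow> determines k n d S I \<Longrightarrow> freedom k n d S \<le> card I"
  unfolding freedom_def by (rule Least_le) blast

lemma card_vertices: "card (vertices k n) = k * n"
proof -
  have "vertices k n = {..<k} \<times> {..<n}" by (auto simp: mem_vertices)
  then show ?thesis by (simp add: card_cartesian_product)
qed

lemma freedom_le_card: "freedom k n d S \<le> d * k * n"
  using freedom_le[of "vertices k n \<times> {..<d}" k n d S]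
  by (simp add: determines_def card_cartesian_product card_vertices mult_ac)

lemma freedom_mono: "S \<subseteq> S' \<Longrightarrow> freedom k n d S' \<le> freedom k n d S"
proof -
  assume S: "S \<subseteq> S'"
  obtain I where I: "I \<subseteq> vertices k n \<times> {..<d}" "card I = freedom k n d S" "determines k n d S I"
    using freedom_attained by blast
  have "determines k n d S' I"
    using I(3) motion_mono[OF S] unfolding determines_def by blast
  then show ?thesis using freedom_le[OF I(1)] I(2) by simp
qed

lemma linear_form_edge_form: "linear_form (edge_form d e)"
  unfolding linear_form_def edge_form_def
  by (simp add: sum.distrib sum_distrib_left algebra_simps)

text \<open>On the motions of \<open>S\<close> the form of \<open>e\<close> is a linear combination of a minimal determining family of
coordinates, and it is not zero. Once the form is required to vanish, a coordinate that occurs with a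
nonzero coefficient is determined by the others.\<close>

lemma freedom_insert_less:
  assumes "finite S" "e \<in> complete_edges k n" "\<not> implied d S e"
  shows "freedom k n d (insert e S) < freedom k n d S"
proof -
  obtain I where I: "I \<subseteq> vertices k n \<times> {..<d}" "card I = freedom k n d S" "determines k n d S I"
    using freedom_attained by blast
  have finI: "finite I" using I(1) finite_vertices by (auto intro: finite_subset)
  define E :: "(vertex set + vertex \<times> nat) set" where "E = Inl ` S \<union> Inr ` I"
  define a where "a r z = (case r of Inl f \<Rightarrow> edge_form d f z | Inr g \<Rightarrow> z g)"
    for r :: "vertex set + vertex \<times> nat" and z
  have lin: "linear_form (a r)" for r
  proof (cases r)
    case (Inl f)
    then show ?thesis using linear_form_edge_form by (simp add: a_def linear_form_def)
  next
    case (Inr g)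
    then show ?thesis by (simp add: a_def linear_form_def)
  qed
  have "\<exists>c. \<forall>z. edge_form d e z = (\<Sum>r\<in>E. c r * a r z)"
  proof (rule linear_form_combination)
    show "finite E" using assms(1) finI by (simp add: E_def)
    fix z assume z: "\<And>r. r \<in> E \<Longrightarrow> a r z = 0"
    have "motion d S z" unfolding motion_def using z by (force simp: E_def a_def)
    moreover have "\<forall>c\<in>I. z c = 0" using z by (force simp: E_def a_def)
    ultimately have "\<forall>c\<in>vertices k n \<times> {..<d}. z c = 0" using I(3) unfolding determines_def by blast
    then have "z (v, j) = 0" if "v \<in> e" "j < d" for v j
      using complete_edges_subset[OF assms(2)] that by blast
    then show "edge_form d e z = 0" unfolding edge_form_def by (simp add: sum.neutral)
  qed (use lin linear_form_edge_form in auto)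
  then obtain c where c: "\<And>z. edge_form d e z = (\<Sum>r\<in>E. c r * a r z)" by blast
  have split: "edge_form d e z = (\<Sum>g\<in>I. c (Inr g) * z g)" if "motion d S z" for z
  proof -
    have "edge_form d e z = (\<Sum>r\<in>Inl ` S. c r * a r z) + (\<Sum>r\<in>Inr ` I. c r * a r z)"
      unfolding c E_def using assms(1) finI by (intro sum.union_disjoint) auto
    also have "(\<Sum>r\<in>Inl ` S. c r * a r z) = 0"
      using that by (intro sum.neutral) (auto simp: a_def motion_def)
    also have "(\<Sum>r\<in>Inr ` I. c r * a r z) = (\<Sum>g\<in>I. c (Inr g) * z g)"
      by (subst sum.reindex) (auto simp: a_def)
    finally show ?thesis by simp
  qed
  obtain z where z: "motion d S z" "edge_form d e z \<noteq> 0" using assms(3) by (auto simp: implied_def)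
  then obtain g where g: "g \<in> I" "c (Inr g) \<noteq> 0"
    using split[OF z(1)] by (metis (no_types, lifting) mult_zero_left sum.neutral)
  have "determines k n d (insert e S) (I - {g})"
    unfolding determines_def
  proof (intro allI impI)
    fix y assume y: "motion d (insert e S) y" "\<forall>c\<in>I - {g}. y c = 0"
    have yS: "motion d S y" using y(1) by (auto simp: motion_def)
    have "0 = (\<Sum>g\<in>I. c (Inr g) * y g)" using y(1) split[OF yS] by (simp add: motion_def)
    also have "\<dots> = c (Inr g) * y g + (\<Sum>g\<in>I - {g}. c (Inr g) * y g)"
      using finI g(1) by (intro sum.remove)
    also have "(\<Sum>g\<in>I - {g}. c (Inr g) * y g) = 0" using y(2) by (intro sum.neutral) auto
    finally have "y g = 0" using g(2) by simp
    then have "\<forall>c\<in>I. y c = 0" using y(2) by blast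
    then show "\<forall>c\<in>vertices k n \<times> {..<d}. y c = 0" using I(3) yS unfolding determines_def by blast
  qed
  then have "freedom k n d (insert e S) \<le> card (I - {g})" using I(1) by (intro freedom_le) auto
  also have "\<dots> < card I" using finI g(1) by (rule card_Diff1_less)
  finally show ?thesis using I(2) by simp
qed

lemma progress_freedom:
  assumes \<epsilon>: "0 < \<epsilon>" "\<epsilon> \<le> 1"
  shows "progress (complete_edges k n)
    (\<lambda>S. real (card {e \<in> complete_edges k n. \<not> implied d S e}) > \<epsilon> * real n ^ k)
    (freedom k n d) (1 / 2) \<epsilon> (1 - \<epsilon> / 2)"
proof
  let ?K = "complete_edges k n"
  show "finite ?K" by (rule finite_complete_edges)
  show "\<epsilon> * real (card (?K - S)) \<le>
      real (card {x \<in> ?K - S. freedom k n d (insert x S) < freedom k n d S})"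
    if S: "S \<subseteq> ?K" and bad: "real (card {e \<in> ?K. \<not> implied d S e}) > \<epsilon> * real n ^ k" for S :: "vertex set set"
  proof -
    have finS: "finite S" using S finite_complete_edges finite_subset by blast
    have "\<epsilon> * real (card (?K - S)) \<le> \<epsilon> * real (card ?K)"
      using \<epsilon> finite_complete_edges by (intro mult_left_mono) (auto intro: card_mono)
    also have "\<dots> \<le> real (card {e \<in> ?K. \<not> implied d S e})"
      using bad by (simp add: card_complete_edges)
    also have "\<dots> \<le> real (card {x \<in> ?K - S. freedom k n d (insert x S) < freedom k n d S})"
      using freedom_insert_less[OF finS] implied_mem finite_complete_edges
      by (intro of_nat_mono card_mono) auto
    finally show ?thesis .
  qed
  show "freedom k n d (insert x S) \<le> freedom k n d S" for x S by (rule freedom_mono) blast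
  show "\<epsilon> * real n ^ k < real (card {e \<in> ?K. \<not> implied d S e})"
    if bad: "\<epsilon> * real n ^ k < real (card {e \<in> ?K. \<not> implied d (insert x S) e})" for x S
  proof -
    have "card {e \<in> ?K. \<not> implied d (insert x S) e} \<le> card {e \<in> ?K. \<not> implied d S e}"
      using implied_mono[of S "insert x S"] finite_complete_edges by (intro card_mono) auto
    then show ?thesis using bad by linarith
  qed
qed (use \<epsilon> in auto)

text \<open>Collecting \<open>t\<close> elements of \<open>N\<close>: as long as fewer have been collected, at least \<open>card N - t\<close> are still
to come.\<close>

lemma progress_few_hits:
  fixes \<xi> \<nu> \<rho> :: real
  assumes "finite K" "N \<subseteq> K" and \<xi>: "0 < \<xi>" "\<xi> \<le> 1"
    and \<rho>: "\<rho> = 1 - (1 - \<xi>) * \<nu>" "0 < \<rho>" and \<nu>: "0 \<le> \<nu>" "\<nu> * card K \<le> real (card N) - real t"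
  shows "progress K (\<lambda>S. card (N \<inter> S) < t) (\<lambda>S. t - card (N \<inter> S)) \<xi> \<nu> \<rho>"
proof
  have finN: "finite N" using assms finite_subset by blast
  show "\<nu> * real (card (K - S)) \<le>
      real (card {x \<in> K - S. t - card (N \<inter> insert x S) < t - card (N \<inter> S)})"
    if S: "S \<subseteq> K" and bad: "card (N \<inter> S) < t" for S
  proof -
    have "\<nu> * real (card (K - S)) \<le> \<nu> * real (card K)"
      using \<nu>(1) assms(1) by (intro mult_left_mono) (auto intro: card_mono)
    also have "\<dots> \<le> real (card N) - real (card (N \<inter> S))" using \<nu>(2) bad by linarith
    also have "\<dots> = real (card (N - S))"
      using finN card_Diff_subset_Int[of N S] card_mono[of N "N \<inter> S"] by (simp add: of_nat_diff)
    also have "\<dots> \<le> real (card {x \<in> K - S. t - card (N \<inter> insert x S) < t - card (N \<inter> S)})"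
    proof (intro of_nat_mono card_mono subsetI)
      show "finite {x \<in> K - S. t - card (N \<inter> insert x S) < t - card (N \<inter> S)}" using assms(1) by simp
      fix x assume x: "x \<in> N - S"
      then have "N \<inter> insert x S = insert x (N \<inter> S)" by blast
      then have "card (N \<inter> insert x S) = Suc (card (N \<inter> S))" using x finN by simp
      then show "x \<in> {x \<in> K - S. t - card (N \<inter> insert x S) < t - card (N \<inter> S)}"
        using x assms(2) bad by auto
    qed
    finally show ?thesis .
  qed
  have le: "card (N \<inter> S) \<le> card (N \<inter> insert x S)" for x S using finN by (intro card_mono) auto
  show "t - card (N \<inter> insert x S) \<le> t - card (N \<inter> S)" for x S using le by (rule diff_le_mono2)
  show "card (N \<inter> S) < t" if "card (N \<inter> insert x S) < t" for x S
    using le that by (rule le_less_trans)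
qed (use assms in \<open>auto simp: mult_nonneg_nonneg\<close>)

section \<open>Counting edges\<close>

lemma card_transversals: "card (transversal k ` Pi\<^sub>E {..<k} X) = (\<Prod>l<k. card (X l))"
  by (simp add: card_image inj_on_transversal card_PiE)

lemma edges_through_vertex:
  assumes "i < k"
  shows "{e \<in> complete_edges k n. (i, a) \<in> e \<and> e - {(i, a)} \<subseteq> C} =
    (if a < n then transversal k ` Pi\<^sub>E {..<k} (\<lambda>l. if l = i then {a} else {b. b < n \<and> (l, b) \<in> C}) else {})"
    (is "?L = ?R")
proof -
  have "?L \<subseteq> ?R"
  proof
    fix e assume e: "e \<in> ?L"
    then obtain g where g: "g \<in> {..<k} \<rightarrow>\<^sub>E {..<n}" "e = transversal k g"
      by (blast elim: complete_edgesE)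
    have gi: "g i = a" using e by (auto simp: g mem_transversal)
    have gl: "(l, g l) \<in> C" if "l < k" "l \<noteq> i" for l
    proof -
      have "(l, g l) \<in> e - {(i, a)}" using that by (auto simp: g mem_transversal)
      then show ?thesis using e by blast
    qed
    have "a < n" using gi g(1) assms by auto
    moreover have "g \<in> Pi\<^sub>E {..<k} (\<lambda>l. if l = i then {a} else {b. b < n \<and> (l, b) \<in> C})"
      using g(1) gi gl by (auto simp: PiE_iff)
    ultimately show "e \<in> ?R" using g(2) by simp
  qed
  moreover have "?R \<subseteq> ?L"
  proof
    fix e assume "e \<in> ?R"
    then obtain g where an: "a < n" and e: "e = transversal k g"
      and g: "g \<in> Pi\<^sub>E {..<k} (\<lambda>l. if l = i then {a} else {b. b < n \<and> (l, b) \<in> C})"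
      by (auto split: if_splits)
    have gi: "g i = a" using PiE_mem[OF g, of i] assms by simp
    have gl: "g l < n" "(l, g l) \<in> C" if "l < k" "l \<noteq> i" for l
      using PiE_mem[OF g, of l] that by auto
    have "e \<in> complete_edges k n"
      unfolding e using gi gl an by (intro transversal_in_complete) (metis Pi_I lessThan_iff)
    moreover have "(i, a) \<in> e" using gi assms by (simp add: e mem_transversal)
    moreover have "e - {(i, a)} \<subseteq> C"
    proof
      fix u assume u: "u \<in> e - {(i, a)}"
      then have "fst u < k" "u = (fst u, g (fst u))" by (auto simp: e mem_transversal prod_eq_iff)
      moreover from this u have "fst u \<noteq> i" using gi by auto
      ultimately show "u \<in> C" using gl by metis
    qed
    ultimately show "e \<in> ?L" by blast
  qed
  ultimately show ?thesis by (rule equalityI)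
qed

lemma card_edges_through_vertex:
  assumes "v \<in> vertices k n"
  shows "card {e \<in> complete_edges k n. v \<in> e} = n ^ (k - 1)"
proof -
  obtain i a where v: "v = (i, a)" "i < k" "a < n" using assms by (cases v) (auto simp: mem_vertices)
  have "{e \<in> complete_edges k n. v \<in> e} = {e \<in> complete_edges k n. (i, a) \<in> e \<and> e - {(i, a)} \<subseteq> UNIV}"
    using v by simp
  also have "card \<dots> = (\<Prod>l<k. card (if l = i then {a} else {b. b < n \<and> (l, b) \<in> UNIV}))"
    unfolding edges_through_vertex[OF v(2)] using v(3) by (simp only: card_transversals if_True)
  also have "\<dots> = (\<Prod>l<k. if l = i then 1 else n)" by (intro prod.cong refl) simp
  also have "\<dots> = n ^ (k - 1)" using v(2) by (subst prod.remove[of _ i]) auto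
  finally show ?thesis .
qed

text \<open>The classes other than that of \<open>v\<close> contribute at least \<open>x\<close> choices each.\<close>

lemma card_edges_into:
  fixes x :: real
  assumes v: "v \<in> vertices k n" and x: "0 \<le> x" "\<And>i. i < k \<Longrightarrow> x \<le> card (C \<inter> vertex_class n i)"
  shows "x ^ (k - 1) \<le> card {e \<in> complete_edges k n. v \<in> e \<and> e - {v} \<subseteq> C}"
proof -
  obtain i a where v: "v = (i, a)" "i < k" "a < n" using v by (cases v) (auto simp: mem_vertices)
  have card: "card {b. b < n \<and> (l, b) \<in> C} = card (C \<inter> vertex_class n l)" for l
  proof -
    have "C \<inter> vertex_class n l = Pair l ` {b. b < n \<and> (l, b) \<in> C}" by (auto simp: vertex_class_def)
    then show ?thesis by (simp add: card_image inj_on_def)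
  qed
  have "x ^ (k - 1) = (\<Prod>l\<in>{..<k} - {i}. x)" using v(2) by simp
  also have "\<dots> \<le> (\<Prod>l\<in>{..<k} - {i}. real (card (C \<inter> vertex_class n l)))"
    using x by (intro prod_mono) auto
  also have "\<dots> = (\<Prod>l<k. real (if l = i then 1 else card (C \<inter> vertex_class n l)))"
    using v(2) by (subst (2) prod.remove[of _ i]) auto
  also have "\<dots> = real (\<Prod>l<k. card (if l = i then {a} else {b. b < n \<and> (l, b) \<in> C}))"
    unfolding of_nat_prod by (intro prod.cong refl) (simp add: card)
  also have "\<dots> = card {e \<in> complete_edges k n. v \<in> e \<and> e - {v} \<subseteq> C}"
    unfolding v(1) edges_through_vertex[OF v(2)] using v(3) by (simp add: card_transversals)
  finally show ?thesis .
qed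

lemma card_edges_through_pair:
  assumes "u \<in> vertices k n" "v \<in> vertices k n" "u \<noteq> v"
  shows "card {e \<in> complete_edges k n. u \<in> e \<and> v \<in> e} \<le> n ^ (k - 2)"
proof -
  obtain i a where u: "u = (i, a)" "i < k" "a < n" using assms by (cases u) (auto simp: mem_vertices)
  obtain j b where v: "v = (j, b)" "j < k" "b < n" using assms by (cases v) (auto simp: mem_vertices)
  let ?X = "\<lambda>l. if l = i then {a} else if l = j then {b} else {..<n}"
  have sub: "{e \<in> complete_edges k n. u \<in> e \<and> v \<in> e} \<subseteq> transversal k ` Pi\<^sub>E {..<k} ?X"
  proof
    fix e assume e: "e \<in> {e \<in> complete_edges k n. u \<in> e \<and> v \<in> e}"
    then obtain g where g: "g \<in> {..<k} \<rightarrow>\<^sub>E {..<n}" "e = transversal k g"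
      by (blast elim: complete_edgesE)
    have "g i = a" "g j = b" using e by (auto simp: g u v mem_transversal)
    then have "g \<in> Pi\<^sub>E {..<k} ?X" using g(1) by (auto simp: PiE_iff)
    then show "e \<in> transversal k ` Pi\<^sub>E {..<k} ?X" using g(2) by blast
  qed
  show ?thesis
  proof (cases "i = j")
    case True
    have "False" if e: "e \<in> complete_edges k n" "u \<in> e" "v \<in> e" for e
    proof -
      from e(1) obtain g where "e = transversal k g" by (rule complete_edgesE)
      then have "a = g i" "b = g j" using e by (auto simp: u v mem_transversal)
      then show False using True assms(3) by (simp add: u v)
    qed
    then have "{e \<in> complete_edges k n. u \<in> e \<and> v \<in> e} = {}" by blast
    then show ?thesis by (simp only: card.empty le0)
  next
    case False
    have "card {e \<in> complete_edges k n. u \<in> e \<and> v \<in> e} \<le> card (transversal k ` Pi\<^sub>E {..<k} ?X)"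
      using sub by (intro card_mono finite_imageI finite_PiE) auto
    also have "\<dots> = (\<Prod>l<k. card (?X l))" by (rule card_transversals)
    also have "\<dots> = (\<Prod>l\<in>{..<k} - {i}. card (?X l))"
      using u(2) by (subst prod.remove[of _ i]) auto
    also have "\<dots> = (\<Prod>l\<in>{..<k} - {i} - {j}. card (?X l))"
      using v(2) False by (subst prod.remove[of _ j]) auto
    also have "\<dots> = (\<Prod>l\<in>{..<k} - {i} - {j}. n)" by (intro prod.cong) auto
    also have "\<dots> = n ^ (k - 2)" using u(2) v(2) False by (simp add: numeral_2_eq_2)
    finally show ?thesis .
  qed
qed



section \<open>The random process\<close>

text \<open>Only edges outside \<open>S\<close> count, so that the order in which they arrive is independent of the core \<open>C\<close>,
which is chosen on the basis of \<open>S\<close>.\<close>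

definition attaching_edges :: "nat \<Rightarrow> nat \<Rightarrow> vertex set set \<Rightarrow> vertex set \<Rightarrow> vertex \<Rightarrow> vertex set set" where
  "attaching_edges k n S C v = {e \<in> complete_edges k n - S. v \<in> e \<and> e - {v} \<subseteq> C}"

definition leftover :: "nat \<Rightarrow> nat \<Rightarrow> nat \<Rightarrow> vertex set set \<Rightarrow> vertex set \<Rightarrow> vertex set set \<Rightarrow> vertex set" where
  "leftover k n d S C S' = {v \<in> vertices k n - C. card (attaching_edges k n S C v \<inter> S') < d}"

text \<open>Two rounds of extension: the vertices outside \<open>C\<close> that are not left over have \<open>d\<close> edges into \<open>C\<close>; the
leftover vertices then have all their edges into the set that is already locked.\<close>

lemma locked_if_leftover_spread:
  assumes lock: "locked k d S C" and C: "C \<subseteq> vertices k n"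
    and sub: "S \<subseteq> S'" "S' \<subseteq> G" "G \<subseteq> complete_edges k n"
    and deg: "\<And>v. v \<in> vertices k n \<Longrightarrow> d \<le> degree_in G v"
    and spread: "\<And>u v e. u \<in> leftover k n d S C S' \<Longrightarrow> v \<in> leftover k n d S C S' \<Longrightarrow> u \<noteq> v \<Longrightarrow>
      e \<in> G \<Longrightarrow> u \<in> e \<Longrightarrow> v \<in> e \<Longrightarrow> False"
  shows "locked k d G (vertices k n)"
proof -
  let ?R = "leftover k n d S C S'"
  have lockC: "locked k d G C" using locked_mono[OF _ lock] sub by blast
  define W where "W = vertices k n - C - ?R"
  have "locked k d G (C \<union> W)"
  proof (rule locked_extend[OF lockC, where n = n])
    fix v assume v: "v \<in> W"
    show "\<exists>F\<subseteq>complete_edges k n. d \<le> card F \<and> (\<forall>e\<in>F. implied d G e \<and> v \<in> e \<and> e - {v} \<subseteq> C)"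
    proof (intro exI[of _ "attaching_edges k n S C v \<inter> S'"] conjI ballI)
      show "d \<le> card (attaching_edges k n S C v \<inter> S')"
        using v by (auto simp: W_def leftover_def)
    qed (use sub in \<open>auto simp: attaching_edges_def intro!: implied_mem\<close>)
  qed
  then have "locked k d G ((C \<union> W) \<union> ?R)"
  proof (rule locked_extend[where n = n])
    fix v assume v: "v \<in> ?R"
    then have vV: "v \<in> vertices k n" by (simp add: leftover_def)
    show "\<exists>F\<subseteq>complete_edges k n. d \<le> card F \<and> (\<forall>e\<in>F. implied d G e \<and> v \<in> e \<and> e - {v} \<subseteq> C \<union> W)"
    proof (intro exI[of _ "{e \<in> G. v \<in> e}"] conjI ballI subsetI)
      show "d \<le> card {e \<in> G. v \<in> e}" using deg[OF vV] by (simp add: degree_in_def)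
      show "e \<in> complete_edges k n" if "e \<in> {e \<in> G. v \<in> e}" for e using that sub by blast
      fix e assume e: "e \<in> {e \<in> G. v \<in> e}"
      then show "implied d G e" "v \<in> e" by (auto intro: implied_mem)
      fix u assume u: "u \<in> e - {v}"
      have "u \<in> vertices k n" using u e sub complete_edges_subset by blast
      moreover have "u \<notin> ?R" using spread[OF _ v, of u e] u e by blast
      ultimately show "u \<in> C \<union> W" by (auto simp: W_def)
    qed
  qed
  then show ?thesis by (rule locked_subset) (auto simp: W_def)
qed

lemma edge_order_eq: "edge_order k n = random_order (complete_edges k n)"
  by (simp add: edge_order_def)

lemma prob_few_implied:
  assumes "0 < \<epsilon>" "\<epsilon> \<le> 1" "m \<le> n ^ k"
  shows "prob (edge_order k n)
      {es. real (card {e \<in> complete_edges k n. \<not> implied d (set (take m es)) e}) > \<epsilon> * real n ^ k} \<le>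
    2 ^ (d * k * n) * (1 - \<epsilon> / 2) ^ m"
proof -
  interpret progress "complete_edges k n"
    "\<lambda>S. real (card {e \<in> complete_edges k n. \<not> implied d S e}) > \<epsilon> * real n ^ k"
    "freedom k n d" "1 / 2" \<epsilon> "1 - \<epsilon> / 2"
    using assms by (intro progress_freedom)
  have "prob (edge_order k n)
      {es. real (card {e \<in> complete_edges k n. \<not> implied d (set (take m es)) e}) > \<epsilon> * real n ^ k} \<le>
      2 ^ freedom k n d {} * (1 - \<epsilon> / 2) ^ m"
    using tail[of "{}" m] assms(3) by (simp add: edge_order_eq card_complete_edges)
  also have "\<dots> \<le> 2 ^ (d * k * n) * (1 - \<epsilon> / 2) ^ m"
    using freedom_le_card[of k n d "{}"] assms
    by (intro mult_right_mono power_increasing) auto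
  finally show ?thesis .
qed

lemma prob_union_bound:
  fixes b :: real
  assumes "finite I" "\<And>i. i \<in> I \<Longrightarrow> prob p (A i) \<le> b"
  shows "prob p (\<Union>i\<in>I. A i) \<le> card I * b"
proof -
  have "prob p (\<Union>i\<in>I. A i) \<le> (\<Sum>i\<in>I. prob p (A i))"
    by (rule measure_pmf.finite_measure_subadditive_finite) (auto simp: assms)
  also have "\<dots> \<le> (\<Sum>i\<in>I. b)" using assms by (intro sum_mono)
  finally show ?thesis by simp
qed

lemma prob_small_degree:
  assumes n: "2 * d \<le> n ^ (k - 1)" "0 < n" "0 < k" and m: "m \<le> n ^ k"
  shows "prob (edge_order k n)
      {es. \<exists>v\<in>vertices k n. card {e \<in> complete_edges k n \<inter> set (take m es). v \<in> e} < d} \<le>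
    real k * real n * (2 ^ d * (1 - 1 / (4 * real n)) ^ m)"
proof -
  let ?K = "complete_edges k n"
  have "{es. \<exists>v\<in>vertices k n. card {e \<in> ?K \<inter> set (take m es). v \<in> e} < d} =
     (\<Union>v\<in>vertices k n. {es. card ({e \<in> ?K. v \<in> e} \<inter> set (take m es)) < d})"
  proof -
    have "{e \<in> ?K \<inter> set (take m es). v \<in> e} = {e \<in> ?K. v \<in> e} \<inter> set (take m es)" for v es by blast
    then show ?thesis by auto
  qed
  also have "prob (edge_order k n) \<dots> \<le> card (vertices k n) * (2 ^ d * (1 - 1 / (4 * real n)) ^ m)"
  proof (rule prob_union_bound[OF finite_vertices])
    fix v assume v: "v \<in> vertices k n"
    let ?N = "{e \<in> ?K. v \<in> e}"
    have nk: "real n ^ k = real n * real n ^ (k - 1)" using n(3) by (cases k) auto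
    have "real (2 * d) \<le> real (n ^ (k - 1))" using n(1) by (rule of_nat_mono)
    then have "1 / (2 * real n) * real (card ?K) \<le> real (card ?N) - real d"
      using n(2) by (simp add: card_complete_edges card_edges_through_vertex[OF v] nk)
    then interpret progress ?K "\<lambda>S. card (?N \<inter> S) < d" "\<lambda>S. d - card (?N \<inter> S)" "1 / 2"
      "1 / (2 * real n)" "1 - 1 / (4 * real n)"
      using n(2) by (intro progress_few_hits) (auto simp: finite_complete_edges field_simps)
    show "prob (edge_order k n) {es. card (?N \<inter> set (take m es)) < d} \<le>
      2 ^ d * (1 - 1 / (4 * real n)) ^ m"
      using tail[of "{}" m] m by (simp add: edge_order_eq card_complete_edges)
  qed
  finally show ?thesis by (simp add: card_vertices)
qed

text \<open>Vertices of one class are enough. Their edge sets are pairwise disjoint blocks of \<open>n\<^sup>k\<^sup>-\<^sup>1\<close> edges, as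
\<open>random_order_all_hit\<close> requires.\<close>

lemma prob_no_isolated:
  assumes k: "2 \<le> k" and n: "4 \<le> n" and m: "m \<le> n ^ (k - 1)"
  shows "prob (edge_order k n)
      {es. \<forall>a<n. set (take m es) \<inter> {e \<in> complete_edges k n. (0, a) \<in> e} \<noteq> {}} \<le>
    1 / (real n * (1 - 1 / (real n - 1)) ^ m)"
proof -
  let ?K = "complete_edges k n"
  let ?B = "\<lambda>a. {e \<in> ?K. (0 :: nat, a) \<in> e}"
  have nk: "n ^ k = n * n ^ (k - 1)" using k by (cases k) auto
  have 0: "(0, a) \<in> vertices k n" if "a < n" for a using that k by (simp add: mem_vertices)
  have "prob (random_order ?K) {es. \<forall>a\<in>{..<n}. set (take m es) \<inter> ?B a \<noteq> {}} \<le>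
      1 / (card {..<n} * (1 - 1 / (real n - 1)) ^ m)"
  proof (rule random_order_all_hit[where b = "n ^ (k - 1)" and A = ?K and B = ?B and V = "{..<n}" and m = m
        and q = "(1 - 1 / (real n - 1)) ^ m"])
    show "card (?B a) = n ^ (k - 1)" if "a \<in> {..<n}" for a
      using card_edges_through_vertex[OF 0] that by simp
    show "?B a \<inter> ?B b = {}" if "a \<noteq> b" for a b
    proof -
      have False if e: "e \<in> ?K" "(0, a) \<in> e" "(0, b) \<in> e" for e
      proof -
        from e(1) obtain g where "e = transversal k g" by (rule complete_edgesE)
        then show False using e \<open>a \<noteq> b\<close> by (auto simp: mem_transversal)
      qed
      then show ?thesis by blast
    qed
    have "m + 2 * n ^ (k - 1) \<le> 3 * n ^ (k - 1)" using m by simp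
    also have "\<dots> \<le> n * n ^ (k - 1)" using n by (intro mult_right_mono) auto
    finally show "m + 2 * n ^ (k - 1) \<le> card ?K" by (simp add: card_complete_edges nk)
    show "0 < (1 - 1 / (real n - 1)) ^ m" using n by (intro zero_less_power) (simp add: field_simps)
    have "(1 - 1 / (real n - 1)) ^ m = (\<Prod>i<m. 1 - 1 / (real n - 1))" by simp
    also have "\<dots> \<le> (\<Prod>i<m. 1 - real (n ^ (k - 1)) / (real (card ?K) - real i))"
    proof (intro prod_mono conjI)
      fix i assume "i \<in> {..<m}"
      then have i: "real i \<le> real n ^ (k - 1)"
        using m by (metis lessThan_iff less_imp_le_nat less_le_trans of_nat_le_iff of_nat_power)
      define b where "b = real n ^ (k - 1)"
      have b: "b > 0" using n by (simp add: b_def)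
      have "b / (real n * b - real i) \<le> b / (b * (real n - 1))"
      proof (intro divide_left_mono mult_pos_pos)
        show "b * (real n - 1) \<le> real n * b - real i" using i by (simp add: b_def algebra_simps)
        have "1 * b < real n * b" using b n by (intro mult_strict_right_mono) auto
        moreover have "real i \<le> b" using i by (simp only: b_def)
        ultimately show "0 < real n * b - real i" by linarith
      qed (use b n in auto)
      also have "\<dots> = 1 / (real n - 1)" using b by simp
      finally show "1 - 1 / (real n - 1) \<le> 1 - real (n ^ (k - 1)) / (real (card ?K) - real i)"
        by (simp add: card_complete_edges nk b_def)
    qed (use n in \<open>simp add: field_simps\<close>)
    finally show "(1 - 1 / (real n - 1)) ^ m \<le> (\<Prod>i<m. 1 - real (n ^ (k - 1)) / (real (card ?K) - real i))" .
    show "{..<n} \<noteq> {}" using n by (simp add: lessThan_empty_iff bot_nat_def)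
  qed (use n in \<open>auto simp: finite_complete_edges\<close>)
  then show ?thesis by (simp add: edge_order_eq Ball_def)
qed

text \<open>Two vertices \<open>u\<close> and \<open>v\<close> outside \<open>C\<close> have disjoint sets of attaching edges, and neither set contains an
edge through both. If both are left over, then the union, of about \<open>2 n\<^sup>k\<^sup>-\<^sup>1\<close> edges, is hit fewer than
\<open>2 d\<close> times in \<open>s\<close> steps. The union bound runs over the pairs in a common edge of \<open>S\<close>, of which there
are at most \<open>k\<^sup>2 card S\<close>, and over all pairs together with the event that one of their at most
\<open>n\<^sup>k\<^sup>-\<^sup>2\<close> common edges arrives within \<open>m\<close> steps, which costs a factor of order \<open>m / n\<^sup>2\<close>.\<close>

lemma prob_close_leftover_pair:
  fixes \<eta> \<xi> \<nu> \<rho> :: real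
  assumes k: "3 \<le> k" and n: "0 < n"
    and S: "S \<subseteq> complete_edges k n" and C: "C \<subseteq> vertices k n"
    and \<eta>: "0 \<le> \<eta>" "\<eta> \<le> 1" "\<And>i. i < k \<Longrightarrow> (1 - \<eta>) * n \<le> card (C \<inter> vertex_class n i)"
    and \<xi>: "0 < \<xi>" "\<xi> \<le> 1" and \<rho>: "\<rho> = 1 - (1 - \<xi>) * \<nu>" "1 / 2 \<le> \<rho>"
    and \<nu>: "0 \<le> \<nu>" "\<nu> * real n ^ k \<le> 2 * ((1 - \<eta>) * n) ^ (k - 1) - 2 * real (card S) - 2 * real d"
    and s: "s \<le> m" and m: "2 * (card S + m) \<le> n ^ k"
  shows "prob (random_order (complete_edges k n - S))
      {xs. \<exists>u v e. u \<noteq> v \<and> u \<in> leftover k n d S C (S \<union> set (take s xs)) \<and>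
        v \<in> leftover k n d S C (S \<union> set (take s xs)) \<and> e \<in> S \<union> set (take m xs) \<and> u \<in> e \<and> v \<in> e}
    \<le> (real k)\<^sup>2 * (real (card S) + 4 * real m) * ((1 / \<xi>) ^ (2 * d) * \<rho> ^ s)"
    (is "prob _ ?close \<le> _")
proof -
  let ?K = "complete_edges k n"
  let ?A = "attaching_edges k n S C"
  let ?M = "random_order (?K - S)"
  let ?B = "\<lambda>u v. {e \<in> ?K. u \<in> e \<and> v \<in> e}"
  note rho_ge = \<rho>(2)
  have finS: "finite S" using S finite_complete_edges finite_subset by blast
  define T where "T = (1 / \<xi>) ^ (2 * d) * \<rho> ^ s"
  have T0: "T \<ge> 0" using \<xi> \<rho> by (simp add: T_def)
  define few where "few u v S' \<longleftrightarrow> card ((?A u \<union> ?A v) \<inter> S') < 2 * d" for u v S'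
  let ?F1 = "\<lambda>u v. {xs. few u v (S \<union> set (take s xs))}"
  let ?F2 = "\<lambda>u v. {xs. set (take m xs) \<inter> ?B u v \<noteq> {} \<and> few u v (S \<union> set (take s xs))}"
  define P where "P = {(u, v). u \<in> vertices k n - C \<and> v \<in> vertices k n - C \<and> u \<noteq> v}"
  have finA: "finite (?A v)" for v using finite_complete_edges by (auto simp: attaching_edges_def)
  have cardKS: "real (card (?K - S)) = real n ^ k - real (card S)"
  proof -
    have "card (?K - S) = card ?K - card S" using S finS by (simp add: card_Diff_subset)
    moreover have "card S \<le> card ?K" using S finite_complete_edges by (simp add: card_mono)
    ultimately show ?thesis by (simp add: of_nat_diff card_complete_edges)
  qed
  have mr: "2 * (real (card S) + real m) \<le> real n ^ k"
  proof -
    have "real (2 * (card S + m)) \<le> real (n ^ k)" using m by (rule of_nat_mono)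
    then show ?thesis by simp
  qed
  have s_le: "s \<le> card (?K - S)"
  proof -
    have "real s \<le> real (card (?K - S))" using s mr unfolding cardKS by simp
    then show ?thesis by simp
  qed
  have prog: "progress ?K (few u v) (\<lambda>S'. 2 * d - card ((?A u \<union> ?A v) \<inter> S')) \<xi> \<nu> \<rho>"
    if "(u, v) \<in> P" for u v
  proof -
    have uv: "u \<in> vertices k n" "v \<in> vertices k n" "u \<notin> C" "v \<notin> C" "u \<noteq> v"
      using that by (auto simp: P_def)
    have card_A: "((1 - \<eta>) * n) ^ (k - 1) - real (card S) \<le> real (card (?A w))"
      if "w \<in> vertices k n" for w
    proof -
      have "?A w = {e \<in> ?K. w \<in> e \<and> e - {w} \<subseteq> C} - S" by (auto simp: attaching_edges_def)
      then have "real (card {e \<in> ?K. w \<in> e \<and> e - {w} \<subseteq> C}) - real (card S) \<le> real (card (?A w))"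
        using diff_card_le_card_Diff[OF finS, of "{e \<in> ?K. w \<in> e \<and> e - {w} \<subseteq> C}"] by simp
      moreover have "((1 - \<eta>) * n) ^ (k - 1) \<le> real (card {e \<in> ?K. w \<in> e \<and> e - {w} \<subseteq> C})"
        using \<eta> that by (intro card_edges_into) auto
      ultimately show ?thesis by linarith
    qed
    have "?A u \<inter> ?A v = {}" using uv by (auto simp: attaching_edges_def)
    then have "card (?A u \<union> ?A v) = card (?A u) + card (?A v)" by (intro card_Un_disjoint finA)
    then have "\<nu> * real (card ?K) \<le> real (card (?A u \<union> ?A v)) - real (2 * d)"
      using card_A[OF uv(1)] card_A[OF uv(2)] \<nu>(2) by (simp add: card_complete_edges)
    then show ?thesis
      unfolding few_def[abs_def] using \<xi> \<rho> \<nu>(1)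
      by (intro progress_few_hits) (auto simp: finite_complete_edges attaching_edges_def)
  qed
  have r_le: "(1 / \<xi>) ^ (2 * d - x) * \<rho> ^ s \<le> T" for x
    unfolding T_def using \<xi> \<rho> by (intro mult_right_mono power_increasing) auto
  define P0 where "P0 = P \<inter> (\<Union>e\<in>S. e \<times> e)"
  have finP: "finite P"
    unfolding P_def by (rule finite_subset[of _ "vertices k n \<times> vertices k n"]) (auto simp: finite_vertices)
  have "prob ?M
      ?close \<le>
    prob ?M ((\<Union>(u, v)\<in>P0. ?F1 u v) \<union>
      (\<Union>(u, v)\<in>P. ?F2 u v))"
  proof (rule measure_pmf.finite_measure_mono_AE)
    have supp: "set_pmf ?M = permutations_of_set (?K - S)"
      using finite_complete_edges by (intro set_random_order) auto
    show "AE xs in measure_pmf ?M. xs \<in> ?close \<longrightarrow>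
      xs \<in> (\<Union>(u, v)\<in>P0. ?F1 u v) \<union>
      (\<Union>(u, v)\<in>P. ?F2 u v)"
      unfolding AE_measure_pmf_iff supp
    proof (intro ballI impI)
      fix xs assume xs: "xs \<in> permutations_of_set (?K - S)"
      let ?S' = "S \<union> set (take s xs)"
      assume "xs \<in> ?close"
      then obtain u v e where uv: "u \<noteq> v" "u \<in> leftover k n d S C ?S'" "v \<in> leftover k n d S C ?S'"
        and e: "e \<in> S \<union> set (take m xs)" "u \<in> e" "v \<in> e" by blast
      have P: "(u, v) \<in> P" using uv by (auto simp: P_def leftover_def)
      have "card ((?A u \<union> ?A v) \<inter> ?S') \<le> card (?A u \<inter> ?S') + card (?A v \<inter> ?S')"
        by (metis Int_Un_distrib2 card_Un_le)
      then have few: "few u v ?S'" using uv by (simp add: few_def leftover_def)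
      show "xs \<in> (\<Union>(u, v)\<in>P0. ?F1 u v) \<union>
        (\<Union>(u, v)\<in>P. ?F2 u v)"
      proof (cases "e \<in> S")
        case True
        then have "(u, v) \<in> P0" using P e by (auto simp: P0_def)
        then show ?thesis using few by blast
      next
        case False
        then have "e \<in> set (take m xs)" using e(1) by blast
        moreover have "e \<in> ?K"
          using calculation set_take_subset[of m xs] permutations_of_setD(1)[OF xs] by blast
        ultimately have "set (take m xs) \<inter> ?B u v \<noteq> {}" using e by blast
        then show ?thesis using few P by blast
      qed
    qed
  qed simp
  also have "\<dots> \<le> prob ?M (\<Union>(u, v)\<in>P0. ?F1 u v) +
      prob ?M (\<Union>(u, v)\<in>P. ?F2 u v)"
    by (rule measure_Un_le) auto
  also have "prob ?M (\<Union>(u, v)\<in>P0. ?F1 u v) \<le> card P0 * T"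
  proof (rule prob_union_bound)
    show "finite P0" using finP by (simp add: P0_def)
    fix x assume "x \<in> P0"
    then obtain u v where uv: "x = (u, v)" "(u, v) \<in> P" by (cases x) (auto simp: P0_def)
    interpret progress ?K "few u v" "\<lambda>S'. 2 * d - card ((?A u \<union> ?A v) \<inter> S')" \<xi> \<nu> \<rho>
      by (rule prog[OF uv(2)])
    show "prob ?M (case x of (u, v) \<Rightarrow> ?F1 u v) \<le> T"
      unfolding uv(1) prod.case using tail[OF S s_le] r_le by (rule order_trans)
  qed
  also have "prob ?M (\<Union>(u, v)\<in>P. ?F2 u v)
      \<le> card P * (m * (2 / (real n)\<^sup>2) * (T / \<rho>))"
  proof (rule prob_union_bound[OF finP])
    fix x assume "x \<in> P"
    then obtain u v where uv: "x = (u, v)" "(u, v) \<in> P" by (cases x) auto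
    interpret progress ?K "few u v" "\<lambda>S'. 2 * d - card ((?A u \<union> ?A v) \<inter> S')" \<xi> \<nu> \<rho>
      by (rule prog[OF uv(2)])
    have nk: "real n ^ k = (real n)\<^sup>2 * real n ^ (k - 2)"
      using k by (metis Suc_leD eval_nat_numeral(3) le_add_diff_inverse power_add)
    have "real (card (?B u v)) \<le> real (n ^ (k - 2))"
      using uv(2) by (intro of_nat_mono card_edges_through_pair) (auto simp: P_def)
    also have "\<dots> = 2 / (real n)\<^sup>2 * (real n ^ k / 2)" using n by (simp add: nk)
    finally have B: "real (card (?B u v)) \<le> 2 / (real n)\<^sup>2 * (real n ^ k / 2)" .
    have "prob ?M (?F2 u v)
        \<le> m * (2 / (real n)\<^sup>2) * ((1 / \<xi>) ^ (2 * d - card ((?A u \<union> ?A v) \<inter> S)) * \<rho> ^ s / \<rho>)"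
    proof (rule tail_hit[OF _ _ _ B S s_le])
      show "finite (?B u v)" using finite_complete_edges by simp
      show "real n ^ k / 2 + real m \<le> real (card (?K - S))" using mr unfolding cardKS by simp
    qed (use n in auto)
    also have "\<dots> \<le> m * (2 / (real n)\<^sup>2) * (T / \<rho>)"
    proof (intro mult_left_mono divide_right_mono r_le)
      show "0 \<le> \<rho>" using rho_ge by simp
    qed simp_all
    finally show "prob ?M (case x of (u, v) \<Rightarrow>
        ?F2 u v) \<le> m * (2 / (real n)\<^sup>2) * (T / \<rho>)"
      unfolding uv(1) prod.case .
  qed
  also have "card P0 * T \<le> (k\<^sup>2 * card S) * T"
  proof (intro mult_right_mono T0 of_nat_mono)
    have fe: "finite e" "card e = k" if e: "e \<in> S" for e
    proof -
      have "e \<in> ?K" using S e by blast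
      then show "finite e" by (rule finite_edge)
      from \<open>e \<in> ?K\<close> obtain g where "e = transversal k g" by (rule complete_edgesE)
      then show "card e = k" by (simp add: transversal_def card_image inj_on_def)
    qed
    have "card P0 \<le> card (\<Union>e\<in>S. e \<times> e)"
      using finS fe by (intro card_mono) (auto simp: P0_def)
    also have "\<dots> \<le> (\<Sum>e\<in>S. card (e \<times> e))" by (rule card_UN_le[OF finS])
    also have "\<dots> = k\<^sup>2 * card S" using fe by (simp add: card_cartesian_product power2_eq_square)
    finally show "card P0 \<le> k\<^sup>2 * card S" .
  qed
  also have "card P * (m * (2 / (real n)\<^sup>2) * (T / \<rho>)) \<le> (k * n)\<^sup>2 * (m * (2 / (real n)\<^sup>2) * (T * 2))"
  proof (intro mult_mono mult_left_mono)
    have "card P \<le> card (vertices k n \<times> vertices k n)"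
      by (intro card_mono) (auto simp: P_def finite_vertices)
    then show "real (card P) \<le> real ((k * n)\<^sup>2)"
      by (simp add: card_cartesian_product card_vertices power2_eq_square flip: of_nat_mult)
    have "T / \<rho> \<le> T / (1 / 2)" using T0 \<rho>(2) by (intro divide_left_mono) auto
    then show "T / \<rho> \<le> T * 2" by simp
  qed (use T0 \<rho>(2) in auto)
  also have "real ((k * n)\<^sup>2) * (m * (2 / (real n)\<^sup>2) * (T * 2)) = k\<^sup>2 * (4 * m) * T"
    using n by (simp add: power_mult_distrib)
  finally show ?thesis by (simp add: T_def algebra_simps)
qed



section \<open>Rigidity at the hitting time\<close>

definition core :: "nat \<Rightarrow> nat \<Rightarrow> nat \<Rightarrow> real \<Rightarrow> vertex set set \<Rightarrow> vertex set" where
  "core k n d \<eta> S = (SOME C. C \<subseteq> vertices k n \<and> locked k d S C \<and>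
     (\<forall>i<k. real (card (C \<inter> vertex_class n i)) \<ge> (1 - \<eta>) * n))"

lemma core:
  assumes "3 \<le> k" "0 < d" "0 < \<eta>" "2 * d \<le> n"
    and \<epsilon>: "\<epsilon> * (1 + k / \<eta>) * (2 * (2 * real d) ^ k) \<le> 1"
    and dense: "real (card {e \<in> complete_edges k n. \<not> implied d S e}) \<le> \<epsilon> * real n ^ k"
  shows "core k n d \<eta> S \<subseteq> vertices k n" "locked k d S (core k n d \<eta> S)"
    "\<And>i. i < k \<Longrightarrow> (1 - \<eta>) * n \<le> real (card (core k n d \<eta> S \<inter> vertex_class n i))"
proof -
  let ?b = "real (card {e \<in> complete_edges k n. \<not> implied d S e})"
  have "?b * ((1 + k / \<eta>) * (2 * (2 * real d) ^ k)) \<le> (\<epsilon> * real n ^ k) * ((1 + k / \<eta>) * (2 * (2 * real d) ^ k))"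
    using dense assms(3) by (intro mult_right_mono) auto
  also have "\<dots> = (\<epsilon> * (1 + k / \<eta>) * (2 * (2 * real d) ^ k)) * real n ^ k" by simp
  also have "\<dots> \<le> 1 * real n ^ k" using \<epsilon> by (intro mult_right_mono) auto
  finally have "?b * (1 + k / \<eta>) * (2 * (2 * real d) ^ k) \<le> real n ^ k" by (simp add: mult.assoc)
  from dense_implied_imp_locked[OF assms(1-4) this]
  have "\<exists>C. C \<subseteq> vertices k n \<and> locked k d S C \<and>
      (\<forall>i<k. real (card (C \<inter> vertex_class n i)) \<ge> (1 - \<eta>) * n)" by blast
  from someI_ex[OF this, folded core_def]
  show "core k n d \<eta> S \<subseteq> vertices k n" "locked k d S (core k n d \<eta> S)"
    "\<And>i. i < k \<Longrightarrow> (1 - \<eta>) * n \<le> real (card (core k n d \<eta> S \<inter> vertex_class n i))"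
    by auto
qed

text \<open>Four bad events: too few implied edges at time \<open>m0\<close>, no isolated vertex in the first class at time
\<open>m1\<close>, a vertex of small degree at time \<open>m2\<close>, and an edge at time \<open>m2\<close> with two leftover vertices. If
none occurs, then the hitting time lies between \<open>m1\<close> and \<open>m2\<close>, and \<open>locked_if_leftover_spread\<close>
applies. Up to the factor \<open>1 / n\<close>, the constants 1.9 and 1.805 are a lower bound for the rate \<open>2 (1 - \<eta>)\<^sup>k\<^sup>-\<^sup>1\<close> at which a pair
acquires attaching edges, and this bound times \<open>1 - \<xi>\<close> for \<open>\<xi> = 1 / 20\<close>.\<close>

lemma prob_not_locked:
  fixes \<eta> \<epsilon> :: real
  assumes k: "3 \<le> k" and d: "0 < d" and n: "4 \<le> n" "2 * d \<le> n" "2 * d \<le> n ^ (k - 1)"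
    and \<eta>: "0 < \<eta>" "\<eta> \<le> 1" and \<epsilon>: "0 < \<epsilon>" "\<epsilon> \<le> 1" "\<epsilon> * (1 + k / \<eta>) * (2 * (2 * real d) ^ k) \<le> 1"
    and m: "m0 \<le> m1" "m1 \<le> m2" "m1 \<le> n ^ (k - 1)" "2 * m2 \<le> n ^ k"
    and \<nu>: "1.9 / real n * real n ^ k \<le> 2 * ((1 - \<eta>) * real n) ^ (k - 1) - 2 * real m0 - 2 * real d"
  shows "prob (edge_order k n)
      {es. \<not> locked k d (process_graph es (hitting_time k n d es)) (vertices k n)} \<le>
    2 ^ (d * k * n) * (1 - \<epsilon> / 2) ^ m0 +
    1 / (real n * (1 - 1 / (real n - 1)) ^ m1) +
    real k * real n * (2 ^ d * (1 - 1 / (4 * real n)) ^ m2) +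
    (real k)\<^sup>2 * (real m0 + 4 * real m2) * (20 ^ (2 * d) * (1 - 1.805 / real n) ^ (m1 - m0))"
    (is "?p \<le> ?p1 + ?p2 + ?p3 + ?p4")
proof -
  let ?K = "complete_edges k n"
  let ?V = "vertices k n"
  have m2: "m2 \<le> n ^ k" using m by simp
  define few where "few S \<longleftrightarrow> real (card {e \<in> ?K. \<not> implied d S e}) > \<epsilon> * real n ^ k" for S
  define R where "R S S' = leftover k n d S (core k n d \<eta> S) S'" for S S'
  define E1 where "E1 = {es. few (set (take m0 es))}"
  define E2 where "E2 = {es. \<forall>a<n. set (take m1 es) \<inter> {e \<in> ?K. (0, a) \<in> e} \<noteq> {}}"
  define E3 where "E3 = {es. \<exists>v\<in>?V. card {e \<in> ?K \<inter> set (take m2 es). v \<in> e} < d}"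
  define E4 where "E4 = {es. \<not> few (set (take m0 es)) \<and> (\<exists>u v e. u \<noteq> v \<and>
    u \<in> R (set (take m0 es)) (set (take m1 es)) \<and> v \<in> R (set (take m0 es)) (set (take m1 es)) \<and>
    e \<in> set (take m2 es) \<and> u \<in> e \<and> v \<in> e)}"
  have E1: "prob (edge_order k n) E1 \<le> ?p1"
    unfolding E1_def few_def using m m2 \<epsilon> by (intro prob_few_implied) auto
  have E2: "prob (edge_order k n) E2 \<le> ?p2"
    unfolding E2_def using k n m by (intro prob_no_isolated) auto
  have E3: "prob (edge_order k n) E3 \<le> ?p3"
    unfolding E3_def using k n m2 by (intro prob_small_degree) auto
  have E4: "prob (edge_order k n) E4 \<le> ?p4"
    unfolding edge_order_eq
  proof (rule random_order_prefix_bound[where m = m0])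
    show "finite ?K" by (rule finite_complete_edges)
    show "m0 \<le> card ?K" using m m2 by (simp add: card_complete_edges)
    fix ys :: "vertex set list" assume ys: "distinct ys" "set ys \<subseteq> ?K" "length ys = m0"
    define S where "S = set ys"
    have cS: "card S = m0" using ys by (simp add: S_def distinct_card)
    have take: "set (take m0 (ys @ xs)) = S" "set (take m1 (ys @ xs)) = S \<union> set (take (m1 - m0) xs)"
      "set (take m2 (ys @ xs)) = S \<union> set (take (m2 - m0) xs)" for xs
      using ys m by (simp_all add: S_def)
    have p4_nonneg: "?p4 \<ge> 0"
      using n by (intro mult_nonneg_nonneg zero_le_power) (auto simp: field_simps)
    show "prob (random_order (?K - set ys)) {xs. ys @ xs \<in> E4} \<le> ?p4"
    proof (cases "few S")
      case True
      then have "{xs. ys @ xs \<in> E4} = {}" unfolding E4_def mem_Collect_eq take by simp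
      then show ?thesis using p4_nonneg by (simp only: measure_empty)
    next
      case False
      then have dense: "real (card {e \<in> ?K. \<not> implied d S e}) \<le> \<epsilon> * real n ^ k"
        by (simp add: few_def)
      note C = core[OF k d \<eta>(1) n(2) \<epsilon>(3) dense]
      let ?C = "core k n d \<eta> S"
      have "{xs. ys @ xs \<in> E4} = {xs. \<exists>u v e. u \<noteq> v \<and> u \<in> leftover k n d S ?C (S \<union> set (take (m1 - m0) xs)) \<and>
        v \<in> leftover k n d S ?C (S \<union> set (take (m1 - m0) xs)) \<and> e \<in> S \<union> set (take (m2 - m0) xs) \<and> u \<in> e \<and> v \<in> e}"
        using False unfolding E4_def mem_Collect_eq take R_def by simp
      also have "prob (random_order (?K - S)) \<dots> \<le>
        (real k)\<^sup>2 * (real (card S) + 4 * real (m2 - m0)) * ((1 / (1 / 20)) ^ (2 * d) * (1 - 1.805 / real n) ^ (m1 - m0))"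
      proof (rule prob_close_leftover_pair[OF k _ _ C(1) _ _ C(3)])
        show "1 - 1.805 / real n = 1 - (1 - 1 / 20) * (1.9 / real n)" by simp
        show "1 / 2 \<le> 1 - 1.805 / real n" using n by (simp add: field_simps)
        show "1.9 / real n * real n ^ k \<le> 2 * ((1 - \<eta>) * real n) ^ (k - 1) - 2 * real (card S) - 2 * real d"
          using \<nu> by (simp add: cS)
      qed (use ys m n \<eta> cS in \<open>auto simp: S_def\<close>)
      also have "\<dots> \<le> ?p4"
      proof -
        have "1 / (1 / 20 :: real) = 20" by simp
        moreover have "0 \<le> 20 ^ (2 * d) * (1 - 1.805 / real n) ^ (m1 - m0)"
          using n by (intro mult_nonneg_nonneg zero_le_power) (auto simp: field_simps)
        moreover have "(real k)\<^sup>2 * (real (card S) + 4 * real (m2 - m0)) \<le>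
            (real k)\<^sup>2 * (real m0 + 4 * real m2)"
          using cS by (intro mult_left_mono) auto
        ultimately show ?thesis by (simp only: mult_right_mono)
      qed
      finally show ?thesis by (simp add: S_def)
    qed
  qed
  have "?p \<le> prob (edge_order k n) (E1 \<union> E2 \<union> E3 \<union> E4)"
  proof (rule measure_pmf.finite_measure_mono_AE)
    show "AE es in measure_pmf (edge_order k n).
      es \<in> {es. \<not> locked k d (process_graph es (hitting_time k n d es)) ?V} \<longrightarrow> es \<in> E1 \<union> E2 \<union> E3 \<union> E4"
      unfolding AE_measure_pmf_iff edge_order_eq set_random_order[OF finite_complete_edges]
    proof (intro ballI impI, rule ccontr)
      fix es assume es: "es \<in> permutations_of_set ?K"
        and nl: "es \<in> {es. \<not> locked k d (process_graph es (hitting_time k n d es)) ?V}"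
        and good: "es \<notin> E1 \<union> E2 \<union> E3 \<union> E4"
      let ?M = "hitting_time k n d es"
      have set_es: "set (take m es) \<subseteq> ?K" for m
        using set_take_subset[of m es] permutations_of_setD(1)[OF es] by blast
      have deg2: "\<forall>v\<in>?V. d \<le> degree_in (process_graph es m2) v"
      proof
        fix v assume v: "v \<in> ?V"
        have "{e \<in> ?K \<inter> set (take m2 es). v \<in> e} = {e \<in> set (take m2 es). v \<in> e}" using set_es by blast
        then show "d \<le> degree_in (process_graph es m2) v"
          using good v by (auto simp: E3_def degree_in_def process_graph_def not_less)
      qed
      have M2: "?M \<le> m2" unfolding hitting_time_def by (rule Least_le) (rule deg2)
      have degM: "\<forall>v\<in>?V. d \<le> degree_in (process_graph es ?M) v"
        unfolding hitting_time_def by (rule LeastI) (rule deg2)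
      have M1: "m1 \<le> ?M"
      proof (rule ccontr)
        \<comment> \<open>A vertex that is isolated at time \<open>m1\<close> has degree \<open>0 < d\<close> at all earlier times.\<close>
        assume "\<not> m1 \<le> ?M"
        then have sub: "set (take ?M es) \<subseteq> set (take m1 es)" by (intro set_take_subset_set_take) simp
        obtain a where a: "a < n" "set (take m1 es) \<inter> {e \<in> ?K. (0, a) \<in> e} = {}"
          using good by (auto simp: E2_def)
        have "{e \<in> set (take ?M es). (0, a) \<in> e} = {}" using a(2) sub set_es by blast
        then have "degree_in (process_graph es ?M) (0, a) = 0"
          unfolding degree_in_def process_graph_def by (simp only: card.empty)
        moreover have "(0, a) \<in> ?V" using a k by (simp add: mem_vertices)
        ultimately show False using degM d by (metis le_zero_eq less_irrefl)
      qed
      let ?S = "set (take m0 es)"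
      have "\<not> few ?S" using good by (simp add: E1_def)
      then have dense: "real (card {e \<in> ?K. \<not> implied d ?S e}) \<le> \<epsilon> * real n ^ k"
        by (simp add: few_def)
      note C = core[OF k d \<eta>(1) n(2) \<epsilon>(3) dense]
      have "locked k d (process_graph es ?M) ?V"
      proof (rule locked_if_leftover_spread[OF C(2,1)])
        show "?S \<subseteq> set (take m1 es)" using m by (intro set_take_subset_set_take)
        show "set (take m1 es) \<subseteq> process_graph es ?M"
          unfolding process_graph_def using M1 by (intro set_take_subset_set_take)
        show "process_graph es ?M \<subseteq> ?K" unfolding process_graph_def by (rule set_es)
        show "d \<le> degree_in (process_graph es ?M) v" if "v \<in> ?V" for v using degM that by blast
        fix u v e assume "u \<in> leftover k n d ?S (core k n d \<eta> ?S) (set (take m1 es))"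
          "v \<in> leftover k n d ?S (core k n d \<eta> ?S) (set (take m1 es))" "u \<noteq> v"
          "e \<in> process_graph es ?M" "u \<in> e" "v \<in> e"
        moreover have "process_graph es ?M \<subseteq> set (take m2 es)"
          unfolding process_graph_def using M2 by (intro set_take_subset_set_take)
        ultimately have "es \<in> E4" using \<open>\<not> few ?S\<close> unfolding E4_def R_def by blast
        then show False using good by blast
      qed
      then show False using nl by simp
    qed
  qed simp
  also have "\<dots> \<le> prob (edge_order k n) E1 + prob (edge_order k n) E2 +
      prob (edge_order k n) E3 + prob (edge_order k n) E4"
    by (intro order_trans[OF measure_Un_le] add_mono order_refl) auto
  also have "\<dots> \<le> ?p1 + ?p2 + ?p3 + ?p4" using E1 E2 E3 E4 by (intro add_mono)
  finally show ?thesis .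
qed



text \<open>The bound of \<open>prob_not_locked\<close> tends to zero for \<open>m0 = c n\<close>, \<open>m1 = 0.9 n ln n\<close> and \<open>m2 = 8 n ln n\<close>. The
constant 0.9 has to be below \<open>1\<close>, so that about \<open>n\<^sup>0\<^sup>.\<^sup>1\<close> isolated vertices remain in the first class,
and large enough that \<open>0.9 \<sqdot> 1.805 > 1\<close>: the last term is of order \<open>n ln n \<sqdot> n\<^sup>-\<^sup>1\<^sup>.\<^sup>6\<close>.\<close>

lemma locked_whp:
  assumes k: "3 \<le> k" and d: "0 < d"
  shows "(\<lambda>n. prob (edge_order k n)
      {es. \<not> locked k d (process_graph es (hitting_time k n d es)) (vertices k n)}) \<longlonglongrightarrow> 0"
proof -
  have "((\<lambda>\<eta>::real. (1 - \<eta>) ^ (k - 1)) \<longlongrightarrow> (1 - 0) ^ (k - 1)) (at_right 0)"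
    by (intro tendsto_intros)
  then have "((\<lambda>\<eta>::real. (1 - \<eta>) ^ (k - 1)) \<longlongrightarrow> 1) (at_right 0)" by simp
  then have "\<forall>\<^sub>F \<eta> in at_right 0. (1 - \<eta>) ^ (k - 1) > (0.98 :: real)"
    by (rule order_tendstoD) simp
  moreover have "\<forall>\<^sub>F \<eta> in at_right 0. 0 < \<eta> \<and> \<eta> < (1 :: real)"
    using eventually_at_right_real[of 0 "1 :: real"] by simp
  ultimately have "\<forall>\<^sub>F \<eta> in at_right (0::real). (1 - \<eta>) ^ (k - 1) > 0.98 \<and> 0 < \<eta> \<and> \<eta> < 1"
    by eventually_elim auto
  then obtain \<eta> :: real where \<eta>: "(1 - \<eta>) ^ (k - 1) > 0.98" "0 < \<eta>" "\<eta> < 1"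
    using eventually_happens'[OF trivial_limit_at_right_real] by blast
  define \<epsilon> where "\<epsilon> = 1 / ((1 + k / \<eta>) * (2 * (2 * real d) ^ k))"
  have D1: "(1 + k / \<eta>) * (2 * (2 * real d) ^ k) \<ge> 1 * 1"
  proof (intro mult_mono)
    have "1 \<le> (2 * real d) ^ k" using d by (intro one_le_power) simp
    then show "1 \<le> 2 * (2 * real d) ^ k" by simp
  qed (use \<eta> in auto)
  have \<epsilon>: "0 < \<epsilon>" "\<epsilon> \<le> 1" "\<epsilon> * (1 + k / \<eta>) * (2 * (2 * real d) ^ k) \<le> 1"
    using D1 by (auto simp: \<epsilon>_def field_simps)
  have "(\<lambda>c. 2 ^ (d * k) * (1 - \<epsilon> / 2) ^ c) \<longlonglongrightarrow> 2 ^ (d * k) * 0"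
    using \<epsilon> by (intro tendsto_mult tendsto_const LIMSEQ_power_zero) auto
  then have "\<forall>\<^sub>F c in sequentially. 2 ^ (d * k) * (1 - \<epsilon> / 2) ^ c < 1 / 2"
    by (rule order_tendstoD) simp
  \<comment> \<open>The factor \<open>2\<^sup>d\<^sup>k\<^sup>n\<close> comes from the potential \<open>d k n\<close>; \<open>c\<close> steps per vertex outweigh it.\<close>
  then obtain c :: nat where c: "2 ^ (d * k) * (1 - \<epsilon> / 2) ^ c < 1 / 2"
    by (auto simp: eventually_sequentially)
  define m0 where "m0 n = c * n" for n :: nat
  define m1 where "m1 n = nat \<lfloor>0.9 * real n * ln n\<rfloor>" for n :: nat
  define m2 where "m2 n = nat \<lceil>8 * real n * ln n\<rceil>" for n :: nat
  have kp: "real n ^ 2 \<le> real n ^ (k - 1)" if "0 < n" for n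
    using k that by (intro power_increasing) auto
  define p where "p n = (1 / 2 :: real) ^ n + 1 / (real n * (1 - 1 / (real n - 1)) powr (0.9 * real n * ln n)) +
    real k * real n * (2 ^ d * exp (- 2 * ln n)) +
    (real k)\<^sup>2 * (real c * real n + 4 * (8 * real n * ln n + 1)) * (20 ^ (2 * d) * exp (- 1.805 * (0.9 * ln n - 1 / real n - real c)))" for n :: nat
  have "\<forall>\<^sub>F n in sequentially. prob (edge_order k n)
      {es. \<not> locked k d (process_graph es (hitting_time k n d es)) (vertices k n)} \<le> p n"
  proof -
    have "\<forall>\<^sub>F n in sequentially. real c * n \<le> 0.9 * real n * ln n - 1" by real_asymp
    moreover have "\<forall>\<^sub>F n in sequentially. 8 * real n * ln n + 1 \<le> real n ^ 2 / 2" by real_asymp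
    moreover have "\<forall>\<^sub>F n in sequentially. 2 * real c * n + 2 * d \<le> 0.06 * real n ^ 2" by real_asymp
    moreover have "\<forall>\<^sub>F n in sequentially. 2 * d + 4 \<le> n" by (rule eventually_ge_at_top)
    ultimately show ?thesis
    proof eventually_elim
      case (elim n)
      have n: "4 \<le> n" "2 * d \<le> n" using elim(4) by auto
      have ln0: "0 \<le> ln (real n)" using n by simp
      have nk: "real n ^ k = real n * real n ^ (k - 1)" using k by (cases k) auto
      have m1_le: "real (m1 n) \<le> 0.9 * real n * ln n"
        unfolding m1_def using ln0 by (intro of_nat_floor) simp
      have m1_ge: "real (m1 n) \<ge> 0.9 * real n * ln n - 1" unfolding m1_def using ln0 by linarith
      have m2_ge: "real (m2 n) \<ge> 8 * real n * ln n" unfolding m2_def by (rule real_nat_ceiling_ge)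
      have m2_le: "real (m2 n) \<le> 8 * real n * ln n + 1" 
      proof -
        have "0 \<le> 8 * real n * ln n" using ln0 by simp
        then have "0 \<le> \<lceil>8 * real n * ln n\<rceil>" by linarith
        then have "real (m2 n) = of_int \<lceil>8 * real n * ln n\<rceil>" unfolding m2_def by simp
        then show ?thesis using of_int_ceiling_le_add_one[of "8 * real n * ln n"] by simp
      qed
      have m0r: "real (m0 n) = real c * real n" by (simp add: m0_def)
      have le01: "m0 n \<le> m1 n"
        using elim(1) m1_ge m0r by (simp flip: of_nat_le_iff[where 'a = real])
      have nl: "0 \<le> real n * ln (real n)" using ln0 by simp
      have le12: "m1 n \<le> m2 n"
      proof -
        have "real (m1 n) \<le> real (m2 n)" using m1_le m2_ge nl by linarith
        then show ?thesis by simp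
      qed
      have m2k: "2 * real (m2 n) \<le> real n ^ (k - 1)"
        using m2_le elim(2) kp[of n] n by linarith
      have "prob (edge_order k n)
          {es. \<not> locked k d (process_graph es (hitting_time k n d es)) (vertices k n)} \<le>
        2 ^ (d * k * n) * (1 - \<epsilon> / 2) ^ m0 n +
        1 / (real n * (1 - 1 / (real n - 1)) ^ m1 n) +
        real k * real n * (2 ^ d * (1 - 1 / (4 * real n)) ^ m2 n) +
        (real k)\<^sup>2 * (real (m0 n) + 4 * real (m2 n)) * (20 ^ (2 * d) * (1 - 1.805 / real n) ^ (m1 n - m0 n))"
      proof (rule prob_not_locked[OF k d n _ \<eta>(2) _ \<epsilon> le01 le12])
        have "n ^ 1 \<le> n ^ (k - 1)" using n k by (intro power_increasing) auto
        then show "2 * d \<le> n ^ (k - 1)" using n by simp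
        have "real (m1 n) \<le> real n ^ (k - 1)" using of_nat_mono[OF le12, where 'a = real] m2k by linarith
        then show "m1 n \<le> n ^ (k - 1)" by (metis of_nat_le_iff of_nat_power)
        have "real n ^ (k - 1) \<le> real n ^ k" using n k by (intro power_increasing) auto
        then have "real (2 * m2 n) \<le> real (n ^ k)" using m2k by simp
        then show "2 * m2 n \<le> n ^ k" by (simp only: of_nat_le_iff)
        have "1.9 / real n * real n ^ k = 1.9 * real n ^ (k - 1)" using n by (simp add: nk)
        also have "\<dots> \<le> 2 * (0.98 * real n ^ (k - 1)) - 0.06 * real n ^ 2"
        proof -
          have "real n ^ 2 \<le> real n ^ (k - 1)" using n by (intro kp) simp
          moreover have "1.9 * x \<le> 2 * (0.98 * x) - 0.06 * y" if "y \<le> x" for x y :: real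
            using that by simp
          ultimately show ?thesis by blast
        qed
        also have "\<dots> \<le> 2 * ((1 - \<eta>) ^ (k - 1) * real n ^ (k - 1)) - (2 * real c * n + 2 * d)"
          using \<eta>(1) elim(3) by (intro diff_mono mult_left_mono mult_right_mono) auto
        finally show "1.9 / real n * real n ^ k \<le> 2 * ((1 - \<eta>) * real n) ^ (k - 1) - 2 * real (m0 n) - 2 * real d"
          by (simp add: m0r power_mult_distrib)
      qed (use \<eta> in auto)
      also have "\<dots> \<le> p n"
        unfolding p_def
      proof (intro add_mono)
        have "2 ^ (d * k * n) * (1 - \<epsilon> / 2) ^ m0 n = (2 ^ (d * k) * (1 - \<epsilon> / 2) ^ c) ^ n"
          by (simp add: m0_def power_mult power_mult_distrib)
        also have "\<dots> \<le> (1 / 2) ^ n" using c \<epsilon> by (intro power_mono) auto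
        finally show "2 ^ (d * k * n) * (1 - \<epsilon> / 2) ^ m0 n \<le> (1 / 2) ^ n" .
      next
        let ?b = "1 - 1 / (real n - 1)"
        have b: "0 < ?b" "?b \<le> 1" using n by (auto simp: field_simps)
        have "?b powr (0.9 * real n * ln n) \<le> ?b powr real (m1 n)"
          using m1_le b by (intro powr_mono') auto
        also have "\<dots> = ?b ^ m1 n" using b by (simp add: powr_realpow)
        finally have le: "?b powr (0.9 * real n * ln n) \<le> ?b ^ m1 n" .
        show "1 / (real n * ?b ^ m1 n) \<le> 1 / (real n * ?b powr (0.9 * real n * ln n))"
          using le b n by (intro divide_left_mono mult_left_mono mult_pos_pos) auto
      next
        have "(1 - 1 / (4 * real n)) ^ m2 n \<le> exp (- (1 / (4 * real n))) ^ m2 n"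
          using n exp_ge_add_one_self[of "- (1 / (4 * real n))"]
          by (intro power_mono) (auto simp: field_simps)
        also have "\<dots> = exp (- (real (m2 n) / (4 * real n)))" by (simp flip: exp_of_nat_mult)
        also have "\<dots> \<le> exp (- 2 * ln n)" using m2_ge n by (simp add: field_simps)
        finally show "real k * real n * (2 ^ d * (1 - 1 / (4 * real n)) ^ m2 n) \<le> real k * real n * (2 ^ d * exp (- 2 * ln n))"
          by (intro mult_left_mono) auto
      next
        have "(1 - 1.805 / real n) ^ (m1 n - m0 n) \<le> exp (- (1.805 / real n)) ^ (m1 n - m0 n)"
          using n exp_ge_add_one_self[of "- (1.805 / real n)"]
          by (intro power_mono) (auto simp: field_simps)
        also have "\<dots> = exp (- 1.805 * (real (m1 n - m0 n) / real n))" by (simp flip: exp_of_nat_mult)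
        also have "\<dots> \<le> exp (- 1.805 * (0.9 * ln n - 1 / real n - real c))"
        proof -
          have "0.9 * ln n - 1 / real n - real c = (0.9 * real n * ln n - 1 - real c * real n) / real n"
            using n by (simp add: field_simps)
          also have "\<dots> \<le> real (m1 n - m0 n) / n"
            using m1_ge m0r le01 by (intro divide_right_mono) (auto simp: of_nat_diff)
          finally show ?thesis by simp
        qed
        finally show "(real k)\<^sup>2 * (real (m0 n) + 4 * real (m2 n)) * (20 ^ (2 * d) * (1 - 1.805 / real n) ^ (m1 n - m0 n)) \<le>
          (real k)\<^sup>2 * (real c * real n + 4 * (8 * real n * ln n + 1)) * (20 ^ (2 * d) * exp (- 1.805 * (0.9 * ln n - 1 / real n - real c)))"
          using m2_le m0r n ln0 by (intro mult_mono mult_left_mono) (auto simp: field_simps)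
      qed
      finally show ?case .
    qed
  qed
  moreover have "p \<longlonglongrightarrow> 0"
  proof -
    have 1: "(\<lambda>n. (1 / 2 :: real) ^ n) \<longlonglongrightarrow> 0" by real_asymp
    have 2: "(\<lambda>n. 1 / (real n * (1 - 1 / (real n - 1)) powr (0.9 * real n * ln n))) \<longlonglongrightarrow> 0" by real_asymp
    have "(\<lambda>n. real n * exp (- 2 * ln n)) \<longlonglongrightarrow> 0" by real_asymp
    then have 3: "(\<lambda>n. real k * 2 ^ d * (real n * exp (- 2 * ln n))) \<longlonglongrightarrow> 0" by (rule tendsto_mult_right_zero)
    have "(\<lambda>n. (real c * real n + 4 * (8 * real n * ln n + 1)) * exp (- 1.805 * (0.9 * ln n - 1 / real n - real c))) \<longlonglongrightarrow> 0"
      by real_asymp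
    then have 4: "(\<lambda>n. (real k)\<^sup>2 * 20 ^ (2 * d) * ((real c * real n + 4 * (8 * real n * ln n + 1)) *
        exp (- 1.805 * (0.9 * ln n - 1 / real n - real c)))) \<longlonglongrightarrow> 0" by (rule tendsto_mult_right_zero)
    have "p = (\<lambda>n. (1 / 2) ^ n + 1 / (real n * (1 - 1 / (real n - 1)) powr (0.9 * real n * ln n)) +
        real k * 2 ^ d * (real n * exp (- 2 * ln n)) +
        (real k)\<^sup>2 * 20 ^ (2 * d) * ((real c * real n + 4 * (8 * real n * ln n + 1)) *
        exp (- 1.805 * (0.9 * ln n - 1 / real n - real c))))"
      unfolding p_def by (simp only: mult.assoc mult.left_commute)
    then show ?thesis
      using tendsto_add[OF tendsto_add[OF tendsto_add[OF 1 2] 3] 4] by (simp only: add_0_left)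
  qed
  ultimately show ?thesis
    by (rule tendsto_sandwich[rotated 1, OF _ tendsto_const]) simp
qed

lemma locally_rigid_whp:
  assumes k: "3 \<le> k" and d: "0 < d"
  shows "(\<lambda>n. prob (edge_order k n)
      {es. locally_rigid TYPE('a::real_normed_field) k n d (process_graph es (hitting_time k n d es))}) \<longlonglongrightarrow> 1"
proof -
  let ?G = "\<lambda>n es. process_graph es (hitting_time k n d es)"
  let ?A = "\<lambda>n. {es. \<not> locked k d (?G n es) (vertices k n)}"
  have "(\<lambda>n. 1 - prob (edge_order k n) (?A n)) \<longlonglongrightarrow> 1 - 0"
    by (intro tendsto_diff tendsto_const locked_whp[OF k d])
  then have lim: "(\<lambda>n. 1 - prob (edge_order k n) (?A n)) \<longlonglongrightarrow> 1" by simp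
  have "1 - prob (edge_order k n) (?A n) \<le>
      prob (edge_order k n) {es. locally_rigid TYPE('a) k n d (?G n es)}" if n: "0 < n" for n
  proof -
    have "1 - prob (edge_order k n) (?A n) = prob (edge_order k n) (- ?A n)"
      using measure_pmf.prob_compl[of "?A n" "edge_order k n"] by (simp add: Compl_eq_Diff_UNIV)
    also have "\<dots> \<le> prob (edge_order k n) {es. locally_rigid TYPE('a) k n d (?G n es)}"
    proof (rule measure_pmf.finite_measure_mono_AE)
      show "AE es in measure_pmf (edge_order k n). es \<in> - ?A n \<longrightarrow>
          es \<in> {es. locally_rigid TYPE('a) k n d (?G n es)}"
        unfolding AE_measure_pmf_iff edge_order_eq set_random_order[OF finite_complete_edges]
      proof (intro ballI impI)
        fix es assume es: "es \<in> permutations_of_set (complete_edges k n)" and l: "es \<in> - ?A n"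
        have "?G n es \<subseteq> complete_edges k n"
          unfolding process_graph_def
          using set_take_subset permutations_of_setD(1)[OF es] by (metis (no_types))
        then show "es \<in> {es. locally_rigid TYPE('a) k n d (?G n es)}"
          using l k n locked_imp_locally_rigid[of k d "?G n es" n] by simp
      qed
    qed simp
    finally show ?thesis .
  qed
  then have "\<forall>\<^sub>F n in sequentially. 1 - prob (edge_order k n) (?A n) \<le>
      prob (edge_order k n) {es. locally_rigid TYPE('a) k n d (?G n es)}"
    by (intro eventually_mono[OF eventually_gt_at_top[of 0]])
  then show ?thesis
    by (rule tendsto_sandwich[OF _ _ lim tendsto_const]) simp
qed

theorem theorem6p2:
  fixes d k :: nat
  assumes "d \<ge> 1" and "k \<ge> 3"
  shows "(\<lambda>n. measure_pmf.prob (edge_order k n)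
            {es. locally_rigid TYPE(real) k n d (process_graph es (hitting_time k n d es))})
          \<longlonglongrightarrow> 1
       \<and> (\<lambda>n. measure_pmf.prob (edge_order k n)
            {es. locally_rigid TYPE(complex) k n d (process_graph es (hitting_time k n d es))})
          \<longlonglongrightarrow> 1"
  using assms locally_rigid_whp[where 'a = real, of k d] locally_rigid_whp[where 'a = complex, of k d] by simp


end
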